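(* Let $p$ be an odd prime and let $i\in\mathbb{F}_p\setminus\{0\}$. There is a Hopf algebra structure $(U_c(\mathfrak{D})[t], m, \Delta, S, \varepsilon)$ over $\mathbb{F}_p[t]$ on $U_c(\mathfrak{D})[t]$ which is a polynomial deformation of the restricted enveloping algebra $U_c(\mathfrak{D})$, in which the algebra structure is undeformed and the coalgebra structure and antipode are given, for all $k\in\mathbb{F}_p$, by $$\Delta(D_k) = D_k\otimes (1-et)^{\frac{k}{i}} + \sum_{l=0}^{p-1} (-1)^l\, N(i,k-i,l)\; h^{(l)}\otimes (1-et)^{-l} D_{k+li}\, t^l ,$$ $$S(D_k) = -(1-et)^{-\frac{k}{i}} \sum_{l=0}^{p-1} N(i,k-i,l)\; D_{k+li}\,(h+1)^{(l)}\, t^l ,$$ $$\varepsilon(D_k)=0 ,$$ where $h:=\frac{1}{i}D_0$ and $e:=iD_i$.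
   Context: $\mathfrak{D}$ is the $\mathbb{F}_p$-Lie algebra given by generators $D_k$, $k\in\mathbb{Z}$, and relations $[D_k,D_l]=(l-k)D_{k+l}$ and $D_{k+p}=D_k$ (the Witt algebra in characteristic $p$, isomorphic to $\mathrm{Der}(\mathbb{F}_p[X]/(X^p-1))$ with $D_k$ corresponding to $X^{k+1}\frac{d}{dX}$); thus $D_k$ is well defined for $k\in\mathbb{F}_p$ and $\dim\mathfrak{D}=p$. Its restricted enveloping algebra is $U_c(\mathfrak{D})=U(\mathfrak{D})/I$, where $I$ is the two-sided ideal generated by $D_0^p-D_0$ and by $D_k^p$ for $k\neq 0$ in $\mathbb{F}_p$; it has dimension $p^p$ and is a Hopf algebra with the $D_k$ primitive. "Polynomial deformation" means that the structure is defined over the polynomial ring $\mathbb{F}_p[t]$ on $U_c(\mathfrak{D})[t]=U_c(\mathfrak{D})\otimes\mathbb{F}_p[t]$ and reduces at $t=0$ to the standard Hopf algebra structure on $U_c(\mathfrak{D})$; $m$ is the $\mathbb{F}_p[t]$-linear extension of the product of $U_c(\mathfrak{D})$. For $x$ in a unital algebra and $n\ge0$, $x^{(n)}:=x(x+1)\cdots(x+n-1)$, with $x^{(0)}=1$. Since $e^p=0$ in $U_c(\mathfrak{D})$, one has $(1-et)^p=1$, so $(1-et)^c$ is well defined for $c\in\mathbb{F}_p$ (via any integer lift of $c$). For $a,b\in\mathbb{F}_p$ and an integer $0\le l\le p-1$, $N(a,b,l)\in\mathbb{F}_p$ denotes the residue class modulo $p$ of the integer $\alpha^l\,\frac{\prod_{j=0}^{l-1}(\kappa+j\alpha)}{l!}$,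 where $\alpha,\kappa$ are any integers with residue classes $a,b$ respectively; this does not depend on the choice of $\alpha,\kappa$. *)

theory Defs
  imports
    "HOL-Library.Poly_Mapping"
    "HOL-Computational_Algebra.Polynomial"
    "Berlekamp_Zassenhaus.Finite_Field"
begin

text \<open>
  The prime field is the type \<^typ>\<open>'p mod_ring\<close> with \<open>'p\<close> of class \<open>prime_card\<close>, so that
  \<open>p = CARD('p)\<close>. The free module over a commutative ring \<open>'r\<close> on a set of generators \<open>'x\<close> is
  the type \<open>'x \<Rightarrow>\<^sub>0 'r\<close> of finitely supported functions; \<open>single x 1\<close> is the generator \<open>x\<close>.
\<close>

text \<open>Otherwise \<open>lift_definition\<close> would unfold \<^typ>\<open>'p mod_ring\<close> to integers; likewise below for
  quotients of quotients.\<close>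

lifting_forget mod_ring.lifting

section \<open>Free modules and two-sided ideals\<close>

abbreviation single :: "'x \<Rightarrow> 'r \<Rightarrow> ('x \<Rightarrow>\<^sub>0 'r::zero)"
  where "single \<equiv> Poly_Mapping.single"

abbreviation lookup :: "('x \<Rightarrow>\<^sub>0 'r::zero) \<Rightarrow> 'x \<Rightarrow> 'r"
  where "lookup \<equiv> Poly_Mapping.lookup"

definition free_scale :: "'r::comm_ring_1 \<Rightarrow> ('x \<Rightarrow>\<^sub>0 'r) \<Rightarrow> ('x \<Rightarrow>\<^sub>0 'r)"
  where "free_scale c x = Poly_Mapping.map ((*) c) x"

lemma lookup_free_scale [simp]: "lookup (free_scale c x) k = c * lookup x k"
  unfolding free_scale_def by (simp add: Poly_Mapping.map.rep_eq when_def)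

lemma module_free_scale: "Modules.module free_scale"
  by standard (auto intro!: poly_mapping_eqI simp: lookup_add algebra_simps)

text \<open>The linear map from a free module to the module with scalar action \<open>scale\<close> that sends each
  generator \<open>k\<close> to \<open>f k\<close>.\<close>

definition linear_extension ::
    "('r::zero \<Rightarrow> 'm \<Rightarrow> 'm) \<Rightarrow> ('x \<Rightarrow> 'm) \<Rightarrow> ('x \<Rightarrow>\<^sub>0 'r) \<Rightarrow> 'm::comm_monoid_add"
  where "linear_extension scale f x = (\<Sum>k\<in>Poly_Mapping.keys x. scale (lookup x k) (f k))"

inductive_set two_sided_ideal :: "'a::ring_1 set \<Rightarrow> 'a set" for R :: "'a set" where
  zero: "0 \<in> two_sided_ideal R"
| gen: "r \<in> R \<Longrightarrow> r \<in> two_sided_ideal R"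
| add: "x \<in> two_sided_ideal R \<Longrightarrow> y \<in> two_sided_ideal R \<Longrightarrow> x + y \<in> two_sided_ideal R"
| left: "x \<in> two_sided_ideal R \<Longrightarrow> a * x \<in> two_sided_ideal R"
| right: "x \<in> two_sided_ideal R \<Longrightarrow> x * a \<in> two_sided_ideal R"

lemma two_sided_ideal_uminus: "x \<in> two_sided_ideal R \<Longrightarrow> - x \<in> two_sided_ideal R"
  using two_sided_ideal.left[of x R "-1"] by simp

lemma two_sided_ideal_diff:
  "x \<in> two_sided_ideal R \<Longrightarrow> y \<in> two_sided_ideal R \<Longrightarrow> x - y \<in> two_sided_ideal R"
  using two_sided_ideal.add[of x R "- y"] two_sided_ideal_uminus[of y R] by simp

lemma equivp_two_sided_ideal: "equivp (\<lambda>x y. x - y \<in> two_sided_ideal R)"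
proof (rule equivpI)
  show "reflp (\<lambda>x y. x - y \<in> two_sided_ideal R)"
    by (simp add: reflp_def two_sided_ideal.zero)
  show "symp (\<lambda>x y. x - y \<in> two_sided_ideal R)"
  proof (rule sympI)
    fix x y assume "x - y \<in> two_sided_ideal R"
    from two_sided_ideal_uminus[OF this] show "y - x \<in> two_sided_ideal R" by simp
  qed
  show "transp (\<lambda>x y. x - y \<in> two_sided_ideal R)"
  proof (rule transpI)
    fix x y z assume "x - y \<in> two_sided_ideal R" "y - z \<in> two_sided_ideal R"
    from two_sided_ideal.add[OF this] show "x - z \<in> two_sided_ideal R" by simp
  qed
qed

lemma two_sided_ideal_add_cong:
  assumes "x - x' \<in> two_sided_ideal R" "y - y' \<in> two_sided_ideal R"
  shows "x + y - (x' + y') \<in> two_sided_ideal R"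
  using two_sided_ideal.add[OF assms] by (simp add: algebra_simps)

lemma two_sided_ideal_diff_cong:
  assumes "x - x' \<in> two_sided_ideal R" "y - y' \<in> two_sided_ideal R"
  shows "x - y - (x' - y') \<in> two_sided_ideal R"
  using two_sided_ideal_diff[OF assms] by (simp add: algebra_simps)

lemma two_sided_ideal_uminus_cong:
  assumes "x - x' \<in> two_sided_ideal R"
  shows "- x - (- x') \<in> two_sided_ideal R"
  using two_sided_ideal_uminus[OF assms] by simp

lemma two_sided_ideal_mult_cong:
  assumes "x - x' \<in> two_sided_ideal R" "y - y' \<in> two_sided_ideal R"
  shows "x * y - x' * y' \<in> two_sided_ideal R"
proof -
  have "(x - x') * y + x' * (y - y') \<in> two_sided_ideal R"
    by (intro two_sided_ideal.add two_sided_ideal.left two_sided_ideal.right assms)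
  then show ?thesis by (simp add: algebra_simps)
qed

lemma two_sided_ideal_kernel:
  assumes "x \<in> two_sided_ideal R" "\<And>r. r \<in> R \<Longrightarrow> f r = 0" "f 0 = 0"
    and "\<And>x y. f (x + y) = f x + f y" "\<And>x y. f (x * y) = f x * f y"
  shows "f x = (0::'b::ring_1)"
  using assms(1) by induction (simp_all add: assms)


section \<open>The Witt algebra by generators and relations\<close>

text \<open>The free module on nonassociative words is the free nonassociative algebra; its quotient
  by the Lie ideal below is the Lie algebra presented by the generators \<open>'x\<close> and the relators \<open>R\<close>.\<close>

datatype 'x lie_word = Gen 'x | Bracket "'x lie_word" "'x lie_word"

definition formal_bracket ::
    "('x lie_word \<Rightarrow>\<^sub>0 'r::comm_ring_1) \<Rightarrow> ('x lie_word \<Rightarrow>\<^sub>0 'r) \<Rightarrow> ('x lie_word \<Rightarrow>\<^sub>0 'r)"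
  where "formal_bracket x y =
    linear_extension free_scale
      (\<lambda>u. linear_extension free_scale (\<lambda>v. single (Bracket u v) 1) y) x"

inductive_set lie_ideal ::
    "('x lie_word \<Rightarrow>\<^sub>0 'r::comm_ring_1) set \<Rightarrow> ('x lie_word \<Rightarrow>\<^sub>0 'r) set"
  for R :: "('x lie_word \<Rightarrow>\<^sub>0 'r) set" where
  zero: "0 \<in> lie_ideal R"
| gen: "r \<in> R \<Longrightarrow> r \<in> lie_ideal R"
| alternating: "formal_bracket x x \<in> lie_ideal R"
| jacobi: "formal_bracket x (formal_bracket y z) + formal_bracket y (formal_bracket z x)
    + formal_bracket z (formal_bracket x y) \<in> lie_ideal R"
| add: "x \<in> lie_ideal R \<Longrightarrow> y \<in> lie_ideal R \<Longrightarrow> x + y \<in> lie_ideal R"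
| scale: "x \<in> lie_ideal R \<Longrightarrow> free_scale c x \<in> lie_ideal R"
| left: "x \<in> lie_ideal R \<Longrightarrow> formal_bracket a x \<in> lie_ideal R"
| right: "x \<in> lie_ideal R \<Longrightarrow> formal_bracket x a \<in> lie_ideal R"

definition witt_relators :: "(int lie_word \<Rightarrow>\<^sub>0 'p::prime_card mod_ring) set"
  where "witt_relators =
    {formal_bracket (single (Gen k) 1) (single (Gen l) 1) - single (Gen (k + l)) (of_int (l - k))
      | k l. True}
    \<union> {single (Gen (k + int CARD('p))) 1 - single (Gen k) 1 | k. True}"

lemma lie_ideal_uminus:
  fixes x :: "'x lie_word \<Rightarrow>\<^sub>0 'r::comm_ring_1"
  assumes "x \<in> lie_ideal R" shows "- x \<in> lie_ideal R"
proof -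
  interpret Modules.module "free_scale :: 'r \<Rightarrow> ('x lie_word \<Rightarrow>\<^sub>0 'r) \<Rightarrow> _"
    by (rule module_free_scale)
  show ?thesis using lie_ideal.scale[OF assms, of "-1"] by simp
qed

lemma lie_ideal_diff: "x \<in> lie_ideal R \<Longrightarrow> y \<in> lie_ideal R \<Longrightarrow> x - y \<in> lie_ideal R"
  using lie_ideal.add[of x R "- y"] lie_ideal_uminus[of y R] by simp

lemma linear_extension_superset:
  assumes "Modules.module scale" "finite A" "Poly_Mapping.keys x \<subseteq> A"
  shows "linear_extension scale f x = (\<Sum>k\<in>A. scale (lookup x k) (f k))"
proof -
  interpret Modules.module scale by fact
  show ?thesis unfolding linear_extension_def
    by (rule sum.mono_neutral_left) (use assms in \<open>auto simp: in_keys_iff\<close>)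
qed

lemma linear_extension_add:
  assumes "Modules.module scale"
  shows "linear_extension scale f (x + y) = linear_extension scale f x + linear_extension scale f y"
proof -
  interpret Modules.module scale by fact
  let ?A = "Poly_Mapping.keys x \<union> Poly_Mapping.keys y"
  have "linear_extension scale f (x + y) = (\<Sum>k\<in>?A. scale (lookup (x + y) k) (f k))"
    by (rule linear_extension_superset) (use assms Poly_Mapping.keys_add[of x y] in auto)
  also have "\<dots> = (\<Sum>k\<in>?A. scale (lookup x k) (f k)) + (\<Sum>k\<in>?A. scale (lookup y k) (f k))"
    by (simp add: lookup_add scale_left_distrib sum.distrib)
  also have "\<dots> = linear_extension scale f x + linear_extension scale f y"
    by (simp add: linear_extension_superset[OF assms, of ?A])
  finally show ?thesis .
qed

lemma linear_extension_diff:
  assumes "Modules.module scale"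
  shows "linear_extension scale f (x - y) = linear_extension scale f x - linear_extension scale f y"
  using linear_extension_add[OF assms, of f "x - y" y] by (simp add: algebra_simps)

lemma linear_extension_fun_diff:
  assumes "Modules.module scale"
  shows "linear_extension scale (\<lambda>k. f k - g k) x
    = linear_extension scale f x - linear_extension scale g x"
proof -
  interpret Modules.module scale by fact
  show ?thesis
    by (simp add: linear_extension_def scale_right_diff_distrib sum_subtractf)
qed

lemma formal_bracket_diff_left:
  "formal_bracket (x - x') y = formal_bracket x y - formal_bracket x' y"
  unfolding formal_bracket_def by (rule linear_extension_diff[OF module_free_scale])

lemma formal_bracket_diff_right:
  "formal_bracket x (y - y') = formal_bracket x y - formal_bracket x y'"
  unfolding formal_bracket_def
  by (simp add: linear_extension_diff[OF module_free_scale]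
      linear_extension_fun_diff[OF module_free_scale])

lemma lie_ideal_bracket_cong:
  assumes "x - x' \<in> lie_ideal R" "y - y' \<in> lie_ideal R"
  shows "formal_bracket x y - formal_bracket x' y' \<in> lie_ideal R"
proof -
  have "formal_bracket (x - x') y + formal_bracket x' (y - y') \<in> lie_ideal R"
    by (intro lie_ideal.add lie_ideal.left lie_ideal.right assms)
  then show ?thesis by (simp add: formal_bracket_diff_left formal_bracket_diff_right)
qed

quotient_type 'p witt = "int lie_word \<Rightarrow>\<^sub>0 'p::prime_card mod_ring" /
  "\<lambda>x y. x - y \<in> lie_ideal witt_relators"
proof (rule equivpI)
  let ?I = "lie_ideal (witt_relators :: (int lie_word \<Rightarrow>\<^sub>0 'p mod_ring) set)"
  show "reflp (\<lambda>x y. x - y \<in> ?I)"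
    by (simp add: reflp_def lie_ideal.zero)
  show "symp (\<lambda>x y. x - y \<in> ?I)"
  proof (rule sympI)
    fix x y assume "x - y \<in> ?I"
    from lie_ideal_uminus[OF this] show "y - x \<in> ?I" by simp
  qed
  show "transp (\<lambda>x y. x - y \<in> ?I)"
  proof (rule transpI)
    fix x y z assume "x - y \<in> ?I" "y - z \<in> ?I"
    from lie_ideal.add[OF this] show "x - z \<in> ?I" by simp
  qed
qed

instantiation witt :: (prime_card) ab_group_add
begin

lift_definition zero_witt :: "'a witt" is 0 .

lift_definition plus_witt :: "'a witt \<Rightarrow> 'a witt \<Rightarrow> 'a witt" is "(+)"
  subgoal for x x' y y'
    using lie_ideal.add[of "x - x'" witt_relators "y - y'"] by (simp add: algebra_simps)
  done

lift_definition minus_witt :: "'a witt \<Rightarrow> 'a witt \<Rightarrow> 'a witt" is "(-)"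
  subgoal for x x' y y'
    using lie_ideal_diff[of "x - x'" witt_relators "y - y'"] by (simp add: algebra_simps)
  done

lift_definition uminus_witt :: "'a witt \<Rightarrow> 'a witt" is uminus
  subgoal for x x'
    using lie_ideal_uminus[of "x - x'" witt_relators] by simp
  done

instance
  by standard (transfer; simp add: lie_ideal.zero algebra_simps)+

end

lift_definition witt_scale :: "'p mod_ring \<Rightarrow> 'p::prime_card witt \<Rightarrow> 'p witt" is free_scale
proof -
  fix c :: "'p mod_ring" and x y :: "int lie_word \<Rightarrow>\<^sub>0 'p mod_ring"
  interpret Modules.module "free_scale :: 'p mod_ring \<Rightarrow> (int lie_word \<Rightarrow>\<^sub>0 'p mod_ring) \<Rightarrow> _"
    by (rule module_free_scale)
  assume "x - y \<in> lie_ideal witt_relators"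
  from lie_ideal.scale[OF this, of c]
  show "free_scale c x - free_scale c y \<in> lie_ideal witt_relators"
    by (simp add: scale_right_diff_distrib)
qed

lift_definition witt_bracket :: "'p::prime_card witt \<Rightarrow> 'p witt \<Rightarrow> 'p witt" is formal_bracket
  by (rule lie_ideal_bracket_cong)

lift_definition witt_gen :: "int \<Rightarrow> 'p::prime_card witt" is "\<lambda>k. single (Gen k) 1" .

lemma witt_bracket_gen:
  "witt_bracket (witt_gen k) (witt_gen l) = witt_scale (of_int (l - k)) (witt_gen (k + l))"
proof transfer
  fix k l
  have "free_scale (of_int (l - k)) (single (Gen (k + l)) 1)
      = single (Gen (k + l)) (of_int (l - k) :: 'a mod_ring)"
    by (rule poly_mapping_eqI) (simp add: lookup_single when_def)
  then show "formal_bracket (single (Gen k) 1) (single (Gen l) 1)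
    - free_scale (of_int (l - k)) (single (Gen (k + l)) (1::'a mod_ring))
      \<in> lie_ideal witt_relators"
    by (auto intro!: lie_ideal.gen simp: witt_relators_def)
qed

lemma witt_gen_periodic: "witt_gen (k + int CARD('p)) = (witt_gen k :: 'p::prime_card witt)"
  by transfer (rule lie_ideal.gen, auto simp: witt_relators_def)

lemma witt_bracket_self: "witt_bracket x x = 0"
  by transfer (simp add: lie_ideal.alternating)

lemma witt_jacobi:
  "witt_bracket x (witt_bracket y z) + witt_bracket y (witt_bracket z x)
    + witt_bracket z (witt_bracket x y) = 0"
  by transfer (simp add: lie_ideal.jacobi)


section \<open>The restricted enveloping algebra\<close>

text \<open>With lists as the free monoid, \<open>'x list \<Rightarrow>\<^sub>0 'r\<close> with the convolution product of
  \<^theory>\<open>HOL-Library.Poly_Mapping\<close> is the free associative unital algebra on \<open>'x\<close>; here \<open>'x\<close>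
  is the underlying set of a Lie algebra.\<close>

instantiation list :: (type) monoid_add
begin
definition zero_list :: "'a list" where "zero_list = []"
definition plus_list :: "'a list \<Rightarrow> 'a list \<Rightarrow> 'a list" where "plus_list = append"
instance by standard (simp_all add: zero_list_def plus_list_def)
end

lifting_forget witt.lifting

definition enveloping_relators ::
    "('r \<Rightarrow> 'l \<Rightarrow> 'l) \<Rightarrow> ('l \<Rightarrow> 'l \<Rightarrow> 'l) \<Rightarrow> ('l::ab_group_add list \<Rightarrow>\<^sub>0 'r::comm_ring_1) set"
  where "enveloping_relators scale bracket =
    {single [x + y] 1 - single [x] 1 - single [y] 1 | x y. True}
    \<union> {single [scale c x] 1 - single [x] c | c x. True}
    \<union> {single [x] 1 * single [y] 1 - single [y] 1 * single [x] 1 - single [bracket x y] 1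
        | x y. True}"

quotient_type 'p U_witt = "'p::prime_card witt list \<Rightarrow>\<^sub>0 'p mod_ring" /
  "\<lambda>x y. x - y \<in> two_sided_ideal (enveloping_relators witt_scale witt_bracket)"
  by (rule equivp_two_sided_ideal)

text \<open>The constant coefficient of a noncommutative polynomial is multiplicative and vanishes on
  all relators; it is used to see that the quotients are nontrivial.\<close>

lemma lookup_Nil_mult:
  fixes x y :: "'x list \<Rightarrow>\<^sub>0 'r::comm_ring_1"
  shows "lookup (x * y) [] = lookup x [] * lookup y []"
proof -
  have nil: "([] = u + v) = (u = [] \<and> v = [])" for u v :: "'x list"
    by (auto simp: plus_list_def)
  have "Sum_any (\<lambda>v. lookup y v when [] = u + v) = (lookup y [] when u = [])" for u
    by (cases "u = []") (simp_all add: nil)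
  then have "lookup (x * y) [] = Sum_any (\<lambda>u. lookup x u * (lookup y [] when u = []))"
    by (simp add: lookup_mult)
  also have "(\<lambda>u. lookup x u * (lookup y [] when u = []))
      = (\<lambda>u. (lookup x u * lookup y []) when u = [])"
    by (simp add: when_def fun_eq_iff)
  finally show ?thesis by simp
qed

lemma lookup_Nil_enveloping_ideal:
  assumes "x \<in> two_sided_ideal (enveloping_relators scale bracket)"
  shows "lookup x [] = 0"
  by (rule two_sided_ideal_kernel[OF assms, of "\<lambda>x. lookup x []"])
    (auto simp: enveloping_relators_def lookup_minus lookup_single lookup_add lookup_Nil_mult)

instantiation U_witt :: (prime_card) ring_1
begin

lift_definition zero_U_witt :: "'a U_witt" is 0 .
lift_definition one_U_witt :: "'a U_witt" is 1 .
lift_definition plus_U_witt :: "'a U_witt \<Rightarrow> 'a U_witt \<Rightarrow> 'a U_witt" is "(+)"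
  by (rule two_sided_ideal_add_cong)
lift_definition minus_U_witt :: "'a U_witt \<Rightarrow> 'a U_witt \<Rightarrow> 'a U_witt" is "(-)"
  by (rule two_sided_ideal_diff_cong)
lift_definition uminus_U_witt :: "'a U_witt \<Rightarrow> 'a U_witt" is uminus
  by (rule two_sided_ideal_uminus_cong)
lift_definition times_U_witt :: "'a U_witt \<Rightarrow> 'a U_witt \<Rightarrow> 'a U_witt" is "(*)"
  by (rule two_sided_ideal_mult_cong)

instance
proof
  show "(0::'a U_witt) \<noteq> 1"
    by transfer (auto dest!: lookup_Nil_enveloping_ideal
        simp: lookup_minus lookup_one zero_list_def)
qed (transfer; simp add: two_sided_ideal.zero algebra_simps)+

end

lift_definition U_const :: "'p mod_ring \<Rightarrow> 'p::prime_card U_witt" is "\<lambda>c. single [] c" .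

lift_definition U_incl :: "'p::prime_card witt \<Rightarrow> 'p U_witt" is "\<lambda>x. single [x] 1" .

lift_definition U_augmentation :: "'p::prime_card U_witt \<Rightarrow> 'p mod_ring" is "\<lambda>x. lookup x []"
  by (auto dest!: lookup_Nil_enveloping_ideal simp: lookup_minus)

lemma U_augmentation_simps:
  "U_augmentation 0 = 0" "U_augmentation 1 = 1"
  "U_augmentation (x + y) = U_augmentation x + U_augmentation y"
  "U_augmentation (x - y) = U_augmentation x - U_augmentation y"
  "U_augmentation (- x) = - U_augmentation x"
  "U_augmentation (x * y) = U_augmentation x * U_augmentation y"
  "U_augmentation (U_incl a) = 0"
  by (transfer; simp add: lookup_add lookup_minus lookup_Nil_mult lookup_one lookup_single
      zero_list_def)+

lifting_forget U_witt.lifting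

definition restricted_relators :: "'p::prime_card U_witt set"
  where "restricted_relators =
    {U_incl (witt_gen 0) ^ CARD('p) - U_incl (witt_gen 0)}
    \<union> {U_incl (witt_gen k) ^ CARD('p) | k. \<not> int CARD('p) dvd k}"

quotient_type 'p Uc = "'p::prime_card U_witt" /
  "\<lambda>x y. x - y \<in> two_sided_ideal restricted_relators"
  by (rule equivp_two_sided_ideal)

lemma U_augmentation_power: "U_augmentation (x ^ n) = U_augmentation x ^ n"
  by (induction n) (simp_all add: U_augmentation_simps)

lemma U_augmentation_restricted_ideal:
  assumes "x \<in> two_sided_ideal restricted_relators"
  shows "U_augmentation x = 0"
  by (rule two_sided_ideal_kernel[OF assms, of U_augmentation])
    (auto simp: restricted_relators_def U_augmentation_simps U_augmentation_power)

instantiation Uc :: (prime_card) ring_1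
begin

lift_definition zero_Uc :: "'a Uc" is 0 .
lift_definition one_Uc :: "'a Uc" is 1 .
lift_definition plus_Uc :: "'a Uc \<Rightarrow> 'a Uc \<Rightarrow> 'a Uc" is "(+)"
  by (rule two_sided_ideal_add_cong)
lift_definition minus_Uc :: "'a Uc \<Rightarrow> 'a Uc \<Rightarrow> 'a Uc" is "(-)"
  by (rule two_sided_ideal_diff_cong)
lift_definition uminus_Uc :: "'a Uc \<Rightarrow> 'a Uc" is uminus
  by (rule two_sided_ideal_uminus_cong)
lift_definition times_Uc :: "'a Uc \<Rightarrow> 'a Uc \<Rightarrow> 'a Uc" is "(*)"
  by (rule two_sided_ideal_mult_cong)

instance
proof
  show "(0::'a Uc) \<noteq> 1"
    by transfer (auto dest!: U_augmentation_restricted_ideal simp: U_augmentation_simps)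
qed (transfer; simp add: two_sided_ideal.zero algebra_simps)+

end

lift_definition Uc_const :: "'p mod_ring \<Rightarrow> 'p::prime_card Uc" is U_const .

definition Uc_scale :: "'p mod_ring \<Rightarrow> 'p::prime_card Uc \<Rightarrow> 'p Uc"
  where "Uc_scale c x = Uc_const c * x"

lift_definition Uc_of_witt :: "'p::prime_card witt \<Rightarrow> 'p Uc" is U_incl .

text \<open>By periodicity, any other integer lift of the index gives the same element.\<close>

definition Uc_D :: "'p::prime_card mod_ring \<Rightarrow> 'p Uc"
  where "Uc_D k = Uc_of_witt (witt_gen (to_int_mod_ring k))"

text \<open>Univariate polynomials over the noncommutative ring \<open>Uc\<close>, in a central indeterminate
  (the type constructor \<open>poly\<close> has a product over commutative rings only).\<close>

type_synonym 'p Uct = "nat \<Rightarrow>\<^sub>0 'p Uc"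

definition Uct_const :: "'p::prime_card Uc \<Rightarrow> 'p Uct"
  where "Uct_const x = single 0 x"

definition Uct_t :: "'p::prime_card Uct"
  where "Uct_t = single 1 1"

definition Uct_scale :: "'p mod_ring poly \<Rightarrow> 'p::prime_card Uct \<Rightarrow> 'p Uct"
  where "Uct_scale f x = (\<Sum>n\<le>degree f. single n (Uc_const (coeff f n))) * x"

definition Uct_D :: "'p::prime_card mod_ring \<Rightarrow> 'p Uct"
  where "Uct_D k = Uct_const (Uc_D k)"


section \<open>Hopf algebras over a commutative ring\<close>

text \<open>The tensor square of the module \<open>'a\<close> over \<open>'r\<close> is the quotient of the free module on
  \<open>'a \<times> 'a\<close> by the submodule of bilinearity relations, \<open>single (a, b) c\<close> representing
  \<open>c (a \<otimes> b)\<close>; its elements are equivalence classes of formal tensors. The tensor cube is the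
  analogous quotient of the free module on triples.\<close>

definition tensor_relators ::
    "('r::comm_ring_1 \<Rightarrow> 'a::ab_group_add \<Rightarrow> 'a) \<Rightarrow> ('a \<times> 'a \<Rightarrow>\<^sub>0 'r) set"
  where "tensor_relators scale =
    {single (a + a', b) 1 - single (a, b) 1 - single (a', b) 1 | a a' b. True}
    \<union> {single (a, b + b') 1 - single (a, b) 1 - single (a, b') 1 | a b b'. True}
    \<union> {single (scale c a, b) 1 - single (a, b) c | c a b. True}
    \<union> {single (a, scale c b) 1 - single (a, b) c | c a b. True}"

definition tensor_rel ::
    "('r::comm_ring_1 \<Rightarrow> 'a::ab_group_add \<Rightarrow> 'a) \<Rightarrow> ('a \<times> 'a \<Rightarrow>\<^sub>0 'r) rel"
  where "tensor_rel scale = {(x, y). x - y \<in> Modules.module.span free_scale (tensor_relators scale)}"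

definition tensor_class ::
    "('r::comm_ring_1 \<Rightarrow> 'a::ab_group_add \<Rightarrow> 'a) \<Rightarrow> ('a \<times> 'a \<Rightarrow>\<^sub>0 'r) \<Rightarrow> ('a \<times> 'a \<Rightarrow>\<^sub>0 'r) set"
  where "tensor_class scale x = tensor_rel scale `` {x}"

definition tensor3_relators ::
    "('r::comm_ring_1 \<Rightarrow> 'a::ab_group_add \<Rightarrow> 'a) \<Rightarrow> ('a \<times> 'a \<times> 'a \<Rightarrow>\<^sub>0 'r) set"
  where "tensor3_relators scale =
    {single (a + a', b, c) 1 - single (a, b, c) 1 - single (a', b, c) 1 | a a' b c. True}
    \<union> {single (a, b + b', c) 1 - single (a, b, c) 1 - single (a, b', c) 1 | a b b' c. True}
    \<union> {single (a, b, c + c') 1 - single (a, b, c) 1 - single (a, b, c') 1 | a b c c'. True}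
    \<union> {single (scale r a, b, c) 1 - single (a, b, c) r | r a b c. True}
    \<union> {single (a, scale r b, c) 1 - single (a, b, c) r | r a b c. True}
    \<union> {single (a, b, scale r c) 1 - single (a, b, c) r | r a b c. True}"

definition tensor3_rel ::
    "('r::comm_ring_1 \<Rightarrow> 'a::ab_group_add \<Rightarrow> 'a) \<Rightarrow> ('a \<times> 'a \<times> 'a \<Rightarrow>\<^sub>0 'r) rel"
  where "tensor3_rel scale = {(x, y). x - y \<in> Modules.module.span free_scale (tensor3_relators scale)}"

text \<open>The product of the tensor square on representatives:
  \<open>(a \<otimes> b) (c \<otimes> d) = a c \<otimes> b d\<close>.\<close>

definition tensor_mult ::
    "('a::monoid_mult \<times> 'a \<Rightarrow>\<^sub>0 'r::comm_ring_1) \<Rightarrow> ('a \<times> 'a \<Rightarrow>\<^sub>0 'r) \<Rightarrow> ('a \<times> 'a \<Rightarrow>\<^sub>0 'r)"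
  where "tensor_mult x y =
    linear_extension free_scale (\<lambda>(a, b).
      linear_extension free_scale (\<lambda>(c, d). single (a * c, b * d) 1) y) x"

locale assoc_algebra = Modules.module scale
  for scale :: "'r::comm_ring_1 \<Rightarrow> 'a::ring_1 \<Rightarrow> 'a" +
  assumes scale_mult_left: "scale c (x * y) = scale c x * y"
    and scale_mult_right: "scale c (x * y) = x * scale c y"

text \<open>As \<open>\<Delta> a\<close> is a class of formal tensors, \<open>x \<in> \<Delta> a\<close> says that \<open>x\<close> represents the coproduct
  of \<open>a\<close>. In \<open>coassoc\<close>, \<open>d\<close> is a choice of representatives of all coproducts, and the two formal
  sums represent \<open>(\<Delta> \<otimes> id) (\<Delta> a)\<close> and \<open>(id \<otimes> \<Delta>) (\<Delta> a)\<close>.\<close>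

locale hopf_algebra = assoc_algebra scale
  for scale :: "'r::comm_ring_1 \<Rightarrow> 'a::ring_1 \<Rightarrow> 'a" +
  fixes \<Delta> :: "'a \<Rightarrow> ('a \<times> 'a \<Rightarrow>\<^sub>0 'r) set"
    and \<epsilon> :: "'a \<Rightarrow> 'r"
    and S :: "'a \<Rightarrow> 'a"
  assumes comult_tensor: "\<Delta> a \<in> UNIV // tensor_rel scale"
    and comult_add: "x \<in> \<Delta> a \<Longrightarrow> y \<in> \<Delta> b \<Longrightarrow> x + y \<in> \<Delta> (a + b)"
    and comult_scale: "x \<in> \<Delta> a \<Longrightarrow> free_scale c x \<in> \<Delta> (scale c a)"
    and comult_mult: "x \<in> \<Delta> a \<Longrightarrow> y \<in> \<Delta> b \<Longrightarrow> tensor_mult x y \<in> \<Delta> (a * b)"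
    and comult_one: "single (1, 1) 1 \<in> \<Delta> 1"
    and counit_hom: "Modules.module_hom scale (*) \<epsilon>"
    and counit_mult: "\<epsilon> (a * b) = \<epsilon> a * \<epsilon> b"
    and counit_one: "\<epsilon> 1 = 1"
    and antipode_hom: "Modules.module_hom scale scale S"
    and coassoc: "x \<in> \<Delta> a \<Longrightarrow> (\<And>b. d b \<in> \<Delta> b) \<Longrightarrow>
      (linear_extension free_scale (\<lambda>(b, c).
         linear_extension free_scale (\<lambda>(b1, b2). single (b1, b2, c) 1) (d b)) x,
       linear_extension free_scale (\<lambda>(b, c).
         linear_extension free_scale (\<lambda>(c1, c2). single (b, c1, c2) 1) (d c)) x)
      \<in> tensor3_rel scale"
    and counit_left: "x \<in> \<Delta> a \<Longrightarrow> linear_extension scale (\<lambda>(b, c). scale (\<epsilon> b) c) x = a"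
    and counit_right: "x \<in> \<Delta> a \<Longrightarrow> linear_extension scale (\<lambda>(b, c). scale (\<epsilon> c) b) x = a"
    and antipode_left: "x \<in> \<Delta> a \<Longrightarrow> linear_extension scale (\<lambda>(b, c). S b * c) x = scale (\<epsilon> a) 1"
    and antipode_right: "x \<in> \<Delta> a \<Longrightarrow> linear_extension scale (\<lambda>(b, c). b * S c) x = scale (\<epsilon> a) 1"


section \<open>Polynomial deformations of the restricted enveloping algebra\<close>

definition standard_hopf_structure ::
    "('p::prime_card Uc \<Rightarrow> ('p Uc \<times> 'p Uc \<Rightarrow>\<^sub>0 'p mod_ring) set) \<Rightarrow> ('p Uc \<Rightarrow> 'p mod_ring) \<Rightarrow>
     ('p Uc \<Rightarrow> 'p Uc) \<Rightarrow> bool"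
  where "standard_hopf_structure \<Delta> \<epsilon> S \<longleftrightarrow> hopf_algebra Uc_scale \<Delta> \<epsilon> S \<and>
    (\<forall>k. \<Delta> (Uc_D k) = tensor_class Uc_scale (single (Uc_D k, 1) 1 + single (1, Uc_D k) 1))"

definition reduction :: "'p::prime_card Uct \<Rightarrow> 'p Uc"
  where "reduction x = lookup x 0"

definition tensor_reduction ::
    "('p::prime_card Uct \<times> 'p Uct \<Rightarrow>\<^sub>0 'p mod_ring poly) \<Rightarrow> ('p Uc \<times> 'p Uc \<Rightarrow>\<^sub>0 'p mod_ring)"
  where "tensor_reduction x =
    linear_extension (\<lambda>f. free_scale (poly f 0))
      (\<lambda>(a, b). single (reduction a, reduction b) 1) x"

text \<open>The product and unit are those of the ring \<open>Uct\<close>, i.e. undeformed. The standard structure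
  in the second conjunct is unique, as the elements \<open>Uc_D k\<close> generate \<open>Uc\<close>.\<close>

definition polynomial_deformation ::
    "('p::prime_card Uct \<Rightarrow> ('p Uct \<times> 'p Uct \<Rightarrow>\<^sub>0 'p mod_ring poly) set) \<Rightarrow>
     ('p Uct \<Rightarrow> 'p mod_ring poly) \<Rightarrow> ('p Uct \<Rightarrow> 'p Uct) \<Rightarrow> bool"
  where "polynomial_deformation \<Delta> \<epsilon> S \<longleftrightarrow> hopf_algebra Uct_scale \<Delta> \<epsilon> S \<and>
    (\<exists>\<Delta>0 \<epsilon>0 S0. standard_hopf_structure \<Delta>0 \<epsilon>0 S0 \<and>
      (\<forall>a. \<forall>x\<in>\<Delta> a. tensor_reduction x \<in> \<Delta>0 (reduction a)) \<and>
      (\<forall>a. poly (\<epsilon> a) 0 = \<epsilon>0 (reduction a)) \<and>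
      (\<forall>a. reduction (S a) = S0 (reduction a)))"


section \<open>Ingredients of the formulas\<close>

text \<open>The library's \<open>pochhammer\<close> requires a commutative ring.\<close>

primrec rising :: "'a::ring_1 \<Rightarrow> nat \<Rightarrow> 'a" where
  "rising x 0 = 1"
| "rising x (Suc n) = rising x n * (x + of_nat n)"

text \<open>\<open>x\<close> to an exponent in the prime field, through the least nonnegative lift of the exponent.
  It is meant for \<open>x\<close> with \<open>x ^ CARD('p) = 1\<close>, where every lift gives the same value.\<close>

definition mod_power :: "'a::monoid_mult \<Rightarrow> 'p::prime_card mod_ring \<Rightarrow> 'a"
  where "mod_power x c = x ^ nat (to_int_mod_ring c)"

lemma mod_power_of_nat:
  assumes "x ^ CARD('p) = 1"
  shows "mod_power x (of_nat n :: 'p::prime_card mod_ring) = x ^ n"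
proof -
  have "to_int_mod_ring (of_nat n :: 'p mod_ring) = int (n mod CARD('p))"
    by (simp only: of_nat_of_int_mod_ring o_apply to_int_mod_ring.rep_eq of_int_mod_ring.rep_eq
        zmod_int)
  then have "mod_power x (of_nat n :: 'p mod_ring) = x ^ (n mod CARD('p))"
    by (simp only: mod_power_def nat_int)
  also have "\<dots> = x ^ (CARD('p) * (n div CARD('p)) + n mod CARD('p))"
    by (simp only: power_add power_mult assms power_one mult_1_left)
  finally show ?thesis by (simp only: mult_div_mod_eq)
qed

text \<open>The division is exact: a prime not dividing \<open>\<alpha>\<close> occurs in \<open>\<Prod>j<l. \<kappa> + j \<alpha>\<close>, and a prime
  dividing \<open>\<alpha>\<close> occurs in \<open>\<alpha> ^ l\<close>, at least as often as in \<open>fact l\<close>. For \<open>l < CARD('p)\<close> the residue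
  class does not depend on the lifts \<open>\<alpha>\<close> and \<open>\<kappa>\<close> of \<open>a\<close> and \<open>b\<close>.\<close>

definition N :: "'p::prime_card mod_ring \<Rightarrow> 'p mod_ring \<Rightarrow> nat \<Rightarrow> 'p mod_ring"
  where "N a b l =
    (let \<alpha> = to_int_mod_ring a; \<kappa> = to_int_mod_ring b
     in of_int ((\<alpha> ^ l * (\<Prod>j<l. \<kappa> + int j * \<alpha>)) div fact l))"

end

theory Submission
  imports Defs
begin

text \<open>The deformation is a Drinfeld twist of the standard Hopf algebra with coproduct \<open>\<Delta>\<^sub>0\<close>. As
  \<open>h ^ p = h\<close>, the elements \<open>P\<^sub>a = 1 - (h - a) ^ (p - 1)\<close>, for \<open>a\<close> in the prime field, are orthogonal
  idempotents with sum \<open>1\<close> and \<open>h P\<^sub>a = a P\<^sub>a\<close>; as \<open>w = 1 - e t\<close> satisfies \<open>w ^ p = 1\<close>, the twist \<open>(1 \<otimes> w) ^ (h \<otimes> 1)\<close>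
  makes sense as \<open>F = \<Sum>\<^sub>a P\<^sub>a \<otimes> w ^ a\<close>, with inverse \<open>\<Sum>\<^sub>a P\<^sub>a \<otimes> w ^ (- a)\<close>. The coproduct \<open>\<Delta> = F \<Delta>\<^sub>0 F\<^sup>-\<^sup>1\<close> makes
  \<open>w\<close> group-like, and together with \<open>\<Delta>\<^sub>0 P\<^sub>a = \<Sum>\<^sub>b P\<^sub>b \<otimes> P\<^bsub>a - b\<^esub>\<close> this is the cocycle identity that yields
  coassociativity. With \<open>v = \<Sum>\<^sub>a P\<^sub>a w ^ a\<close> the antipode is the standard one conjugated by \<open>v\<close>.
  The explicit formulas come from moving \<open>w ^ a\<close> past \<open>D\<^sub>k\<close>, since \<open>N i (k - i) l D\<^bsub>k + l i\<^esub>\<close> is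
  \<open>(ad e) ^ l D\<^sub>k / l!\<close>. All structure maps come from universal properties, so that no basis of the
  enveloping algebra is needed.\<close>


section \<open>Linear extensions and monoid algebras\<close>

text \<open>The scalars in \<open>h\<close> and \<open>e\<close> are chosen so that
  \<open>h e - e h = e\<close>. Over this two-dimensional Lie algebra the twist is formally
  \<open>exp (h \<otimes> log (1 - e t))\<close>. The sum over the eigenvalues of \<open>h\<close>
  replaces the two series and their factorials: every identity for \<open>F\<close> reduces to the
  orthogonality of the idempotents and to the exponent law of \<open>w\<close>. The factorials
  survive only in the divided powers of \<open>ad e\<close>, where \<open>N\<close> absorbs them.
  The eigenvalue \<open>a\<close> enters the conjugate of \<open>1 \<otimes> D_k\<close> by
  \<open>F\<close> only through a polynomial in \<open>a\<close>, and summing against the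
  idempotents turns that into a polynomial in \<open>h\<close>; this is how the rising factorials
  arise. The correcting elements of the antipode are Drinfeld's: \<open>v\<close> is
  \<open>m (S_0 \<otimes> id)\<close> applied to the inverse of \<open>F\<close>, and its inverse
  \<open>u\<close> is \<open>m (id \<otimes> S_0)\<close> applied to \<open>F\<close>. With no basis
  at hand, nothing about tensor powers comes for free: that they are nonzero is seen from an
  augmentation, and that relations over \<open>Uc\<close> can be read off over \<open>Uct\<close> is
  seen from setting \<open>t = 0\<close>.\<close>

lemma poly_mapping_sum_induct [case_names zero single add]:
  assumes "P 0" "\<And>k c. P (single k c)" "\<And>x y. P x \<Longrightarrow> P y \<Longrightarrow> P (x + y)"
  shows "P x"
proof (induction x rule: update_induct)
  case const
  show ?case by fact
next
  case (update f a b)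
  have "Poly_Mapping.update a b f = f + single a b"
    using update(1) by (intro poly_mapping_eqI) (auto simp: lookup_update lookup_add lookup_single when_def
        not_in_keys_iff_lookup_eq_zero)
  then show ?case using update(3) assms(2,3) by simp
qed

text \<open>Asks only for additivity in the scalar: the scalars may act through a ring homomorphism,
  and in \<open>Uct_hom_exists\<close> they come from the noncommutative ring
  \<open>Uc\<close>.\<close>

lemma linear_extension_plus:
  fixes sc :: "'r::comm_monoid_add \<Rightarrow> 'm \<Rightarrow> 'm::comm_monoid_add"
  assumes "\<And>c d m. sc (c + d) m = sc c m + sc d m" "\<And>m. sc 0 m = 0"
  shows "linear_extension sc f (x + y) = linear_extension sc f x + linear_extension sc f y"
proof -
  let ?A = "Poly_Mapping.keys x \<union> Poly_Mapping.keys y"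
  have *: "linear_extension sc f z = (\<Sum>k\<in>?A. sc (lookup z k) (f k))"
    if "Poly_Mapping.keys z \<subseteq> ?A" for z
    unfolding linear_extension_def
    by (rule sum.mono_neutral_left) (use that assms(2) in \<open>auto simp: in_keys_iff\<close>)
  show ?thesis
    using *[of x] *[of y] *[of "x + y"] Poly_Mapping.keys_add[of x y]
    by (simp add: lookup_add assms(1) sum.distrib)
qed

lemma linear_extension_zero [simp]: "linear_extension sc f 0 = 0"
  by (simp add: linear_extension_def)

lemma linear_extension_single:
  assumes "\<And>m. sc 0 m = 0"
  shows "linear_extension sc f (single k c) = sc c (f k)"
  using assms by (simp add: linear_extension_def)

interpretation free_scale: Modules.module
  "free_scale :: 'r::comm_ring_1 \<Rightarrow> ('x \<Rightarrow>\<^sub>0 'r) \<Rightarrow> _"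
  by (rule module_free_scale)

lemma free_scale_single [simp]: "free_scale c (single k d) = single k (c * d)"
  by (rule poly_mapping_eqI) (simp add: lookup_single when_def)

lemma linear_extension_free_scale_add:
  "linear_extension free_scale f (x + y) = linear_extension free_scale f x + linear_extension free_scale f y"
  by (rule linear_extension_add[OF module_free_scale])

lemma linear_extension_free_scale_single [simp]:
  "linear_extension free_scale f (single k c) = free_scale c (f k)"
  by (simp add: linear_extension_single)

lemma linear_extension_free_scale_scale:
  "linear_extension free_scale f (free_scale c x) = free_scale c (linear_extension free_scale f x)"
  by (induction x rule: poly_mapping_sum_induct)
    (simp_all add: linear_extension_free_scale_add free_scale.scale_right_distrib)

lemma linear_extension_free_scale_fun_add:
  "linear_extension free_scale (\<lambda>k. f k + g k) x
    = linear_extension free_scale f x + linear_extension free_scale g x"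
  by (simp add: linear_extension_def free_scale.scale_right_distrib sum.distrib)

lemma poly_mapping_mult_eqI:
  fixes H :: "('m::monoid_add \<Rightarrow>\<^sub>0 'r::semiring_0) \<Rightarrow> 'b::semiring_0"
  assumes "H 0 = 0" "\<And>x y. H (x + y) = H x + H y"
    and "\<And>a c b d. H (single a c * single b d) = H (single a c) * H (single b d)"
  shows "H (x * y) = H x * H y"
proof (induction x rule: poly_mapping_sum_induct)
  case (single k c)
  show ?case
    by (induction y rule: poly_mapping_sum_induct) (simp_all add: assms distrib_left)
qed (simp_all add: assms distrib_right)

text \<open>The convolution product on \<open>\<Rightarrow>\<^sub>0\<close> reads the index monoid
  additively, whereas the indices here are pairs and triples of ring elements, which multiply. On
  pairs this is \<open>tensor_mult\<close>.\<close>

definition monoid_algebra_mult ::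
    "('m::monoid_mult \<Rightarrow>\<^sub>0 'r::comm_ring_1) \<Rightarrow> ('m \<Rightarrow>\<^sub>0 'r) \<Rightarrow> ('m \<Rightarrow>\<^sub>0 'r)"
  where "monoid_algebra_mult x y =
    linear_extension free_scale (\<lambda>m. linear_extension free_scale (\<lambda>n. single (m * n) 1) y) x"

lemma monoid_algebra_mult_add:
  "monoid_algebra_mult (x + x') y = monoid_algebra_mult x y + monoid_algebra_mult x' y"
  "monoid_algebra_mult x (y + y') = monoid_algebra_mult x y + monoid_algebra_mult x y'"
  by (simp_all add: monoid_algebra_mult_def linear_extension_free_scale_add
      linear_extension_free_scale_fun_add)

lemma monoid_algebra_mult_single [simp]:
  "monoid_algebra_mult (single m c) (single n d) = single (m * n) (c * d)"
  by (simp add: monoid_algebra_mult_def)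

lemma monoid_algebra_mult_zero [simp]:
  "monoid_algebra_mult 0 y = 0" "monoid_algebra_mult x 0 = 0"
  using monoid_algebra_mult_add(1)[of 0 0 y] monoid_algebra_mult_add(2)[of x 0 0] by simp_all

lemma monoid_algebra_mult_diff:
  "monoid_algebra_mult (x - x') y = monoid_algebra_mult x y - monoid_algebra_mult x' y"
  "monoid_algebra_mult x (y - y') = monoid_algebra_mult x y - monoid_algebra_mult x y'"
  using monoid_algebra_mult_add(1)[of "x - x'" x' y] monoid_algebra_mult_add(2)[of x "y - y'" y']
  by (simp_all add: algebra_simps)

lemma monoid_algebra_mult_assoc:
  "monoid_algebra_mult (monoid_algebra_mult x y) z = monoid_algebra_mult x (monoid_algebra_mult y z)"
proof (induction x rule: poly_mapping_sum_induct)
  case (single m c)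
  show ?case
  proof (induction y rule: poly_mapping_sum_induct)
    case (single n d)
    show ?case
      by (induction z rule: poly_mapping_sum_induct) (simp_all add: monoid_algebra_mult_add mult.assoc)
  qed (simp_all add: monoid_algebra_mult_add)
qed (simp_all add: monoid_algebra_mult_add)

lemma monoid_algebra_mult_one [simp]:
  "monoid_algebra_mult (single 1 1) x = x" "monoid_algebra_mult x (single 1 1) = x"
  by (induction x rule: poly_mapping_sum_induct; simp add: monoid_algebra_mult_add)+

lemma monoid_algebra_mult_scale:
  "monoid_algebra_mult (free_scale c x) y = free_scale c (monoid_algebra_mult x y)"
  "monoid_algebra_mult x (free_scale c y) = free_scale c (monoid_algebra_mult x y)"
proof -
  show "monoid_algebra_mult (free_scale c x) y = free_scale c (monoid_algebra_mult x y)"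
    by (simp add: monoid_algebra_mult_def linear_extension_free_scale_scale)
  show "monoid_algebra_mult x (free_scale c y) = free_scale c (monoid_algebra_mult x y)"
  proof (induction x rule: poly_mapping_sum_induct)
    case (single k d)
    show ?case
      by (induction y rule: poly_mapping_sum_induct)
        (simp_all add: monoid_algebra_mult_add free_scale.scale_right_distrib mult.left_commute)
  qed (simp_all add: monoid_algebra_mult_add free_scale.scale_right_distrib)
qed

text \<open>Multiplication is bilinear, so stability under the basis elements
  \<open>single m 1\<close> is enough to make the span of the relators a two-sided ideal.\<close>

lemma monoid_algebra_span_ideal:
  fixes R :: "('m::monoid_mult \<Rightarrow>\<^sub>0 'r::comm_ring_1) set"
  assumes left: "\<And>m r. r \<in> R \<Longrightarrow> monoid_algebra_mult (single m 1) r \<in> free_scale.span R"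
    and right: "\<And>m r. r \<in> R \<Longrightarrow> monoid_algebra_mult r (single m 1) \<in> free_scale.span R"
    and "x \<in> free_scale.span R"
  shows "monoid_algebra_mult a x \<in> free_scale.span R" "monoid_algebra_mult x a \<in> free_scale.span R"
proof -
  have *: "single m c = free_scale c (single m 1)" for m :: 'm and c :: 'r
    by simp
  have "monoid_algebra_mult (single m c) x \<in> free_scale.span R
      \<and> monoid_algebra_mult x (single m c) \<in> free_scale.span R" for m c
    using assms(3)
  proof (induction rule: free_scale.span_induct_alt)
    case base
    show ?case by (simp add: free_scale.span_zero)
  next
    case (step d r y)
    then show ?case
      unfolding monoid_algebra_mult_add monoid_algebra_mult_scale
      by (subst (1 2) *) (auto simp only: monoid_algebra_mult_scale
          intro!: free_scale.span_add free_scale.span_scale left right)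
  qed
  then show "monoid_algebra_mult a x \<in> free_scale.span R" "monoid_algebra_mult x a \<in> free_scale.span R"
    by (induction a rule: poly_mapping_sum_induct)
      (auto simp: monoid_algebra_mult_add free_scale.span_zero intro: free_scale.span_add)
qed


section \<open>Linear extension along a homomorphism into the centre\<close>

definition algebra_extension :: "('r::comm_ring_1 \<Rightarrow> 'b::ring_1) \<Rightarrow> ('x \<Rightarrow> 'b) \<Rightarrow> ('x \<Rightarrow>\<^sub>0 'r) \<Rightarrow> 'b"
  where "algebra_extension \<kappa> = linear_extension (\<lambda>c x. \<kappa> c * x)"

locale central_hom = Ring_Hom.ring_hom \<kappa> for \<kappa> :: "'r::comm_ring_1 \<Rightarrow> 'b::ring_1" +
  assumes central: "\<kappa> c * x = x * \<kappa> c"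
begin

lemma left_commute: "x * (\<kappa> c * y) = \<kappa> c * (x * y)"
  by (metis central mult.assoc)

lemma extension_add: "algebra_extension \<kappa> g (x + y) = algebra_extension \<kappa> g x + algebra_extension \<kappa> g y"
  unfolding algebra_extension_def by (rule linear_extension_plus) (simp_all add: hom_add distrib_right)

lemma extension_single [simp]: "algebra_extension \<kappa> g (single k c) = \<kappa> c * g k"
  by (simp add: algebra_extension_def linear_extension_single)

lemma extension_zero [simp]: "algebra_extension \<kappa> g 0 = 0"
  by (simp add: algebra_extension_def)

lemma extension_diff: "algebra_extension \<kappa> g (x - y) = algebra_extension \<kappa> g x - algebra_extension \<kappa> g y"
  using extension_add[of g "x - y" y] by simp

lemma extension_scale: "algebra_extension \<kappa> g (free_scale c x) = \<kappa> c * algebra_extension \<kappa> g x"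
  by (induction x rule: poly_mapping_sum_induct)
    (simp_all add: extension_add free_scale.scale_right_distrib hom_mult distrib_left mult.assoc)

lemma extension_mult:
  assumes "\<And>m n. g (m * n) = g m * g n"
  shows "algebra_extension \<kappa> g (monoid_algebra_mult x y) = algebra_extension \<kappa> g x * algebra_extension \<kappa> g y"
proof (induction x rule: poly_mapping_sum_induct)
  case (single m c)
  show ?case
    by (induction y rule: poly_mapping_sum_induct)
      (simp_all add: monoid_algebra_mult_add extension_add distrib_left hom_mult assms left_commute[of "g _"] mult.assoc)
qed (simp_all add: monoid_algebra_mult_add extension_add distrib_right)

lemma extension_linear_extension:
  "algebra_extension \<kappa> g (linear_extension free_scale f x)
    = algebra_extension \<kappa> (\<lambda>k. algebra_extension \<kappa> g (f k)) x"
  by (induction x rule: poly_mapping_sum_induct)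
    (simp_all add: linear_extension_free_scale_add extension_add extension_scale)

lemma extension_span:
  assumes "\<And>r. r \<in> R \<Longrightarrow> algebra_extension \<kappa> g r = 0" "x \<in> free_scale.span R"
  shows "algebra_extension \<kappa> g x = 0"
  using assms(2)
  by (induction rule: free_scale.span_induct_alt) (simp_all add: extension_add extension_scale assms(1))

end


section \<open>Commutative subrings of noncommutative rings\<close>

text \<open>The library's \<open>poly\<close> takes values in commutative rings only.\<close>

definition eval_at :: "('r::comm_ring_1 \<Rightarrow> 'b::ring_1) \<Rightarrow> 'b \<Rightarrow> 'r poly \<Rightarrow> 'b"
  where "eval_at s x f = fold_coeffs (\<lambda>a b. s a + x * b) f 0"

context
  fixes s :: "'r::comm_ring_1 \<Rightarrow> 'b::ring_1" and x :: 'b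
  assumes s: "Ring_Hom.ring_hom s" and s_commute: "\<And>c. s c * x = x * s c"
begin

interpretation Ring_Hom.ring_hom s by (rule s)

lemma eval_at_0: "eval_at s x 0 = 0"
  by (simp add: eval_at_def)

lemma eval_at_pCons: "eval_at s x (pCons a f) = s a + x * eval_at s x f"
  by (cases "pCons a f = 0") (auto simp: eval_at_def fold_coeffs_pCons_eq)

lemma eval_at_add: "eval_at s x (f + g) = eval_at s x f + eval_at s x g"
  by (induction f g rule: poly_induct2) (simp_all add: eval_at_pCons eval_at_0 hom_distribs algebra_simps)

lemma eval_at_smult: "eval_at s x (smult a f) = s a * eval_at s x f"
proof (induction f)
  case (pCons b f)
  have "s a * (x * y) = x * (s a * y)" for y
    by (metis mult.assoc s_commute)
  with pCons show ?case
    by (simp add: eval_at_pCons hom_distribs algebra_simps)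
qed (simp add: eval_at_0)

lemma ring_hom_eval_at: "Ring_Hom.ring_hom (eval_at s x)"
proof unfold_locales
  show "eval_at s x (f * g) = eval_at s x f * eval_at s x g" for f g
    by (induction f) (simp_all add: eval_at_0 eval_at_pCons eval_at_add eval_at_smult algebra_simps)
  show "eval_at s x 1 = 1"
    unfolding one_pCons by (simp add: eval_at_0 eval_at_pCons)
qed (simp_all add: eval_at_0 eval_at_add)

lemma eval_at_altdef: "eval_at s x f = (\<Sum>n\<le>degree f. s (coeff f n) * x ^ n)"
proof (induction f)
  case 0
  then show ?case by (simp add: eval_at_0)
next
  case (pCons a f)
  have *: "x * (s c * y) = s c * (x * y)" for c y
    by (metis mult.assoc s_commute)
  show ?case
  proof (cases "f = 0")
    case False
    then show ?thesis
      by (simp add: eval_at_pCons pCons sum.atMost_Suc_shift sum_distrib_left * del: sum.atMost_Suc)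
  qed (simp add: eval_at_pCons eval_at_0)
qed

end

text \<open>The binomial theorem holds in the commutative ring of integer polynomials in two
  variables. Evaluating the inner variable at \<open>y\<close> and then the outer one at
  \<open>x\<close> is a ring homomorphism because \<open>x\<close> and \<open>y\<close> commute, and
  it carries the identity over.\<close>

lemma binomial_commuting:
  fixes x y :: "'b::ring_1"
  assumes "x * y = y * x"
  shows "(x + y) ^ n = (\<Sum>k\<le>n. of_nat (n choose k) * x ^ k * y ^ (n - k))"
proof -
  define Y where "Y = eval_at (of_int :: int \<Rightarrow> 'b) y"
  have of_int: "Ring_Hom.ring_hom (of_int :: int \<Rightarrow> 'b)"
    by unfold_locales simp_all
  interpret Y: Ring_Hom.ring_hom Y
    unfolding Y_def by (rule ring_hom_eval_at[OF of_int]) (rule mult_of_int_commute)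
  have Y_commute: "Y c * x = x * Y c" for c
    unfolding Y_def
  proof (induction c)
    case (pCons a c)
    have "y * (z * x) = x * (y * z)" if "z * x = x * z" for z
      using that assms by (metis mult.assoc)
    with pCons show ?case
      by (simp add: eval_at_pCons[OF of_int mult_of_int_commute] distrib_left distrib_right
          mult_of_int_commute mult.assoc)
  qed (simp add: eval_at_0[OF of_int mult_of_int_commute])
  note XY = eval_at_pCons[OF Y.ring_hom_axioms Y_commute] eval_at_0[OF Y.ring_hom_axioms Y_commute]
  interpret X: Ring_Hom.ring_hom "eval_at Y x"
    by (rule ring_hom_eval_at[OF Y.ring_hom_axioms Y_commute])
  have Y: "Y [:0, 1:] = y"
    by (simp add: Y_def eval_at_pCons[OF of_int mult_of_int_commute] eval_at_0[OF of_int mult_of_int_commute])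
  have 1: "eval_at Y x [:0, 1:] = x" and 2: "eval_at Y x [:[:0, 1:]:] = y"
    by (simp_all add: XY Y)
  have "(x + y) ^ n = eval_at Y x (([:0, 1:] + [:[:0, 1:]:]) ^ n)"
    by (simp only: X.hom_power X.hom_add 1 2)
  also have "\<dots> = (\<Sum>k\<le>n. of_nat (n choose k) * x ^ k * y ^ (n - k))"
    by (simp only: binomial_ring X.hom_sum X.hom_mult X.hom_power X.hom_of_nat 1 2)
  finally show ?thesis .
qed

lemma freshmans_dream_commuting:
  fixes x y :: "'b::ring_1"
  assumes "x * y = y * x" "prime p" "of_nat p = (0 :: 'b)"
  shows "(x + y) ^ p = x ^ p + y ^ p"
proof -
  have "p > 0" using assms(2) by (simp add: prime_gt_0_nat)
  have "(x + y) ^ p = (\<Sum>k\<in>{0, p}. of_nat (p choose k) * x ^ k * y ^ (p - k))"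
    unfolding binomial_commuting[OF assms(1)]
  proof (intro sum.mono_neutral_right ballI)
    fix k assume "k \<in> {..p} - {0, p}"
    then have "p dvd (p choose k)"
      by (intro dvd_choose_prime assms) auto
    then obtain j where "p choose k = p * j" ..
    then have "of_nat (p choose k) = (0 :: 'b)"
      using assms(3) by simp
    then show "of_nat (p choose k) * x ^ k * y ^ (p - k) = 0" by simp
  qed auto
  then show ?thesis using \<open>p > 0\<close> by (simp add: add.commute)
qed


section \<open>Rings of characteristic \<open>p\<close>\<close>

text \<open>Defined through the integer lift, so that it makes sense in every ring and is preserved
  by every ring homomorphism; it is itself a homomorphism once the target has characteristic
  \<open>p\<close>.\<close>

definition cst :: "'p::prime_card mod_ring \<Rightarrow> 'b::ring_1"
  where "cst c = of_int (to_int_mod_ring c)"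

lemma cst_commute: "cst c * x = x * cst c"
  unfolding cst_def by (rule mult_of_int_commute)

lemma cst_left_commute: "x * (cst c * y) = cst c * (x * y)"
  by (metis cst_commute mult.assoc)

lemma cst_mod_ring [simp]: "cst c = (c :: 'p::prime_card mod_ring)"
  by (simp add: cst_def of_int_of_int_mod_ring)

lemma (in Ring_Hom.ring_hom) hom_cst: "hom (cst c) = cst c"
  by (simp add: cst_def hom_of_int)

lemma fermat_mod_ring:
  fixes a :: "'p::prime_card mod_ring"
  shows "a ^ CARD('p) = a" "a \<noteq> 0 \<Longrightarrow> a ^ (CARD('p) - 1) = 1"
proof -
  show *: "a ^ CARD('p) = a"
    using finite_field_power_card_eq_same[of a] by simp
  have "CARD('p) = Suc (CARD('p) - 1)"
    by simp
  then have "a ^ (CARD('p) - 1) * a = a"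
    using * by (metis power_Suc2)
  then show "a \<noteq> 0 \<Longrightarrow> a ^ (CARD('p) - 1) = 1" by simp
qed

lemma mod_ring_nat_induct [case_names 0 Suc]:
  fixes a :: "'p::prime_card mod_ring"
  assumes "P 0" "\<And>a. P a \<Longrightarrow> P (a + 1)"
  shows "P a"
proof -
  have "P (of_nat n)" for n
    by (induction n) (use assms in \<open>simp_all add: add.commute[of 1]\<close>)
  then show ?thesis using surj_of_nat_mod_ring[of a] by auto
qed

context
  fixes P :: "'p::prime_card itself" and B :: "'b::ring_1 itself"
  assumes char: "of_nat CARD('p) = (0 :: 'b)"
begin

lemma cst_of_int: "(cst (of_int n :: 'p mod_ring) :: 'b) = of_int n"
proof -
  have "to_int_mod_ring (of_int n :: 'p mod_ring) = n mod int CARD('p)"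
    by (simp only: of_int_of_int_mod_ring to_int_mod_ring.rep_eq of_int_mod_ring.rep_eq)
  then have "(cst (of_int n :: 'p mod_ring) :: 'b) = of_int (n mod int CARD('p))"
    by (simp only: cst_def)
  also have "\<dots> = of_int (int CARD('p)) * of_int (n div int CARD('p)) + of_int (n mod int CARD('p))"
    using char by simp
  also have "\<dots> = of_int (int CARD('p) * (n div int CARD('p)) + n mod int CARD('p))"
    by (simp only: of_int_add of_int_mult)
  finally show ?thesis by simp
qed

lemma ring_hom_cst: "Ring_Hom.ring_hom (cst :: 'p mod_ring \<Rightarrow> 'b)"
proof unfold_locales
  have *: "a = of_int (to_int_mod_ring a)" for a :: "'p mod_ring"
    by (simp add: of_int_of_int_mod_ring)
  show "cst (x + y) = (cst x + cst y :: 'b)" for x y :: "'p mod_ring"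
    by (metis * cst_def cst_of_int of_int_add)
  show "cst (x * y) = (cst x * cst y :: 'b)" for x y :: "'p mod_ring"
    by (metis * cst_def cst_of_int of_int_mult)
qed (simp_all add: cst_def)

lemma central_hom_cst: "central_hom (cst :: 'p mod_ring \<Rightarrow> 'b)"
  by (intro central_hom.intro central_hom_axioms.intro ring_hom_cst cst_commute)

end

section \<open>Spectral idempotents of an element with \<open>x ^ p = x\<close>\<close>

text \<open>On a vector that \<open>x\<close> multiplies by the scalar \<open>d\<close>, Fermat's little theorem makes
  \<open>idem x a\<close> the projection onto the case \<open>d = a\<close>.\<close>

definition idem :: "'b::ring_1 \<Rightarrow> 'p::prime_card mod_ring \<Rightarrow> 'b"
  where "idem x a = 1 - (x - cst a) ^ (CARD('p) - 1)"

lemma (in Ring_Hom.ring_hom) hom_idem: "hom (idem x a) = idem (hom x) a"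
  by (simp add: idem_def hom_minus hom_power hom_cst)

text \<open>Moving \<open>y\<close> across \<open>x\<close> shifts the spectrum:
  \<open>y (x - a) = (x - (a - c)) y\<close>, and the same for powers.\<close>

lemma idem_commute:
  fixes a :: "'p::prime_card mod_ring" and x :: "'b::ring_1"
  assumes char: "of_nat CARD('p) = (0 :: 'b)" and "y * x = (x + cst c) * y"
  shows "y * idem x a = idem x (a - c) * y"
proof -
  interpret cst: Ring_Hom.ring_hom "cst :: 'p mod_ring \<Rightarrow> 'b" by (rule ring_hom_cst[OF char])
  have 1: "y * (x - cst a) = (x - cst (a - c)) * y"
    using assms(2) by (simp add: cst.hom_minus algebra_simps cst_commute[of a y])
  have "y * (x - cst a) ^ n = (x - cst (a - c)) ^ n * y" for n
  proof (induction n)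
    case (Suc n)
    then show ?case
      by (metis 1 mult.assoc power_Suc)
  qed simp
  then show ?thesis
    by (simp add: idem_def algebra_simps)
qed

context
  fixes p_type :: "'p::prime_card itself" and b_type :: "'b::ring_1 itself"
  assumes char: "of_nat CARD('p) = (0 :: 'b)"
begin

interpretation cst: Ring_Hom.ring_hom "cst :: 'p mod_ring \<Rightarrow> 'b" by (rule ring_hom_cst[OF char])

lemma idem_eigen:
  fixes a d :: "'p mod_ring" and z Q :: 'b
  assumes "z * Q = cst d * Q"
  shows "idem z a * Q = (if a = d then Q else 0)"
proof -
  have "(z - cst a) ^ n * Q = cst ((d - a) ^ n) * Q" for n
  proof (induction n)
    case (Suc n)
    have "(z - cst a) ^ Suc n * Q = (z - cst a) ^ n * (cst (d - a) * Q)"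
      by (simp only: power_Suc2 mult.assoc left_diff_distrib assms cst.hom_minus)
    also have "\<dots> = cst (d - a) * ((z - cst a) ^ n * Q)"
      by (rule cst_left_commute)
    finally show ?case by (simp add: Suc cst.hom_mult mult.assoc)
  qed simp
  then have "idem z a * Q = cst (1 - (d - a) ^ (CARD('p) - 1)) * Q"
    by (simp add: idem_def left_diff_distrib cst.hom_minus)
  also have "1 - (d - a) ^ (CARD('p) - 1) = (if a = d then 1 else 0)"
    using fermat_mod_ring(2)[of "d - a"] nontriv[where 'a='p] by (auto simp: power_0_left)
  finally show ?thesis by simp
qed

lemma idem_zero: "idem (0 :: 'b) (a :: 'p mod_ring) = (if a = 0 then 1 else 0)"
  using idem_eigen[of 0 1 0 a] by simp

text \<open>The polynomial \<open>f\<close>, the sum of \<open>1 - (X - a) ^ (p - 1)\<close> over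
  all \<open>a\<close>, has degree below \<open>p\<close> and takes the value 1 at all
  \<open>p\<close> points of the field by Fermat, so it is the constant 1; evaluate it at
  \<open>x\<close>.\<close>

lemma sum_idem:
  fixes x :: 'b
  shows "(\<Sum>a\<in>UNIV. idem x (a :: 'p mod_ring)) = 1"
proof -
  have hom: "Ring_Hom.ring_hom (eval_at (cst :: 'p mod_ring \<Rightarrow> 'b) x)"
    by (rule ring_hom_eval_at[OF cst.ring_hom_axioms cst_commute])
  interpret ev: Ring_Hom.ring_hom "eval_at (cst :: 'p mod_ring \<Rightarrow> 'b) x" by fact
  note ev = eval_at_pCons[OF cst.ring_hom_axioms cst_commute, where x = x]
  define f :: "'p mod_ring poly" where "f = (\<Sum>a\<in>UNIV. 1 - [:-a, 1:] ^ (CARD('p) - 1))"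
  have "f = 1"
  proof (rule poly_eqI_degree)
    fix b :: "'p mod_ring" assume "b \<in> UNIV"
    have "1 - (b - a) ^ (CARD('p) - 1) = (if a = b then 1 else 0)" for a
      using fermat_mod_ring(2)[of "b - a"] nontriv[where 'a='p] by (auto simp: power_0_left)
    then show "poly f b = poly 1 b"
      by (simp add: f_def poly_sum)
  next
    show "degree f < card (UNIV :: 'p mod_ring set)"
    proof -
      have "degree f \<le> CARD('p) - 1"
        unfolding f_def by (rule degree_sum_le) (auto intro!: degree_diff_le simp: degree_power_eq)
      then show ?thesis using nontriv[where 'a='p] by simp
    qed
  qed simp
  then have "eval_at cst x f = 1"
    by (simp add: ev.hom_one)
  moreover have "eval_at cst x [:-a, 1:] = x - cst a" for a :: "'p mod_ring"
    by (simp add: ev ev.hom_zero cst.hom_uminus)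
  ultimately show ?thesis
    by (simp add: f_def ev.hom_sum ev.hom_minus ev.hom_power ev.hom_one idem_def)
qed

text \<open>The product \<open>(x - a) idem x a\<close> is \<open>(x - a) - (x - a) ^ p\<close>.
  Frobenius and Fermat turn the power into \<open>x ^ p - a\<close>, which is \<open>x - a\<close>
  again.\<close>

lemma mult_idem:
  fixes x :: 'b and a :: "'p mod_ring"
  assumes "x ^ CARD('p) = x"
  shows "x * idem x a = cst a * idem x a"
proof -
  have "(x - cst a) ^ CARD('p) = (x + cst (- a)) ^ CARD('p)"
    by (simp add: cst.hom_uminus)
  also have "\<dots> = x ^ CARD('p) + cst (- a) ^ CARD('p)"
    by (rule freshmans_dream_commuting[OF _ prime_card char]) (rule cst_commute[symmetric])
  also have "\<dots> = x - cst a"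
  proof -
    have "cst (- a) ^ CARD('p) = (cst (- a) :: 'b)"
      by (simp only: fermat_mod_ring(1) flip: cst.hom_power)
    then show ?thesis
      by (simp only: assms) (simp add: cst.hom_uminus)
  qed
  finally have "(x - cst a) * (x - cst a) ^ (CARD('p) - 1) = x - cst a"
    by (simp add: power_eq_if split: if_splits)
  then have "(x - cst a) * idem x a = 0"
    by (simp add: idem_def right_diff_distrib)
  then show ?thesis by (simp add: left_diff_distrib)
qed

lemma idem_orthogonal:
  fixes x :: 'b and a b :: "'p mod_ring"
  assumes "x ^ CARD('p) = x"
  shows "idem x a * idem x b = (if a = b then idem x b else 0)"
  by (rule idem_eigen[OF mult_idem[OF assms]])

text \<open>Insert the decompositions of 1 for \<open>x\<close> and for \<open>y\<close>: on
  \<open>idem x b * idem y c\<close> the sum \<open>x + y\<close> has the eigenvalue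
  \<open>b + c\<close>, so \<open>idem_eigen\<close> keeps exactly the pairs with
  \<open>b + c = a\<close>.\<close>

lemma idem_add:
  fixes x y :: 'b and a :: "'p mod_ring"
  assumes "x ^ CARD('p) = x" "y ^ CARD('p) = y" "x * y = y * x"
  shows "idem (x + y) a = (\<Sum>b\<in>UNIV. idem x b * idem y (a - b))"
proof -
  have eigen: "(x + y) * (idem x b * idem y c) = cst (b + c) * (idem x b * idem y c)"
    for b c :: "'p mod_ring"
  proof -
    have "y * idem x b = idem x b * y"
      using idem_commute[OF char, of y x 0 b] assms(3) by simp
    then have "(x + y) * (idem x b * idem y c)
        = (x * idem x b) * idem y c + idem x b * (y * idem y c)"
      by (simp add: distrib_right) (metis mult.assoc)
    then show ?thesis
      by (simp add: mult_idem assms distrib_right cst.hom_add cst_left_commute mult.assoc)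
  qed
  have "idem (x + y) a
      = idem (x + y) a * ((\<Sum>b\<in>UNIV. idem x (b :: 'p mod_ring)) * (\<Sum>c\<in>UNIV. idem y (c :: 'p mod_ring)))"
    by (simp add: sum_idem)
  also have "\<dots> = (\<Sum>b\<in>UNIV. \<Sum>c\<in>UNIV. idem (x + y) a * (idem x (b :: 'p mod_ring) * idem y (c :: 'p mod_ring)))"
    by (simp add: sum_distrib_left sum_distrib_right mult.assoc)
      (rule sum.swap)
  also have "\<dots> = (\<Sum>b\<in>UNIV. \<Sum>c\<in>UNIV. if c = a - b then idem x b * idem y c else 0)"
    by (intro sum.cong refl) (auto simp: idem_eigen[OF eigen])
  finally show ?thesis by simp
qed

end

text \<open>The exponent \<open>p - 1\<close> is even, so the sign of \<open>- (x + a)\<close>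
  disappears.\<close>

lemma idem_uminus:
  fixes a :: "'p::prime_card mod_ring" and x :: "'b::ring_1"
  assumes char: "of_nat CARD('p) = (0 :: 'b)" and "odd CARD('p)"
  shows "idem (- x) a = idem x (- a)"
proof -
  interpret cst: Ring_Hom.ring_hom "cst :: 'p mod_ring \<Rightarrow> 'b" by (rule ring_hom_cst[OF char])
  have "- x - cst a = - (x - cst (- a))"
    by (simp add: cst.hom_uminus)
  then have "(- x - cst a) ^ (CARD('p) - 1) = (x - cst (- a)) ^ (CARD('p) - 1)"
    using assms(2) by (metis power_minus_even odd_pos odd_Suc_minus_one even_Suc Suc_diff_1 One_nat_def)
  then show ?thesis by (simp add: idem_def)
qed


section \<open>Powers with exponents in the prime field\<close>

lemma mod_power_0 [simp]: "mod_power w 0 = 1"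
  by (simp add: mod_power_def)

lemma mod_power_one [simp]: "mod_power 1 a = 1"
  by (simp add: mod_power_def)

lemma mod_power_1:
  fixes w :: "'b::monoid_mult" and p_type :: "'p::prime_card itself"
  assumes "w ^ CARD('p) = 1"
  shows "mod_power w (1 :: 'p mod_ring) = w"
  using mod_power_of_nat[OF assms, of 1] by simp

lemma mod_power_add:
  fixes a b :: "'p::prime_card mod_ring"
  assumes "w ^ CARD('p) = 1"
  shows "mod_power w (a + b) = mod_power w a * mod_power w b"
proof -
  obtain m n where "a = of_nat m" "b = of_nat n"
    using surj_of_nat_mod_ring by metis
  then show ?thesis
    using mod_power_of_nat[OF assms, of m] mod_power_of_nat[OF assms, of n]
      mod_power_of_nat[OF assms, of "m + n"]
    by (simp add: power_add)
qed

lemma mod_power_commute: "x * w = w * x \<Longrightarrow> x * mod_power w a = mod_power w a * x"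
  unfolding mod_power_def by (simp add: power_commuting_commutes)

lemma mod_power_hom:
  assumes "f 1 = 1" "\<And>x y. f (x * y) = f x * f y"
  shows "f (mod_power w a) = mod_power (f w) a"
proof -
  have "f (w ^ n) = f w ^ n" for n
    by (induction n) (simp_all add: assms)
  then show ?thesis by (simp add: mod_power_def)
qed


section \<open>Integrality of the coefficients\<close>

text \<open>The factors \<open>q m + 1, ..., q m + r\<close> lie strictly between two multiples of
  \<open>q\<close>, so none of them contributes to the exponent of \<open>q\<close>.\<close>

lemma fact_multiple_add:
  fixes q :: nat
  assumes "prime q" "r < q"
  shows "\<exists>c. fact (q * m + r) = (fact (q * m) * c :: nat) \<and> \<not> q dvd c"
  using assms(2)
proof (induction r)
  case 0
  show ?case using assms(1) prime_gt_1_nat by (intro exI[of _ 1]) auto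
next
  case (Suc r)
  then obtain c where c: "fact (q * m + r) = (fact (q * m) * c :: nat)" "\<not> q dvd c" by auto
  have "\<not> q dvd q * m + Suc r"
    using Suc.prems dvd_add_right_iff[of q "q * m" "Suc r"] nat_dvd_not_less[of "Suc r" q] by auto
  then have "\<not> q dvd (q * m + Suc r) * c"
    using c(2) assms(1) prime_dvd_multD by blast
  with c(1) show ?case by (intro exI[of _ "(q * m + Suc r) * c"]) (simp add: algebra_simps)
qed

text \<open>The multiples of \<open>q\<close> up to \<open>q m\<close> are
  \<open>q, 2 q, ..., m q\<close>, with product \<open>q ^ m * m!\<close>; all other factors are
  prime to \<open>q\<close>.\<close>

lemma fact_multiple:
  fixes q :: nat
  assumes "prime q"
  shows "\<exists>c. fact (q * m) = (q ^ m * fact m * c :: nat) \<and> \<not> q dvd c"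
proof (induction m)
  case 0
  show ?case using assms prime_gt_1_nat by (intro exI[of _ 1]) auto
next
  case (Suc m)
  then obtain c where c: "fact (q * m) = (q ^ m * fact m * c :: nat)" "\<not> q dvd c" by auto
  from fact_multiple_add[OF assms, of "q - 1" m] assms prime_gt_0_nat
  obtain d where d: "fact (q * m + (q - 1)) = (fact (q * m) * d :: nat)" "\<not> q dvd d" by auto
  have "q * Suc m = Suc (q * m + (q - 1))"
    using prime_gt_0_nat[OF assms] by simp
  then have "fact (q * Suc m) = (q * Suc m) * (fact (q * m + (q - 1)) :: nat)"
    by (metis fact_Suc of_nat_id)
  then have "fact (q * Suc m) = (q ^ Suc m * fact (Suc m) * (c * d) :: nat)"
    unfolding d(1) c(1) by (simp add: algebra_simps)
  moreover have "\<not> q dvd c * d"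
    using c(2) d(2) assms by (auto simp: prime_dvd_mult_iff)
  ultimately show ?case by blast
qed

text \<open>Legendre's recursion: with \<open>m = n div q\<close>, the exponent of \<open>q\<close>
  in \<open>n!\<close> is \<open>m\<close> plus its exponent in \<open>m!\<close>. By induction it
  is at most \<open>2 m\<close>, and \<open>2 m \<le> q m \<le> n\<close>.\<close>

lemma multiplicity_fact_le:
  fixes q :: nat
  assumes "prime q"
  shows "multiplicity q (fact n :: nat) \<le> n"
proof (induction n rule: less_induct)
  case (less n)
  show ?case
  proof (cases "n = 0")
    case False
    define m r where "m = n div q" and "r = n mod q"
    have q: "q > 1" "\<not> is_unit q" using assms prime_gt_1_nat by auto
    have n: "n = q * m + r" and "r < q" using q by (auto simp: m_def r_def)
    obtain c where c: "fact n = (fact (q * m) * c :: nat)" "\<not> q dvd c"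
      using fact_multiple_add[OF assms \<open>r < q\<close>] n by metis
    obtain d where d: "fact (q * m) = (q ^ m * fact m * d :: nat)" "\<not> q dvd d"
      using fact_multiple[OF assms] by metis
    have nz: "c \<noteq> 0" "d \<noteq> 0" using c(2) d(2) by (metis dvd_0_right)+
    have "multiplicity q (fact n) = m + multiplicity q (fact m :: nat)"
      using nz q c(2) d(2) assms
      by (simp add: c(1) d(1) prime_elem_multiplicity_mult_distrib not_dvd_imp_multiplicity_0)
    also have "\<dots> \<le> m + m"
      using less[of m] False q by (simp add: m_def)
    also have "\<dots> \<le> q * m"
      using q by (cases q) auto
    finally show ?thesis using n by simp
  qed simp
qed

lemma fact_dvd_scaled_prod:
  fixes \<alpha> \<kappa> :: int
  shows "fact l dvd \<alpha> ^ l * (\<Prod>j<l. \<kappa> + int j * \<alpha>)"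
proof (cases "\<alpha> ^ l * (\<Prod>j<l. \<kappa> + int j * \<alpha>) = 0")
  case True
  then show ?thesis by (simp only: dvd_0_right)
next
  case False
  show ?thesis
  proof (rule multiplicity_le_imp_dvd)
    fix q :: int assume q: "prime q"
    define v where "v = multiplicity q (fact l :: int)"
    have v: "q ^ v dvd fact l"
      unfolding v_def by (rule multiplicity_dvd)
    have "q ^ v dvd \<alpha> ^ l * (\<Prod>j<l. \<kappa> + int j * \<alpha>)"
    proof (cases "q dvd \<alpha>")
      case True
      obtain q' where q': "q = int q'" "prime q'"
        using q by (metis prime_int_nat_transfer prime_ge_0_int int_nat_eq nat_int zero_le_imp_eq_int)
      have "q' ^ v dvd fact l"
        using v q'(1) by (metis of_nat_dvd_iff of_nat_fact of_nat_power)
      then have "v \<le> multiplicity q' (fact l :: nat)"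
        using q'(2) by (intro multiplicity_geI) auto
      also have "\<dots> \<le> l" by (rule multiplicity_fact_le[OF q'(2)])
      finally have "q ^ v dvd \<alpha> ^ l"
        by (meson True dvd_power_same dvd_trans le_imp_power_dvd)
      then show ?thesis by simp
    next
      case False
      then have "coprime \<alpha> (q ^ v)"
        using q by (metis coprime_commute coprime_power_right_iff prime_imp_coprime)
      \<comment> \<open>Modulo \<open>q ^ v\<close> the inverse \<open>\<beta>\<close> of
        \<open>\<alpha>\<close> gives
        \<open>\<kappa> + j \<alpha> = \<alpha> (\<kappa> \<beta> + j)\<close>. The product thus
        becomes \<open>\<alpha> ^ l\<close> times a product of \<open>l\<close> consecutive
        integers, which \<open>l!\<close> divides.\<close>
      then obtain \<beta> where \<beta>: "[\<alpha> * \<beta> = 1] (mod q ^ v)"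
        using cong_solve_coprime_int by blast
      have "[\<kappa> * (\<alpha> * \<beta>) + \<alpha> * int j = \<kappa> * 1 + \<alpha> * int j] (mod q ^ v)" for j
        by (intro cong_add cong_mult \<beta> cong_refl)
      then have "[(\<Prod>j<l. \<kappa> * (\<alpha> * \<beta>) + \<alpha> * int j) = (\<Prod>j<l. \<kappa> + int j * \<alpha>)] (mod q ^ v)"
        by (intro cong_prod) (simp add: mult.commute)
      moreover have "(\<Prod>j<l. \<kappa> * (\<alpha> * \<beta>) + \<alpha> * int j) = \<alpha> ^ l * pochhammer (\<kappa> * \<beta>) l"
        by (induction l) (simp_all add: pochhammer_Suc algebra_simps)
      moreover have "q ^ v dvd pochhammer (\<kappa> * \<beta>) l"
        using v fact_dvd_pochhammer dvd_trans by blast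
      ultimately have "q ^ v dvd (\<Prod>j<l. \<kappa> + int j * \<alpha>)"
        by (metis cong_dvd_iff dvd_mult)
      then show ?thesis by simp
    qed
    then show "multiplicity q (fact l) \<le> multiplicity q (\<alpha> ^ l * (\<Prod>j<l. \<kappa> + int j * \<alpha>))"
      unfolding v_def[symmetric] using q False by (intro multiplicity_geI) auto
  qed simp
qed

lemma N_0 [simp]: "N a b 0 = 1"
  by (simp add: N_def)

text \<open>Exactness of the division lets the factorials be cancelled over the integers, before
  reducing modulo \<open>p\<close>; the recursion therefore holds for all \<open>l\<close>. Together
  with \<open>N_0\<close> it is the only way in which \<open>N\<close> is used below.\<close>

lemma N_Suc: "of_nat (Suc l) * N a b (Suc l) = a * (b + of_nat l * a) * N a b l"
proof -
  define \<alpha> \<kappa> where "\<alpha> = to_int_mod_ring a" and "\<kappa> = to_int_mod_ring b"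
  define M where "M l = (\<alpha> ^ l * (\<Prod>j<l. \<kappa> + int j * \<alpha>)) div fact l" for l
  have M: "fact l * M l = \<alpha> ^ l * (\<Prod>j<l. \<kappa> + int j * \<alpha>)" for l
    unfolding M_def using fact_dvd_scaled_prod by (rule dvd_mult_div_cancel)
  have "fact l * (int (Suc l) * M (Suc l)) = fact l * (\<alpha> * (\<kappa> + int l * \<alpha>) * M l)"
    using M[of "Suc l"] M[of l] by (simp add: algebra_simps)
  then have "int (Suc l) * M (Suc l) = \<alpha> * (\<kappa> + int l * \<alpha>) * M l"
    by simp
  then have "of_int (int (Suc l) * M (Suc l)) = (of_int (\<alpha> * (\<kappa> + int l * \<alpha>) * M l) :: 'a mod_ring)"
    by (simp only:)
  moreover have "of_int \<alpha> = a" "of_int \<kappa> = b"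
    by (simp_all add: \<alpha>_def \<kappa>_def of_int_of_int_mod_ring)
  ultimately show ?thesis
    by (simp add: N_def Let_def M_def \<alpha>_def \<kappa>_def)
qed


section \<open>The opposite ring\<close>

text \<open>The standard antipode reverses products. As a ring homomorphism into the opposite ring
  it can be obtained from the universal property, like the coproduct and the counit.\<close>

datatype 'a opp = Opp (unopp: 'a)

instantiation opp :: (ring_1) ring_1
begin

definition "0 = Opp 0"
definition "1 = Opp 1"
definition "x + y = Opp (unopp x + unopp y)"
definition "x - y = Opp (unopp x - unopp y)"
definition "- x = Opp (- unopp x)"
definition "x * y = Opp (unopp y * unopp x)"

instance
  by standard (simp_all add: zero_opp_def one_opp_def plus_opp_def minus_opp_def uminus_opp_def
      times_opp_def algebra_simps)

end

lemma unopp_simps [simp]: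
  "unopp 0 = 0" "unopp 1 = 1" "unopp (x + y) = unopp x + unopp y" "unopp (x - y) = unopp x - unopp y"
  "unopp (- x) = - unopp x" "unopp (x * y) = unopp y * unopp x"
  by (simp_all add: zero_opp_def one_opp_def plus_opp_def minus_opp_def uminus_opp_def times_opp_def)

lemma unopp_power [simp]: "unopp (x ^ n) = unopp x ^ n"
  by (induction n) (simp_all add: power_commutes)

lemma unopp_of_nat [simp]: "unopp (of_nat n) = of_nat n"
  by (induction n) simp_all

lemma unopp_cst [simp]: "unopp (cst c) = cst c"
proof -
  have "unopp (of_int n) = of_int n" for n
    by (cases n) simp_all
  then show ?thesis by (simp add: cst_def)
qed

section \<open>The universal property of the restricted enveloping algebra\<close>

lemma factor_through_quotient:
  assumes "Quotient3 R Abs Rep" "reflp R" "\<And>x y. R x y \<Longrightarrow> f x = f y"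
  shows "f (Rep (Abs x)) = f x"
  using assms Quotient3_rep_abs[OF assms(1)] by (metis reflpD)

lemma of_int_mod_ring_eq_0: "of_int k = (0 :: 'p::prime_card mod_ring) \<longleftrightarrow> int CARD('p) dvd k"
proof -
  have "to_int_mod_ring (of_int k :: 'p mod_ring) = k mod int CARD('p)"
    by (simp only: of_int_of_int_mod_ring to_int_mod_ring.rep_eq of_int_mod_ring.rep_eq)
  then show ?thesis
    by (metis dvd_eq_mod_eq_0 to_int_mod_ring_hom.hom_0_iff)
qed

context
  includes witt.lifting and U_witt.lifting
begin

lemma U_incl_add: "U_incl (x + y) = U_incl x + U_incl y"
proof -
  have "single [x + y] 1 - (single [x] 1 + single [y] 1)
      \<in> enveloping_relators witt_scale (witt_bracket :: 'a witt \<Rightarrow> _)"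
    by (auto simp: enveloping_relators_def diff_diff_eq)
  then show ?thesis
    by (simp add: U_incl.abs_eq plus_U_witt.abs_eq U_witt.abs_eq_iff two_sided_ideal.gen)
qed

lemma U_incl_scale: "U_incl (witt_scale c x) = U_const c * U_incl x"
proof -
  have "single [witt_scale c x] 1 - single [x] c
      \<in> enveloping_relators witt_scale (witt_bracket :: 'a witt \<Rightarrow> _)"
    by (auto simp: enveloping_relators_def)
  moreover have "single [] c * single [x] 1 = single [x] c"
    by (simp add: mult_single plus_list_def)
  ultimately show ?thesis
    by (simp add: U_incl.abs_eq U_const.abs_eq times_U_witt.abs_eq U_witt.abs_eq_iff two_sided_ideal.gen)
qed

lemma U_incl_bracket: "U_incl (witt_bracket x y) = U_incl x * U_incl y - U_incl y * U_incl x"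
proof -
  have "single [x] 1 * single [y] 1 - single [y] 1 * single [x] 1 - single [witt_bracket x y] 1
      \<in> enveloping_relators witt_scale (witt_bracket :: 'a witt \<Rightarrow> _)"
    by (auto simp: enveloping_relators_def)
  from two_sided_ideal.gen[OF this] show ?thesis
    by (simp add: U_incl.abs_eq times_U_witt.abs_eq minus_U_witt.abs_eq
        U_witt.abs_eq_iff[symmetric] eq_commute[of "abs_U_witt (single [witt_bracket x y] 1)"])
qed

lemma ring_hom_U_const: "Ring_Hom.ring_hom (U_const :: 'p::prime_card mod_ring \<Rightarrow> 'p U_witt)"
proof unfold_locales
  fix c d :: "'p mod_ring"
  show "U_const (c + d) = U_const c + U_const d"
    by (simp add: U_const.abs_eq plus_U_witt.abs_eq single_add)
  show "U_const (c * d) = U_const c * U_const d"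
    by (simp add: U_const.abs_eq times_U_witt.abs_eq mult_single plus_list_def)
  show "U_const 0 = (0 :: 'p U_witt)"
    by (simp add: U_const.abs_eq zero_U_witt_def)
  have "single [] (1 :: 'p mod_ring) = (1 :: 'p witt list \<Rightarrow>\<^sub>0 'p mod_ring)"
    unfolding single_one[symmetric] by (simp add: zero_list_def)
  then show "U_const 1 = (1 :: 'p U_witt)"
    by (simp add: U_const.abs_eq one_U_witt_def)
qed

lemma U_const_cst: "U_const c = (cst c :: 'p::prime_card U_witt)"
  using ring_hom.hom_cst[OF ring_hom_U_const[where 'p='p], of c] by simp

lemma of_nat_card_U_witt: "(of_nat CARD('p) :: 'p::prime_card U_witt) = 0"
proof -
  interpret Ring_Hom.ring_hom "U_const :: 'p mod_ring \<Rightarrow> 'p U_witt" by (rule ring_hom_U_const)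
  show ?thesis using hom_of_nat[of "CARD('p)"] by simp
qed

lemma witt_gen_mod: "witt_gen (k mod int CARD('p)) = (witt_gen k :: 'p::prime_card witt)"
proof -
  have "witt_gen (k + int CARD('p) * int n) = (witt_gen k :: 'p witt)" for k n
  proof (induction n)
    case (Suc n)
    then show ?case
      using witt_gen_periodic[of "k + int CARD('p) * int n", where 'p='p]
      by (simp add: algebra_simps)
  qed simp
  then have *: "witt_gen (k + int CARD('p) * n) = (witt_gen k :: 'p witt)" if "n \<ge> 0" for k n
    using that by (metis zero_le_imp_eq_int)
  have "witt_gen (k + int CARD('p) * n) = (witt_gen k :: 'p witt)" for k n
  proof (cases "n \<ge> 0")
    case False
    then show ?thesis using *[of "- n" "k + int CARD('p) * n"] by simp
  qed (rule *)
  from this[of "k mod int CARD('p)" "k div int CARD('p)"] show ?thesis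
    by simp
qed

lemma witt_gen_cong:
  "of_int k = (of_int l :: 'p::prime_card mod_ring) \<Longrightarrow> witt_gen k = (witt_gen l :: 'p witt)"
  by (metis of_int_mod_ring_eq_0 witt_gen_mod mod_eq_dvd_iff of_int_diff right_minus_eq)

lemma U_witt_induct [case_names const incl plus times]:
  assumes "\<And>c :: 'p::prime_card mod_ring. P (cst c)" "\<And>x. P (U_incl x)"
    "\<And>x y. P x \<Longrightarrow> P y \<Longrightarrow> P (x + y)" "\<And>x y. P x \<Longrightarrow> P y \<Longrightarrow> P (x * y)"
  shows "P (x :: 'p U_witt)"
proof (induction x rule: U_witt.abs_induct)
  case (1 y)
  show ?case
  proof (induction y rule: poly_mapping_sum_induct)
    case zero
    show ?case using assms(1)[of 0] by (simp add: cst_def zero_U_witt_def)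
  next
    case (single w c)
    show ?case
    proof (induction w)
      case Nil
      show ?case using assms(1)[of c] by (simp add: U_const.abs_eq flip: U_const_cst)
    next
      case (Cons x w)
      have "abs_U_witt (single (x # w) c) = U_incl x * abs_U_witt (single w c)"
        by (simp add: U_incl.abs_eq times_U_witt.abs_eq mult_single plus_list_def)
      then show ?case using Cons assms(2,4) by metis
    qed
  next
    case (add x y)
    then show ?case using assms(3) by (simp add: plus_U_witt.abs_eq[symmetric])
  qed
qed

lemma witt_induct [case_names gen zero plus scale bracket]:
  assumes "\<And>k. P (witt_gen k)" "P 0" "\<And>x y. P x \<Longrightarrow> P y \<Longrightarrow> P (x + y)"
    "\<And>c x. P x \<Longrightarrow> P (witt_scale c x)" "\<And>x y. P x \<Longrightarrow> P y \<Longrightarrow> P (witt_bracket x y)"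
  shows "P x"
proof (induction x rule: witt.abs_induct)
  case (1 y)
  show ?case
  proof (induction y rule: poly_mapping_sum_induct)
    case zero
    show ?case using assms(2) by (simp add: zero_witt_def)
  next
    case (single u c)
    have "P (abs_witt (single u 1))"
    proof (induction u)
      case (Gen k)
      show ?case using assms(1)[of k] by (simp add: witt_gen.abs_eq)
    next
      case (Bracket u v)
      have "formal_bracket (single u 1) (single v (1 :: 'a mod_ring)) = single (Bracket u v) 1"
        by (simp add: formal_bracket_def)
      then show ?case using assms(5)[OF Bracket] by (simp add: witt_bracket.abs_eq)
    qed
    from assms(4)[OF this, of c] show ?case by (simp add: witt_scale.abs_eq)
  next
    case (add x y)
    then show ?case using assms(3) by (simp add: plus_witt.abs_eq[symmetric])
  qed
qed

primrec lie_word_value :: "('x \<Rightarrow> 'b::ring_1) \<Rightarrow> 'x lie_word \<Rightarrow> 'b" where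
  "lie_word_value d (Gen x) = d x"
| "lie_word_value d (Bracket u v)
    = lie_word_value d u * lie_word_value d v - lie_word_value d v * lie_word_value d u"

text \<open>A bracket of words is evaluated as a commutator, which is alternating and satisfies the
  Jacobi identity in every ring. So only the relators of the presentation remain: the bracket
  relators by \<open>comm\<close>, the periodicity because \<open>d\<close> is indexed by the
  field.\<close>

lemma witt_map_exists:
  fixes d :: "'p::prime_card mod_ring \<Rightarrow> 'b::ring_1"
  assumes char: "of_nat CARD('p) = (0 :: 'b)"
    and comm: "\<And>k l. d k * d l - d l * d k = cst (l - k) * d (k + l)"
  shows "\<exists>\<phi> :: 'p witt \<Rightarrow> 'b. (\<forall>x y. \<phi> (x + y) = \<phi> x + \<phi> y) \<and> (\<forall>c x. \<phi> (witt_scale c x) = cst c * \<phi> x)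
    \<and> (\<forall>x y. \<phi> (witt_bracket x y) = \<phi> x * \<phi> y - \<phi> y * \<phi> x) \<and> (\<forall>k. \<phi> (witt_gen k) = d (of_int k))"
proof -
  interpret cst: central_hom "cst :: 'p mod_ring \<Rightarrow> 'b" by (rule central_hom_cst[OF char])
  define f where "f = algebra_extension (cst :: 'p mod_ring \<Rightarrow> 'b) (lie_word_value (\<lambda>k. d (of_int k)))"
  note extension = cst.extension_add cst.extension_diff cst.extension_zero cst.extension_single cst.extension_scale
  note [simp] = extension[where g = "lie_word_value (\<lambda>k. d (of_int k))", folded f_def]
  have bracket_add: "formal_bracket (x + y) z = formal_bracket x z + formal_bracket y z"
    "formal_bracket z (x + y) = formal_bracket z x + formal_bracket z y"
    "formal_bracket 0 z = 0" "formal_bracket z 0 = 0"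
    for x y z :: "int lie_word \<Rightarrow>\<^sub>0 'p mod_ring"
    using formal_bracket_diff_left[of "x + y" y z] formal_bracket_diff_right[of z "x + y" y]
      formal_bracket_diff_left[of 0 0 z] formal_bracket_diff_right[of z 0 0]
    by (simp_all add: algebra_simps)
  have cst_mult: "cst c * x * (cst e * y) = cst (c * e) * (x * y)" for c e :: "'p mod_ring" and x y :: 'b
    by (metis cst.hom_mult cst_left_commute mult.assoc)
  have f_bracket: "f (formal_bracket x y) = f x * f y - f y * f x" for x y
  proof (induction x rule: poly_mapping_sum_induct)
    case (single u c)
    show ?case
    proof (induction y rule: poly_mapping_sum_induct)
      case (single v e)
      have "formal_bracket (single u c) (single v e) = single (Bracket u v) (c * e)"
        by (simp add: formal_bracket_def)
      then show ?case
        by (simp add: cst_mult right_diff_distrib mult.commute[of e c])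
    qed (simp_all add: bracket_add algebra_simps)
  qed (simp_all add: bracket_add algebra_simps)
  have f_ideal: "f x = 0" if "x \<in> lie_ideal witt_relators" for x
    using that
  proof induction
    case (gen r)
    then consider k l where "r = formal_bracket (single (Gen k) 1) (single (Gen l) 1)
        - single (Gen (k + l)) (of_int (l - k))"
      | k where "r = single (Gen (k + int CARD('p))) 1 - single (Gen k) 1"
      unfolding witt_relators_def by blast
    then show ?case
    proof cases
      case 1
      then show ?thesis using comm[of "of_int k" "of_int l"]
        by (simp add: f_bracket)
    qed simp
  qed (simp_all add: f_bracket algebra_simps)
  define \<phi> where "\<phi> x = f (rep_witt x)" for x
  have \<phi>: "\<phi> (abs_witt x) = f x" for x
    unfolding \<phi>_def
  proof (rule factor_through_quotient[OF Quotient3_witt])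
    show "reflp (\<lambda>x y. x - y \<in> lie_ideal (witt_relators :: (int lie_word \<Rightarrow>\<^sub>0 'p mod_ring) set))"
      by (simp add: reflp_def lie_ideal.zero)
    show "f x = f y" if "x - y \<in> lie_ideal witt_relators" for x y
      using f_ideal[OF that] by simp
  qed
  show ?thesis
  proof (intro exI conjI allI)
    fix x y c k
    show "\<phi> (x + y) = \<phi> x + \<phi> y"
      by (induction x rule: witt.abs_induct, induction y rule: witt.abs_induct)
        (simp add: plus_witt.abs_eq \<phi>)
    show "\<phi> (witt_bracket x y) = \<phi> x * \<phi> y - \<phi> y * \<phi> x"
      by (induction x rule: witt.abs_induct, induction y rule: witt.abs_induct)
        (simp add: witt_bracket.abs_eq \<phi> f_bracket)
    show "\<phi> (witt_scale c x) = cst c * \<phi> x"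
      by (induction x rule: witt.abs_induct) (simp add: witt_scale.abs_eq \<phi>)
    show "\<phi> (witt_gen k) = d (of_int k)"
      by (simp add: witt_gen.abs_eq \<phi>)
  qed
qed

lemma U_witt_hom_exists:
  fixes \<phi> :: "'p::prime_card witt \<Rightarrow> 'b::ring_1"
  assumes char: "of_nat CARD('p) = (0 :: 'b)"
    and add: "\<And>x y. \<phi> (x + y) = \<phi> x + \<phi> y" and scale: "\<And>c x. \<phi> (witt_scale c x) = cst c * \<phi> x"
    and bracket: "\<And>x y. \<phi> (witt_bracket x y) = \<phi> x * \<phi> y - \<phi> y * \<phi> x"
  shows "\<exists>\<Phi> :: 'p U_witt \<Rightarrow> 'b. Ring_Hom.ring_hom \<Phi> \<and> (\<forall>x. \<Phi> (U_incl x) = \<phi> x)"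
proof -
  interpret cst: central_hom "cst :: 'p mod_ring \<Rightarrow> 'b" by (rule central_hom_cst[OF char])
  define f where "f = algebra_extension (cst :: 'p mod_ring \<Rightarrow> 'b) (\<lambda>w. prod_list (map \<phi> w))"
  note extension = cst.extension_add cst.extension_diff cst.extension_zero cst.extension_single
  note [simp] = extension[where g = "\<lambda>w. prod_list (map \<phi> w)", folded f_def]
  have f_mult: "f (x * y) = f x * f y" for x y
    by (rule poly_mapping_mult_eqI)
      (simp_all add: mult_single plus_list_def cst.hom_mult mult.assoc cst_left_commute[of "prod_list _"])
  have f_one: "f 1 = 1"
    unfolding single_one[symmetric] by (simp add: zero_list_def)
  have f_ideal: "f x = 0" if "x \<in> two_sided_ideal (enveloping_relators witt_scale witt_bracket)" for x
    using that
    by (rule two_sided_ideal_kernel)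
      (auto simp: enveloping_relators_def f_mult add scale bracket)
  define \<Phi> where "\<Phi> x = f (rep_U_witt x)" for x
  have \<Phi>: "\<Phi> (abs_U_witt x) = f x" for x
    unfolding \<Phi>_def
  proof (rule factor_through_quotient[OF Quotient3_U_witt])
    show "reflp (\<lambda>x y. x - y \<in> two_sided_ideal
        (enveloping_relators witt_scale (witt_bracket :: 'p witt \<Rightarrow> _)))"
      by (simp add: reflp_def two_sided_ideal.zero)
    show "f x = f y"
      if "x - y \<in> two_sided_ideal (enveloping_relators witt_scale witt_bracket)" for x y
      using f_ideal[OF that] by simp
  qed
  have "Ring_Hom.ring_hom \<Phi>"
  proof unfold_locales
    fix x y
    show "\<Phi> (x + y) = \<Phi> x + \<Phi> y"
      by (induction x rule: U_witt.abs_induct, induction y rule: U_witt.abs_induct)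
        (simp add: plus_U_witt.abs_eq \<Phi>)
    show "\<Phi> (x * y) = \<Phi> x * \<Phi> y"
      by (induction x rule: U_witt.abs_induct, induction y rule: U_witt.abs_induct)
        (simp add: times_U_witt.abs_eq \<Phi> f_mult)
  qed (simp_all add: zero_U_witt_def one_U_witt_def \<Phi> f_one)
  moreover have "\<Phi> (U_incl x) = \<phi> x" for x
    by (simp add: U_incl.abs_eq \<Phi>)
  ultimately show ?thesis by blast
qed

end

lemma ring_hom_abs_Uc: "Ring_Hom.ring_hom (abs_Uc :: 'p::prime_card U_witt \<Rightarrow> 'p Uc)"
  by unfold_locales (simp_all add: plus_Uc.abs_eq times_Uc.abs_eq zero_Uc_def one_Uc_def)

lemma Uc_of_witt_abs: "Uc_of_witt x = abs_Uc (U_incl x)"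
  by (simp add: Uc_of_witt.abs_eq)

lemma Uc_const_cst: "Uc_const c = cst c"
  by (simp add: Uc_const.abs_eq U_const_cst ring_hom.hom_cst[OF ring_hom_abs_Uc])

lemma of_nat_card_Uc [simp]: "(of_nat CARD('p) :: 'p::prime_card Uc) = 0"
proof -
  interpret Ring_Hom.ring_hom "abs_Uc :: 'p U_witt \<Rightarrow> 'p Uc" by (rule ring_hom_abs_Uc)
  show ?thesis using hom_of_nat[of "CARD('p)"] by (simp add: of_nat_card_U_witt)
qed

lemma Uc_of_witt_gen: "Uc_of_witt (witt_gen k) = Uc_D (of_int k)"
  unfolding Uc_D_def
  by (rule arg_cong[of _ _ Uc_of_witt], rule witt_gen_cong) (simp add: of_int_of_int_mod_ring)

lemma Uc_D_commutator:
  "Uc_D k * Uc_D l - Uc_D l * Uc_D k = (cst (l - k) * Uc_D (k + l) :: 'p::prime_card Uc)"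
proof -
  interpret Ring_Hom.ring_hom "abs_Uc :: 'p U_witt \<Rightarrow> 'p Uc" by (rule ring_hom_abs_Uc)
  define m n where "m = to_int_mod_ring k" and "n = to_int_mod_ring l"
  have mn: "of_int m = k" "of_int n = l"
    by (simp_all add: m_def n_def of_int_of_int_mod_ring)
  have "Uc_of_witt (witt_bracket (witt_gen m) (witt_gen n))
      = Uc_D k * Uc_D l - (Uc_D l * Uc_D k :: 'p Uc)"
    by (simp add: Uc_of_witt_abs U_incl_bracket hom_minus hom_mult Uc_D_def m_def n_def)
  moreover have "Uc_of_witt (witt_bracket (witt_gen m) (witt_gen n))
      = (cst (l - k) * Uc_of_witt (witt_gen (m + n)) :: 'p Uc)"
    by (simp add: Uc_of_witt_abs witt_bracket_gen U_incl_scale hom_mult U_const_cst hom_cst mn)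
  ultimately show ?thesis
    by (simp add: Uc_of_witt_gen mn)
qed

lemma Uc_D_power:
  "(Uc_D 0 :: 'p::prime_card Uc) ^ CARD('p) = Uc_D 0"
  "k \<noteq> 0 \<Longrightarrow> (Uc_D k :: 'p Uc) ^ CARD('p) = 0"
proof -
  interpret Ring_Hom.ring_hom "abs_Uc :: 'p U_witt \<Rightarrow> 'p Uc" by (rule ring_hom_abs_Uc)
  have *: "abs_Uc x = abs_Uc y" if "x - y \<in> restricted_relators" for x y :: "'p U_witt"
    using that by (simp add: Uc.abs_eq_iff two_sided_ideal.gen)
  have "abs_Uc (U_incl (witt_gen 0) ^ CARD('p)) = (abs_Uc (U_incl (witt_gen 0)) :: 'p Uc)"
    by (rule *) (simp add: restricted_relators_def)
  then show "(Uc_D 0 :: 'p Uc) ^ CARD('p) = Uc_D 0"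
    by (simp add: Uc_D_def Uc_of_witt_abs hom_power)
  assume "k \<noteq> 0"
  then have "\<not> int CARD('p) dvd to_int_mod_ring k"
    using of_int_mod_ring_eq_0[of "to_int_mod_ring k", where 'p='p] by (simp add: of_int_of_int_mod_ring)
  then have "abs_Uc (U_incl (witt_gen (to_int_mod_ring k)) ^ CARD('p)) = (abs_Uc 0 :: 'p Uc)"
    by (intro *) (auto simp: restricted_relators_def)
  then show "(Uc_D k :: 'p Uc) ^ CARD('p) = 0"
    by (simp add: Uc_D_def Uc_of_witt_abs hom_power)
qed

lemma Uc_induct [case_names const D plus times]:
  assumes "\<And>c :: 'p::prime_card mod_ring. P (cst c)" "\<And>k. P (Uc_D k)"
    "\<And>x y. P x \<Longrightarrow> P y \<Longrightarrow> P (x + y)" "\<And>x y. P x \<Longrightarrow> P y \<Longrightarrow> P (x * y)"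
  shows "P (x :: 'p Uc)"
proof -
  interpret abs: Ring_Hom.ring_hom "abs_Uc :: 'p U_witt \<Rightarrow> 'p Uc" by (rule ring_hom_abs_Uc)
  interpret cst: Ring_Hom.ring_hom "cst :: 'p mod_ring \<Rightarrow> 'p Uc"
    by (rule ring_hom_cst[OF of_nat_card_Uc])
  \<comment> \<open>Brackets in the Witt algebra become commutators, so closure under subtraction is
    required; it comes from multiplication by the constant \<open>-1\<close>.\<close>
  have "P (- x)" if "P x" for x
    using assms(4)[OF assms(1)[of "- 1"] that] by (simp add: cst.hom_uminus)
  then have diff: "P (x - y)" if "P x" "P y" for x y
    using assms(3)[of x "- y"] that by simp
  have "P (abs_Uc (U_incl x))" for x
  proof (induction x rule: witt_induct)
    case (gen k)
    show ?case using assms(2) by (simp flip: Uc_of_witt_abs add: Uc_of_witt_gen)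
  next
    case zero
    have "U_incl (0 :: 'p witt) = 0"
      using U_incl_add[of "0 :: 'p witt" 0] by simp
    then show ?case using assms(1)[of 0] by simp
  next
    case (scale c x)
    then show ?case
      using assms(1,4) by (simp add: U_incl_scale U_const_cst abs.hom_mult abs.hom_cst)
  qed (simp_all add: assms diff U_incl_add U_incl_bracket abs.hom_add abs.hom_minus abs.hom_mult)
  note incl = this
  show ?thesis
  proof (induction x rule: Uc.abs_induct)
    case (1 y)
    show ?case
      by (induction y rule: U_witt_induct) (simp_all add: assms incl abs.hom_cst abs.hom_add abs.hom_mult)
  qed
qed

lemma Uc_hom_exists:
  fixes d :: "'p::prime_card mod_ring \<Rightarrow> 'b::ring_1"
  assumes char: "of_nat CARD('p) = (0 :: 'b)"
    and comm: "\<And>k l. d k * d l - d l * d k = cst (l - k) * d (k + l)"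
    and d_0: "d 0 ^ CARD('p) = d 0" and d_nz: "\<And>k. k \<noteq> 0 \<Longrightarrow> d k ^ CARD('p) = 0"
  shows "\<exists>\<Phi> :: 'p Uc \<Rightarrow> 'b. Ring_Hom.ring_hom \<Phi> \<and> (\<forall>k. \<Phi> (Uc_D k) = d k)"
proof -
  obtain \<phi> :: "'p witt \<Rightarrow> 'b" where \<phi>_hom: "(\<forall>x y. \<phi> (x + y) = \<phi> x + \<phi> y) \<and> (\<forall>c x. \<phi> (witt_scale c x) = cst c * \<phi> x)
    \<and> (\<forall>x y. \<phi> (witt_bracket x y) = \<phi> x * \<phi> y - \<phi> y * \<phi> x) \<and> (\<forall>k. \<phi> (witt_gen k) = d (of_int k))"
    using witt_map_exists[of d, OF char comm] by (rule exE)
  note \<phi> = \<phi>_hom[THEN conjunct2, THEN conjunct2, THEN conjunct2, rule_format]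
  obtain f :: "'p U_witt \<Rightarrow> 'b" where f: "Ring_Hom.ring_hom f \<and> (\<forall>x. f (U_incl x) = \<phi> x)"
    using U_witt_hom_exists[of \<phi>, OF char \<phi>_hom[THEN conjunct1, rule_format]
        \<phi>_hom[THEN conjunct2, THEN conjunct1, rule_format]
        \<phi>_hom[THEN conjunct2, THEN conjunct2, THEN conjunct1, rule_format]]
    by (rule exE)
  then have f_incl: "f (U_incl x) = \<phi> x" for x
    by blast
  interpret f: Ring_Hom.ring_hom f using f by (rule conjunct1)
  have f_ideal: "f x = 0" if "x \<in> two_sided_ideal restricted_relators" for x
    using that
    by (rule two_sided_ideal_kernel)
      (auto simp: restricted_relators_def f.hom_minus f.hom_power f.hom_add f.hom_mult f_incl \<phi> d_0
        of_int_mod_ring_eq_0 d_nz)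
  define \<Phi> where "\<Phi> x = f (rep_Uc x)" for x
  have \<Phi>: "\<Phi> (abs_Uc x) = f x" for x
    unfolding \<Phi>_def
  proof (rule factor_through_quotient[OF Quotient3_Uc])
    show "reflp (\<lambda>x y. x - y \<in> two_sided_ideal (restricted_relators :: 'p U_witt set))"
      by (simp add: reflp_def two_sided_ideal.zero)
    show "f x = f y" if "x - y \<in> two_sided_ideal restricted_relators" for x y
      using f_ideal[OF that] by (simp add: f.hom_minus)
  qed
  have "Ring_Hom.ring_hom \<Phi>"
  proof unfold_locales
    fix x y
    show "\<Phi> (x + y) = \<Phi> x + \<Phi> y"
      by (induction x rule: Uc.abs_induct, induction y rule: Uc.abs_induct)
        (simp add: plus_Uc.abs_eq \<Phi> f.hom_add)
    show "\<Phi> (x * y) = \<Phi> x * \<Phi> y"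
      by (induction x rule: Uc.abs_induct, induction y rule: Uc.abs_induct)
        (simp add: times_Uc.abs_eq \<Phi> f.hom_mult)
  qed (simp_all add: zero_Uc_def one_Uc_def \<Phi>)
  moreover have "\<Phi> (Uc_D k) = d k" for k
    by (simp add: Uc_D_def Uc_of_witt_abs \<Phi> f_incl \<phi> of_int_of_int_mod_ring)
  ultimately show ?thesis by blast
qed

lifting_forget Uc.lifting

section \<open>Polynomials over the restricted enveloping algebra\<close>

lemma ring_hom_Uct_const: "Ring_Hom.ring_hom (Uct_const :: 'p::prime_card Uc \<Rightarrow> 'p Uct)"
  by unfold_locales (simp_all add: Uct_const_def single_add mult_single)

lemma of_nat_card_Uct [simp]: "(of_nat CARD('p) :: 'p::prime_card Uct) = 0"
proof -
  interpret Ring_Hom.ring_hom "Uct_const :: 'p Uc \<Rightarrow> 'p Uct" by (rule ring_hom_Uct_const)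
  show ?thesis using hom_of_nat[of "CARD('p)"] by simp
qed

lemma Uct_t_commute: "Uct_t * x = x * Uct_t"
  by (induction x rule: poly_mapping_sum_induct)
    (simp_all add: Uct_t_def mult_single distrib_left distrib_right add.commute)

lemma Uct_t_power: "Uct_t ^ n = single n 1"
  by (induction n) (simp_all add: Uct_t_def mult_single)

lemma single_Uct: "single n a = Uct_const a * Uct_t ^ n"
  by (simp add: Uct_t_power Uct_const_def mult_single)

lemma Uct_induct [case_names const t plus times]:
  assumes "\<And>a. P (Uct_const a)" "P Uct_t"
    "\<And>x y. P x \<Longrightarrow> P y \<Longrightarrow> P (x + y)" "\<And>x y. P x \<Longrightarrow> P y \<Longrightarrow> P (x * y)"
  shows "P (x :: 'p::prime_card Uct)"
proof (induction x rule: poly_mapping_sum_induct)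
  case zero
  show ?case using assms(1)[of 0] by (simp add: Uct_const_def)
next
  case (single n a)
  show ?case
    unfolding single_Uct
  proof (induction n)
    case (Suc n)
    then show ?case
      using assms(4)[OF Suc assms(2)] by (simp only: power_Suc2 mult.assoc)
  qed (simp add: assms(1))
qed (rule assms(3))

lemma Uct_hom_exists:
  fixes \<Phi> :: "'p::prime_card Uc \<Rightarrow> 'b::ring_1"
  assumes "Ring_Hom.ring_hom \<Phi>" and comm: "\<And>a. \<tau> * \<Phi> a = \<Phi> a * \<tau>"
  shows "\<exists>\<Psi> :: 'p Uct \<Rightarrow> 'b. Ring_Hom.ring_hom \<Psi> \<and> (\<forall>a. \<Psi> (Uct_const a) = \<Phi> a) \<and> \<Psi> Uct_t = \<tau>"
proof -
  interpret \<Phi>: Ring_Hom.ring_hom \<Phi> by fact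
  define f where "f = linear_extension (\<lambda>a x. \<Phi> a * x) (\<lambda>n. \<tau> ^ n)"
  have f_add: "f (x + y) = f x + f y" for x y
    unfolding f_def by (rule linear_extension_plus) (simp_all add: \<Phi>.hom_add distrib_right)
  have f_single: "f (single n a) = \<Phi> a * \<tau> ^ n" for n a
    unfolding f_def by (simp add: linear_extension_single)
  have f_zero: "f 0 = 0"
    by (simp add: f_def)
  have pow: "\<tau> ^ n * \<Phi> a = \<Phi> a * \<tau> ^ n" for n a
    using comm by (simp add: power_commuting_commutes)
  have "f (x * y) = f x * f y" for x y
  proof (rule poly_mapping_mult_eqI[OF f_zero f_add])
    fix m a n b
    show "f (single m a * single n b) = f (single m a) * f (single n b)"
      using pow[of m b] by (simp add: f_single mult_single \<Phi>.hom_mult power_add) (metis mult.assoc)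
  qed
  moreover have "f 1 = 1"
    using f_single[of 0 1] by simp
  ultimately have "Ring_Hom.ring_hom f"
    by unfold_locales (simp_all add: f_add f_zero)
  then show ?thesis
    by (intro exI[of _ f]) (simp add: Uct_const_def Uct_t_def f_single)
qed

text \<open>Every constant is the image of an integer, so two ring homomorphisms can differ only at
  the indeterminate.\<close>

lemma mod_ring_poly_hom_eqI:
  fixes f g :: "'p::prime_card mod_ring poly \<Rightarrow> 'b::ring_1"
  assumes "Ring_Hom.ring_hom f" "Ring_Hom.ring_hom g" "f [:0, 1:] = g [:0, 1:]"
  shows "f = g"
proof
  interpret f: Ring_Hom.ring_hom f by fact
  interpret g: Ring_Hom.ring_hom g by fact
  have const: "[:a:] = cst a" for a :: "'p mod_ring"
    by (simp add: cst_def of_int_poly of_int_of_int_mod_ring)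
  show "f x = g x" for x
  proof (induction x)
    case (pCons a x)
    have "pCons a x = [:a:] + [:0, 1:] * x"
      by simp
    then show ?case
      by (simp only: const[of a] f.hom_add g.hom_add f.hom_mult g.hom_mult f.hom_cst g.hom_cst assms(3) pCons)
  qed simp
qed

text \<open>The scalars as central elements of \<open>Uct\<close>: \<open>Uct_scale\<close> becomes
  left multiplication (\<open>Uct_scale_eq\<close>), so that linearity of a ring homomorphism is a
  statement about its values on these elements.\<close>

definition Uct_of_poly :: "'p::prime_card mod_ring poly \<Rightarrow> 'p Uct"
  where "Uct_of_poly = eval_at cst Uct_t"

lemma ring_hom_Uct_of_poly: "Ring_Hom.ring_hom (Uct_of_poly :: 'p::prime_card mod_ring poly \<Rightarrow> _)"
  unfolding Uct_of_poly_def
  by (rule ring_hom_eval_at[OF ring_hom_cst[OF of_nat_card_Uct] cst_commute])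

lemma Uct_of_poly_pCons: "Uct_of_poly (pCons a f) = cst a + Uct_t * Uct_of_poly f"
  unfolding Uct_of_poly_def
  by (rule eval_at_pCons[OF ring_hom_cst[OF of_nat_card_Uct] cst_commute])

interpretation Uct_of_poly: Ring_Hom.ring_hom "Uct_of_poly :: 'p::prime_card mod_ring poly \<Rightarrow> _"
  by (rule ring_hom_Uct_of_poly)

lemma Uct_of_poly_simps [simp]:
  "Uct_of_poly [:c:] = cst c" "Uct_of_poly [:0, 1:] = Uct_t"
  by (simp_all add: Uct_of_poly_pCons cst_def)

lemma Uct_of_poly_commute: "Uct_of_poly f * x = x * Uct_of_poly f"
proof (induction f)
  case (pCons a f)
  have "Uct_t * Uct_of_poly f * x = x * (Uct_t * Uct_of_poly f)"
    unfolding mult.assoc pCons by (simp only: Uct_t_commute[of x] flip: mult.assoc)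
  then show ?case
    by (simp only: Uct_of_poly_pCons distrib_left distrib_right cst_commute[of a x])
qed simp

lemma Uct_scale_eq: "Uct_scale f x = Uct_of_poly f * x"
proof -
  have "(\<Sum>n\<le>degree f. single n (Uc_const (coeff f n))) = Uct_of_poly f"
    unfolding Uct_of_poly_def eval_at_altdef[OF ring_hom_cst[OF of_nat_card_Uct] cst_commute]
    by (simp add: single_Uct Uc_const_cst ring_hom.hom_cst[OF ring_hom_Uct_const])
  then show ?thesis by (simp only: Uct_scale_def)
qed

lemma assoc_algebra_central_hom:
  fixes \<kappa> :: "'r::comm_ring_1 \<Rightarrow> 'a::ring_1"
  assumes "Ring_Hom.ring_hom \<kappa>" and central: "\<And>c x. \<kappa> c * x = x * \<kappa> c"
  shows "assoc_algebra (\<lambda>c x. \<kappa> c * x)"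
proof -
  interpret Ring_Hom.ring_hom \<kappa> by fact
  show ?thesis
  proof
    show "\<kappa> c * (x * y) = x * (\<kappa> c * y)" for c x y
      by (metis central mult.assoc)
  qed (simp_all add: hom_add hom_mult algebra_simps)
qed

lemma assoc_algebra_Uct: "assoc_algebra (Uct_scale :: 'p::prime_card mod_ring poly \<Rightarrow> _)"
  using assoc_algebra_central_hom[OF ring_hom_Uct_of_poly Uct_of_poly_commute]
  by (simp add: Uct_scale_eq[abs_def])

lemma assoc_algebra_Uc: "assoc_algebra (Uc_scale :: 'p::prime_card mod_ring \<Rightarrow> _)"
  using assoc_algebra_central_hom[OF ring_hom_cst[OF of_nat_card_Uc] cst_commute]
  by (simp add: Uc_scale_def[abs_def] Uc_const_cst)


section \<open>Tensor powers as rings\<close>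

lemma equivp_free_span: "equivp (\<lambda>x y. x - y \<in> free_scale.span R)"
proof (rule equivpI)
  show "reflp (\<lambda>x y. x - y \<in> free_scale.span R)"
    by (simp add: reflp_def free_scale.span_zero)
  show "symp (\<lambda>x y. x - y \<in> free_scale.span R)"
    by (rule sympI) (drule free_scale.span_neg, simp)
  show "transp (\<lambda>x y. x - y \<in> free_scale.span R)"
    by (rule transpI) (drule (1) free_scale.span_add, simp)
qed

instantiation prod :: (monoid_mult, monoid_mult) monoid_mult
begin

definition "1 = (1, 1)"
definition "x * y = (fst x * fst y, snd x * snd y)"

instance
  by standard (simp_all add: one_prod_def times_prod_def mult.assoc)

end

lemma times_Pair [simp]: "(a, b) * (c, d) = (a * c, b * d)"
  by (simp add: times_prod_def)

lemma tensor_mult_eq: "tensor_mult = monoid_algebra_mult"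
proof (intro ext)
  fix x y :: "'a \<times> 'a \<Rightarrow>\<^sub>0 'b"
  have "(\<lambda>(c, d). single (a * c, b * d) (1 :: 'b)) = (\<lambda>n. single ((a, b) * n) 1)" for a b :: 'a
    by (simp add: fun_eq_iff)
  then show "tensor_mult x y = monoid_algebra_mult x y"
    by (simp add: tensor_mult_def monoid_algebra_mult_def case_prod_unfold)
qed

lemma tensor_relators_intros:
  "single (a + a', b) 1 - single (a, b) 1 - single (a', b) 1 \<in> tensor_relators scale"
  "single (a, b + b') 1 - single (a, b) 1 - single (a, b') 1 \<in> tensor_relators scale"
  "single (scale c a, b) 1 - single (a, b) c \<in> tensor_relators scale"
  "single (a, scale c b) 1 - single (a, b) c \<in> tensor_relators scale"
  unfolding tensor_relators_def by blast+

lemma tensor_relators_cases: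
  assumes "r \<in> tensor_relators scale"
  obtains a a' b where "r = single (a + a', b) 1 - single (a, b) 1 - single (a', b) 1"
  | a b b' where "r = single (a, b + b') 1 - single (a, b) 1 - single (a, b') 1"
  | a b c where "r = single (scale c a, b) 1 - single (a, b) c"
  | a b c where "r = single (a, scale c b) 1 - single (a, b) c"
  using assms unfolding tensor_relators_def by blast

lemma tensor3_relators_intros:
  "single (a + a', b, c) 1 - single (a, b, c) 1 - single (a', b, c) 1 \<in> tensor3_relators scale"
  "single (a, b + b', c) 1 - single (a, b, c) 1 - single (a, b', c) 1 \<in> tensor3_relators scale"
  "single (a, b, c + c') 1 - single (a, b, c) 1 - single (a, b, c') 1 \<in> tensor3_relators scale"
  "single (scale s a, b, c) 1 - single (a, b, c) s \<in> tensor3_relators scale"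
  "single (a, scale s b, c) 1 - single (a, b, c) s \<in> tensor3_relators scale"
  "single (a, b, scale s c) 1 - single (a, b, c) s \<in> tensor3_relators scale"
  unfolding tensor3_relators_def Un_iff mem_Collect_eq simp_thms by (metis | fast)+

lemma tensor3_relators_cases:
  assumes "r \<in> tensor3_relators scale"
  obtains a a' b c where "r = single (a + a', b, c) 1 - single (a, b, c) 1 - single (a', b, c) 1"
  | a b b' c where "r = single (a, b + b', c) 1 - single (a, b, c) 1 - single (a, b', c) 1"
  | a b c c' where "r = single (a, b, c + c') 1 - single (a, b, c) 1 - single (a, b, c') 1"
  | a b c s where "r = single (scale s a, b, c) 1 - single (a, b, c) s"
  | a b c s where "r = single (a, scale s b, c) 1 - single (a, b, c) s"
  | a b c s where "r = single (a, b, scale s c) 1 - single (a, b, c) s"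
  using assms unfolding tensor3_relators_def Un_iff mem_Collect_eq by (auto intro: that)

context assoc_algebra
begin

lemma tensor_relators_absorb:
  assumes "r \<in> tensor_relators scale"
  shows "monoid_algebra_mult (single m 1) r \<in> tensor_relators scale"
    "monoid_algebra_mult r (single m 1) \<in> tensor_relators scale"
proof -
  obtain m1 m2 where m: "m = (m1, m2)" by (cases m)
  note simps = m monoid_algebra_mult_diff distrib_left distrib_right
    scale_mult_left[symmetric] scale_mult_right[symmetric]
  have "monoid_algebra_mult (single m 1) r \<in> tensor_relators scale
      \<and> monoid_algebra_mult r (single m 1) \<in> tensor_relators scale"
    using assms by (cases rule: tensor_relators_cases) (simp_all add: simps tensor_relators_intros)
  then show "monoid_algebra_mult (single m 1) r \<in> tensor_relators scale"
    "monoid_algebra_mult r (single m 1) \<in> tensor_relators scale" by simp_all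
qed

lemma tensor3_relators_absorb:
  assumes "r \<in> tensor3_relators scale"
  shows "monoid_algebra_mult (single m 1) r \<in> tensor3_relators scale"
    "monoid_algebra_mult r (single m 1) \<in> tensor3_relators scale"
proof -
  obtain m1 m2 m3 where m: "m = (m1, m2, m3)" by (cases m)
  note simps = m monoid_algebra_mult_diff distrib_left distrib_right
    scale_mult_left[symmetric] scale_mult_right[symmetric]
  have "monoid_algebra_mult (single m 1) r \<in> tensor3_relators scale
      \<and> monoid_algebra_mult r (single m 1) \<in> tensor3_relators scale"
    using assms by (cases rule: tensor3_relators_cases) (simp_all add: simps tensor3_relators_intros)
  then show "monoid_algebra_mult (single m 1) r \<in> tensor3_relators scale"
    "monoid_algebra_mult r (single m 1) \<in> tensor3_relators scale" by simp_all
qed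

lemmas tensor_span_ideal = monoid_algebra_span_ideal[OF tensor_relators_absorb[THEN free_scale.span_base]]
lemmas tensor3_span_ideal = monoid_algebra_span_ideal[OF tensor3_relators_absorb[THEN free_scale.span_base]]

end

lemma monoid_algebra_mult_cong:
  assumes ideal: "\<And>a x. x \<in> free_scale.span R \<Longrightarrow> monoid_algebra_mult a x \<in> free_scale.span R"
      "\<And>a x. x \<in> free_scale.span R \<Longrightarrow> monoid_algebra_mult x a \<in> free_scale.span R"
    and "x - x' \<in> free_scale.span R" "y - y' \<in> free_scale.span R"
  shows "monoid_algebra_mult x y - monoid_algebra_mult x' y' \<in> free_scale.span R"
proof -
  have "monoid_algebra_mult x y - monoid_algebra_mult x' y'
      = monoid_algebra_mult (x - x') y + monoid_algebra_mult x' (y - y')"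
    by (simp add: monoid_algebra_mult_diff)
  then show ?thesis
    using assms by (simp add: free_scale.span_add)
qed

lemma free_span_add_cong:
  assumes "x - x' \<in> free_scale.span R" "y - y' \<in> free_scale.span R"
  shows "x + y - (x' + y') \<in> free_scale.span R" "x - y - (x' - y') \<in> free_scale.span R"
    "- x - - x' \<in> free_scale.span R"
  using free_scale.span_add[OF assms] free_scale.span_diff[OF assms] free_scale.span_neg[OF assms(1)]
  by (simp_all add: algebra_simps)

text \<open>The scalars act on the target through \<open>\<kappa>\<close>, which need not be
  injective: with \<open>\<kappa>\<close> evaluating at \<open>t = 0\<close> the notion also covers
  the reduction of tensors.\<close>

definition bilinear_map :: "('r::comm_ring_1 \<Rightarrow> 'a::ring_1 \<Rightarrow> 'a) \<Rightarrow> ('r \<Rightarrow> 'b::ring_1) \<Rightarrow> ('a \<Rightarrow> 'a \<Rightarrow> 'b) \<Rightarrow> bool"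
  where "bilinear_map scale \<kappa> g \<longleftrightarrow>
    (\<forall>a a' b. g (a + a') b = g a b + g a' b) \<and> (\<forall>a b b'. g a (b + b') = g a b + g a b') \<and>
    (\<forall>c a b. g (scale c a) b = \<kappa> c * g a b) \<and> (\<forall>c a b. g a (scale c b) = \<kappa> c * g a b)"

lemma (in central_hom) extension_tensor_relators:
  assumes "bilinear_map scale \<kappa> g" "r \<in> tensor_relators scale"
  shows "algebra_extension \<kappa> (\<lambda>(a, b). g a b) r = 0"
  using assms(2,1) by (cases rule: tensor_relators_cases) (simp_all add: extension_diff bilinear_map_def)

text \<open>A character of \<open>Uct\<close> that kills every \<open>D_k\<close> and
  \<open>t\<close>; its only purpose is to separate 0 from 1 in the tensor powers.\<close>

lemma Uct_augmentation_exists: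
  "\<exists>f :: 'p::prime_card Uct \<Rightarrow> 'p mod_ring. Ring_Hom.ring_hom f \<and> (\<forall>c. f (Uct_of_poly c) = poly c 0)"
proof -
  have "\<exists>f :: 'p Uc \<Rightarrow> 'p mod_ring. Ring_Hom.ring_hom f \<and> (\<forall>k. f (Uc_D k) = 0)"
    using Uc_hom_exists[of "\<lambda>_ :: 'p mod_ring. 0 :: 'p mod_ring"] by (simp add: power_0_left)
  then obtain f :: "'p Uc \<Rightarrow> 'p mod_ring" where "Ring_Hom.ring_hom f" by blast
  then obtain g :: "'p Uct \<Rightarrow> 'p mod_ring" where g: "Ring_Hom.ring_hom g" "g Uct_t = 0"
    using Uct_hom_exists[of f 0] by auto
  interpret g: Ring_Hom.ring_hom g by (rule g)
  have "(\<lambda>c. g (Uct_of_poly c)) = (\<lambda>c. poly c 0)"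
  proof (rule mod_ring_poly_hom_eqI)
    show "Ring_Hom.ring_hom (\<lambda>c. g (Uct_of_poly c))"
      by unfold_locales (simp_all add: hom_distribs)
    show "Ring_Hom.ring_hom (\<lambda>c :: 'p mod_ring poly. poly c 0)"
      by unfold_locales simp_all
  qed (simp add: g)
  then show ?thesis
    using g(1) by metis
qed

\<comment> \<open>The quotients by \<open>tensor_rel\<close> and \<open>tensor3_rel\<close> for
  \<open>Uct_scale\<close>, taken as types so that they can be rings and the structure maps ring
  homomorphisms.\<close>
quotient_type 'p Uct2 = "'p::prime_card Uct \<times> 'p Uct \<Rightarrow>\<^sub>0 'p mod_ring poly" /
  "\<lambda>x y. x - y \<in> free_scale.span (tensor_relators Uct_scale)"
  by (rule equivp_free_span)

quotient_type 'p Uct3 = "'p::prime_card Uct \<times> 'p Uct \<times> 'p Uct \<Rightarrow>\<^sub>0 'p mod_ring poly" /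
  "\<lambda>x y. x - y \<in> free_scale.span (tensor3_relators Uct_scale)"
  by (rule equivp_free_span)

text \<open>The product of the augmentations of the factors kills all relators but takes the value 1
  on the unit tensor. This is the axiom \<open>0 \<noteq> 1\<close> of \<open>ring_1\<close> for the
  tensor powers.\<close>

lemma single_one_notin_tensor_span:
  "single (1, 1) 1 \<notin> free_scale.span (tensor_relators (Uct_scale :: 'p::prime_card mod_ring poly \<Rightarrow> _))"
  "single (1, 1, 1) 1 \<notin> free_scale.span (tensor3_relators (Uct_scale :: 'p::prime_card mod_ring poly \<Rightarrow> _))"
proof -
  obtain f :: "'p Uct \<Rightarrow> 'p mod_ring" where "Ring_Hom.ring_hom f" and f: "\<And>c. f (Uct_of_poly c) = poly c 0"
    using Uct_augmentation_exists by blast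
  then interpret f: Ring_Hom.ring_hom f by simp
  interpret central_hom "\<lambda>c :: 'p mod_ring poly. poly c 0"
    by unfold_locales simp_all
  have "algebra_extension (\<lambda>c. poly c 0) (\<lambda>(a, b). f a * f b) r = 0"
    if "r \<in> tensor_relators Uct_scale" for r
    using that by (cases rule: tensor_relators_cases)
      (simp_all add: extension_diff f.hom_add Uct_scale_eq f.hom_mult f distrib_left distrib_right)
  from extension_span[OF this, where x = "single (1, 1) 1"]
  show "single (1, 1) 1 \<notin> free_scale.span (tensor_relators (Uct_scale :: 'p mod_ring poly \<Rightarrow> _))"
    by auto
  have "algebra_extension (\<lambda>c. poly c 0) (\<lambda>(a, b, c). f a * f b * f c) r = 0"
    if "r \<in> tensor3_relators Uct_scale" for r
    using that by (cases rule: tensor3_relators_cases)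
      (simp_all add: extension_diff f.hom_add Uct_scale_eq f.hom_mult f distrib_left distrib_right)
  from extension_span[OF this, where x = "single (1, 1, 1) 1"]
  show "single (1, 1, 1) 1 \<notin> free_scale.span (tensor3_relators (Uct_scale :: 'p mod_ring poly \<Rightarrow> _))"
    by auto
qed

instantiation Uct2 :: (prime_card) ring_1
begin

lift_definition zero_Uct2 :: "'a Uct2" is 0 .
lift_definition one_Uct2 :: "'a Uct2" is "single 1 1" .
lift_definition plus_Uct2 :: "'a Uct2 \<Rightarrow> 'a Uct2 \<Rightarrow> 'a Uct2" is "(+)"
  by (rule free_span_add_cong)
lift_definition minus_Uct2 :: "'a Uct2 \<Rightarrow> 'a Uct2 \<Rightarrow> 'a Uct2" is "(-)"
  by (rule free_span_add_cong)
lift_definition uminus_Uct2 :: "'a Uct2 \<Rightarrow> 'a Uct2" is uminus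
  by (rule free_span_add_cong)
lift_definition times_Uct2 :: "'a Uct2 \<Rightarrow> 'a Uct2 \<Rightarrow> 'a Uct2" is monoid_algebra_mult
  by (rule monoid_algebra_mult_cong[OF assoc_algebra.tensor_span_ideal[OF assoc_algebra_Uct]])

instance
proof
  show "(0 :: 'a Uct2) \<noteq> 1"
    by transfer (metis diff_0 free_scale.span_neg minus_minus one_prod_def single_one_notin_tensor_span(1))
qed (transfer; simp add: free_scale.span_zero monoid_algebra_mult_assoc monoid_algebra_mult_add)+

end

instantiation Uct3 :: (prime_card) ring_1
begin

lift_definition zero_Uct3 :: "'a Uct3" is 0 .
lift_definition one_Uct3 :: "'a Uct3" is "single 1 1" .
lift_definition plus_Uct3 :: "'a Uct3 \<Rightarrow> 'a Uct3 \<Rightarrow> 'a Uct3" is "(+)"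
  by (rule free_span_add_cong)
lift_definition minus_Uct3 :: "'a Uct3 \<Rightarrow> 'a Uct3 \<Rightarrow> 'a Uct3" is "(-)"
  by (rule free_span_add_cong)
lift_definition uminus_Uct3 :: "'a Uct3 \<Rightarrow> 'a Uct3" is uminus
  by (rule free_span_add_cong)
lift_definition times_Uct3 :: "'a Uct3 \<Rightarrow> 'a Uct3 \<Rightarrow> 'a Uct3" is monoid_algebra_mult
  by (rule monoid_algebra_mult_cong[OF assoc_algebra.tensor3_span_ideal[OF assoc_algebra_Uct]])

instance
proof
  show "(0 :: 'a Uct3) \<noteq> 1"
    by transfer (metis diff_0 free_scale.span_neg minus_minus one_prod_def single_one_notin_tensor_span(2))
qed (transfer; simp add: free_scale.span_zero monoid_algebra_mult_assoc monoid_algebra_mult_add)+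

end

definition tens :: "'p::prime_card Uct \<Rightarrow> 'p Uct \<Rightarrow> 'p Uct2"
  where "tens a b = abs_Uct2 (single (a, b) 1)"

definition tens3 :: "'p::prime_card Uct \<Rightarrow> 'p Uct \<Rightarrow> 'p Uct \<Rightarrow> 'p Uct3"
  where "tens3 a b c = abs_Uct3 (single (a, b, c) 1)"

definition Uct2_of_poly :: "'p::prime_card mod_ring poly \<Rightarrow> 'p Uct2"
  where "Uct2_of_poly c = abs_Uct2 (single 1 c)"

definition Uct3_of_poly :: "'p::prime_card mod_ring poly \<Rightarrow> 'p Uct3"
  where "Uct3_of_poly c = abs_Uct3 (single 1 c)"

lemma abs_Uct2_simps:
  "abs_Uct2 (x + y) = abs_Uct2 x + abs_Uct2 y" "abs_Uct2 (x - y) = abs_Uct2 x - abs_Uct2 y"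
  "abs_Uct2 (monoid_algebra_mult x y) = abs_Uct2 x * abs_Uct2 y" "abs_Uct2 0 = 0"
  by (simp_all add: plus_Uct2.abs_eq minus_Uct2.abs_eq times_Uct2.abs_eq zero_Uct2_def)

lemma abs_Uct3_simps:
  "abs_Uct3 (x + y) = abs_Uct3 x + abs_Uct3 y" "abs_Uct3 (x - y) = abs_Uct3 x - abs_Uct3 y"
  "abs_Uct3 (monoid_algebra_mult x y) = abs_Uct3 x * abs_Uct3 y" "abs_Uct3 0 = 0"
  by (simp_all add: plus_Uct3.abs_eq minus_Uct3.abs_eq times_Uct3.abs_eq zero_Uct3_def)

lemma central_hom_Uct2_of_poly: "central_hom (Uct2_of_poly :: 'p::prime_card mod_ring poly \<Rightarrow> _)"
proof
  fix c d :: "'p mod_ring poly" and x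
  show "Uct2_of_poly (c + d) = Uct2_of_poly c + Uct2_of_poly d"
    by (simp add: Uct2_of_poly_def single_add abs_Uct2_simps)
  show "Uct2_of_poly (c * d) = Uct2_of_poly c * Uct2_of_poly d"
    by (simp add: Uct2_of_poly_def flip: abs_Uct2_simps)
  show "Uct2_of_poly 0 = (0 :: 'p Uct2)" "Uct2_of_poly 1 = (1 :: 'p Uct2)"
    by (simp_all add: Uct2_of_poly_def abs_Uct2_simps one_Uct2_def)
  show "Uct2_of_poly c * x = x * Uct2_of_poly c"
  proof (induction x rule: Uct2.abs_induct)
    case (1 y)
    show ?case
      by (induction y rule: poly_mapping_sum_induct)
        (simp_all add: abs_Uct2_simps Uct2_of_poly_def distrib_left distrib_right mult.commute flip: abs_Uct2_simps(3))
  qed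
qed

lemma central_hom_Uct3_of_poly: "central_hom (Uct3_of_poly :: 'p::prime_card mod_ring poly \<Rightarrow> _)"
proof
  fix c d :: "'p mod_ring poly" and x
  show "Uct3_of_poly (c + d) = Uct3_of_poly c + Uct3_of_poly d"
    by (simp add: Uct3_of_poly_def single_add abs_Uct3_simps)
  show "Uct3_of_poly (c * d) = Uct3_of_poly c * Uct3_of_poly d"
    by (simp add: Uct3_of_poly_def flip: abs_Uct3_simps)
  show "Uct3_of_poly 0 = (0 :: 'p Uct3)" "Uct3_of_poly 1 = (1 :: 'p Uct3)"
    by (simp_all add: Uct3_of_poly_def abs_Uct3_simps one_Uct3_def)
  show "Uct3_of_poly c * x = x * Uct3_of_poly c"
  proof (induction x rule: Uct3.abs_induct)
    case (1 y)
    show ?case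
      by (induction y rule: poly_mapping_sum_induct)
        (simp_all add: abs_Uct3_simps Uct3_of_poly_def distrib_left distrib_right mult.commute flip: abs_Uct3_simps(3))
  qed
qed

interpretation Uct2_of_poly: central_hom "Uct2_of_poly :: 'p::prime_card mod_ring poly \<Rightarrow> _"
  by (rule central_hom_Uct2_of_poly)

interpretation Uct3_of_poly: central_hom "Uct3_of_poly :: 'p::prime_card mod_ring poly \<Rightarrow> _"
  by (rule central_hom_Uct3_of_poly)

interpretation Uct_of_poly: central_hom "Uct_of_poly :: 'p::prime_card mod_ring poly \<Rightarrow> _"
  by standard (rule Uct_of_poly_commute)

lemma abs_Uct2_single: "abs_Uct2 (single (a, b) c) = Uct2_of_poly c * tens a b"
  by (simp add: Uct2_of_poly_def tens_def one_prod_def flip: abs_Uct2_simps)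

lemma abs_Uct3_single: "abs_Uct3 (single (a, b, d) c) = Uct3_of_poly c * tens3 a b d"
  by (simp add: Uct3_of_poly_def tens3_def one_prod_def flip: abs_Uct3_simps)

lemma abs_Uct2_eq: "abs_Uct2 x = algebra_extension Uct2_of_poly (\<lambda>(a, b). tens a b) x"
  by (induction x rule: poly_mapping_sum_induct)
    (auto simp: abs_Uct2_simps Uct2_of_poly.extension_add abs_Uct2_single)

lemma abs_Uct3_eq: "abs_Uct3 x = algebra_extension Uct3_of_poly (\<lambda>(a, b, c). tens3 a b c) x"
  by (induction x rule: poly_mapping_sum_induct)
    (auto simp: abs_Uct3_simps Uct3_of_poly.extension_add abs_Uct3_single)

lemma abs_Uct2_relator: "r \<in> tensor_relators Uct_scale \<Longrightarrow> abs_Uct2 r = 0"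
  unfolding zero_Uct2_def by (simp add: Uct2.abs_eq_iff free_scale.span_base)

lemma abs_Uct3_relator: "r \<in> tensor3_relators Uct_scale \<Longrightarrow> abs_Uct3 r = 0"
  unfolding zero_Uct3_def by (simp add: Uct3.abs_eq_iff free_scale.span_base)

lemma tens_add: "tens (a + a') b = tens a b + tens a' b" "tens a (b + b') = tens a b + tens a b'"
  using abs_Uct2_relator[OF tensor_relators_intros(1)[of a a' b]]
    abs_Uct2_relator[OF tensor_relators_intros(2)[of a b b']]
  by (simp_all add: abs_Uct2_simps tens_def algebra_simps)

lemma tens_scale: "tens (Uct_of_poly c * a) b = Uct2_of_poly c * tens a b"
  "tens a (Uct_of_poly c * b) = Uct2_of_poly c * tens a b"
  using abs_Uct2_relator[OF tensor_relators_intros(3)[of Uct_scale c a b]]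
    abs_Uct2_relator[OF tensor_relators_intros(4)[of a Uct_scale c b]]
  by (simp_all add: abs_Uct2_simps Uct_scale_eq abs_Uct2_single[of _ _ c]) (simp_all add: tens_def)

lemma tens_mult: "tens a b * tens c d = tens (a * c) (b * d)"
  by (simp add: tens_def flip: abs_Uct2_simps)

lemma tens_one [simp]: "tens 1 1 = 1"
  by (simp add: tens_def one_Uct2_def one_prod_def)

lemma tens3_add: "tens3 (a + a') b c = tens3 a b c + tens3 a' b c"
  "tens3 a (b + b') c = tens3 a b c + tens3 a b' c" "tens3 a b (c + c') = tens3 a b c + tens3 a b c'"
  using abs_Uct3_relator[OF tensor3_relators_intros(1)[of a a' b c]]
    abs_Uct3_relator[OF tensor3_relators_intros(2)[of a b b' c]]
    abs_Uct3_relator[OF tensor3_relators_intros(3)[of a b c c']]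
  by (simp_all add: abs_Uct3_simps tens3_def algebra_simps)

lemma tens3_scale: "tens3 (Uct_of_poly s * a) b c = Uct3_of_poly s * tens3 a b c"
  "tens3 a (Uct_of_poly s * b) c = Uct3_of_poly s * tens3 a b c"
  "tens3 a b (Uct_of_poly s * c) = Uct3_of_poly s * tens3 a b c"
  using abs_Uct3_relator[OF tensor3_relators_intros(4)[of Uct_scale s a b c]]
    abs_Uct3_relator[OF tensor3_relators_intros(5)[of a Uct_scale s b c]]
    abs_Uct3_relator[OF tensor3_relators_intros(6)[of a b Uct_scale s c]]
  by (simp_all add: abs_Uct3_simps Uct_scale_eq abs_Uct3_single[of _ _ _ s]) (simp_all add: tens3_def)

lemma tens3_mult: "tens3 a b c * tens3 a' b' c' = tens3 (a * a') (b * b') (c * c')"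
  by (simp add: tens3_def flip: abs_Uct3_simps)

lemma tens3_one [simp]: "tens3 1 1 1 = 1"
  by (simp add: tens3_def one_Uct3_def one_prod_def)

interpretation tens_left: Modules.additive "\<lambda>a. tens a b"
  by standard (rule tens_add)

interpretation tens_right: Modules.additive "tens a"
  by standard (rule tens_add)

interpretation tens3_1: Modules.additive "\<lambda>a. tens3 a b c"
  by standard (rule tens3_add)

interpretation tens3_2: Modules.additive "\<lambda>b. tens3 a b c"
  by standard (rule tens3_add)

interpretation tens3_3: Modules.additive "\<lambda>c. tens3 a b c"
  by standard (rule tens3_add)

text \<open>A scalar coefficient can be absorbed into the left factor, so the pure tensors generate
  the tensor square additively.\<close>

lemma Uct2_induct [case_names tens zero plus]:
  assumes "\<And>a b. P (tens a b)" "P 0" "\<And>x y. P x \<Longrightarrow> P y \<Longrightarrow> P (x + y)"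
  shows "P x"
proof (induction x rule: Uct2.abs_induct)
  case (1 y)
  show ?case
  proof (induction y rule: poly_mapping_sum_induct)
    case (single k c)
    obtain a b where "k = (a, b)" by (cases k)
    then have "abs_Uct2 (single k c) = tens (Uct_of_poly c * a) b"
      by (simp add: abs_Uct2_single tens_scale)
    then show ?case by (simp add: assms(1))
  qed (simp_all add: abs_Uct2_simps assms)
qed

lemma ring_hom_tens: "Ring_Hom.ring_hom (\<lambda>a. tens a 1)" "Ring_Hom.ring_hom (tens 1)"
  by (unfold_locales; simp add: tens_left.zero tens_right.zero tens_add tens_mult)+

lemma of_nat_card_Uct2 [simp]: "(of_nat CARD('p) :: 'p::prime_card Uct2) = 0"
  using semiring_hom.hom_of_nat[of "tens (1 :: 'p Uct)" "CARD('p)"] ring_hom_tens(2)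
  by (simp add: Ring_Hom.ring_hom_def tens_right.zero)

section \<open>Maps out of the tensor square\<close>

definition tensor_extension ::
    "('p::prime_card mod_ring poly \<Rightarrow> 'b::ring_1) \<Rightarrow> ('p Uct \<Rightarrow> 'p Uct \<Rightarrow> 'b) \<Rightarrow> 'p Uct2 \<Rightarrow> 'b"
  where "tensor_extension \<kappa> g x = algebra_extension \<kappa> (\<lambda>(a, b). g a b) (rep_Uct2 x)"

context
  fixes \<kappa> :: "'p::prime_card mod_ring poly \<Rightarrow> 'b::ring_1" and g :: "'p Uct \<Rightarrow> 'p Uct \<Rightarrow> 'b"
  assumes \<kappa>: "central_hom \<kappa>" and g: "bilinear_map Uct_scale \<kappa> g"
begin

interpretation central_hom \<kappa> by (rule \<kappa>)

lemma tensor_extension_abs: "tensor_extension \<kappa> g (abs_Uct2 x) = algebra_extension \<kappa> (\<lambda>(a, b). g a b) x"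
  unfolding tensor_extension_def
proof (rule factor_through_quotient[OF Quotient3_Uct2])
  show "reflp (\<lambda>x y :: 'p Uct \<times> 'p Uct \<Rightarrow>\<^sub>0 'p mod_ring poly. x - y \<in> free_scale.span (tensor_relators Uct_scale))"
    by (simp add: reflp_def free_scale.span_zero)
  show "algebra_extension \<kappa> (\<lambda>(a, b). g a b) x = algebra_extension \<kappa> (\<lambda>(a, b). g a b) y"
    if "x - y \<in> free_scale.span (tensor_relators Uct_scale)" for x y
    using extension_span[OF extension_tensor_relators[OF g] that] by (simp add: extension_diff)
qed

lemma tensor_extension_tens: "tensor_extension \<kappa> g (tens a b) = g a b"
  by (simp add: tens_def tensor_extension_abs)

lemma tensor_extension_add: "tensor_extension \<kappa> g (x + y) = tensor_extension \<kappa> g x + tensor_extension \<kappa> g y"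
  by (induction x rule: Uct2.abs_induct, induction y rule: Uct2.abs_induct)
    (simp add: tensor_extension_abs extension_add flip: abs_Uct2_simps)

lemma tensor_extension_ring_hom:
  assumes "\<And>a b c d. g (a * c) (b * d) = g a b * g c d" "g 1 1 = 1"
  shows "Ring_Hom.ring_hom (tensor_extension \<kappa> g)"
proof unfold_locales
  show "tensor_extension \<kappa> g (x * y) = tensor_extension \<kappa> g x * tensor_extension \<kappa> g y" for x y
    by (induction x rule: Uct2.abs_induct, induction y rule: Uct2.abs_induct)
      (simp add: tensor_extension_abs extension_mult assms times_prod_def case_prod_beta flip: abs_Uct2_simps)
  show "tensor_extension \<kappa> g 1 = 1"
    using tensor_extension_tens[of 1 1] assms(2) by simp
  show "tensor_extension \<kappa> g 0 = 0"
    using tensor_extension_add[of 0 0] by simp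
qed (rule tensor_extension_add)

end

section \<open>The standard Hopf algebra structure\<close>

lemma Uct_D_commutator:
  "Uct_D k * Uct_D l - Uct_D l * Uct_D k = (cst (l - k) * Uct_D (k + l) :: 'p::prime_card Uct)"
proof -
  interpret Ring_Hom.ring_hom "Uct_const :: 'p Uc \<Rightarrow> 'p Uct" by (rule ring_hom_Uct_const)
  show ?thesis
    using arg_cong[OF Uc_D_commutator[of k l], of Uct_const]
    by (simp add: Uct_D_def hom_minus hom_mult hom_cst)
qed

lemma Uct_D_power:
  "(Uct_D 0 :: 'p::prime_card Uct) ^ CARD('p) = Uct_D 0"
  "k \<noteq> 0 \<Longrightarrow> (Uct_D k :: 'p Uct) ^ CARD('p) = 0"
proof -
  interpret Ring_Hom.ring_hom "Uct_const :: 'p Uc \<Rightarrow> 'p Uct" by (rule ring_hom_Uct_const)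
  show "(Uct_D 0 :: 'p::prime_card Uct) ^ CARD('p) = Uct_D 0"
    "k \<noteq> 0 \<Longrightarrow> (Uct_D k :: 'p Uct) ^ CARD('p) = 0"
    using Uc_D_power(1)[where 'p='p] Uc_D_power(2)[of k] by (simp_all add: Uct_D_def flip: hom_power)
qed

lemma Uct_gen_induct [case_names cst D t plus times]:
  assumes "\<And>c :: 'p::prime_card mod_ring. P (cst c)" "\<And>k. P (Uct_D k)" "P Uct_t"
    "\<And>x y. P x \<Longrightarrow> P y \<Longrightarrow> P (x + y)" "\<And>x y. P x \<Longrightarrow> P y \<Longrightarrow> P (x * y)"
  shows "P (x :: 'p Uct)"
proof (induction x rule: Uct_induct)
  case (const a)
  interpret Ring_Hom.ring_hom "Uct_const :: 'p Uc \<Rightarrow> 'p Uct" by (rule ring_hom_Uct_const)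
  show ?case
    by (induction a rule: Uc_induct) (simp_all add: assms hom_cst hom_add hom_mult flip: Uct_D_def)
qed (simp_all add: assms)

lemma Uct_hom_eqI:
  fixes f g :: "'p::prime_card Uct \<Rightarrow> 'b::ring_1"
  assumes "Ring_Hom.ring_hom f" "Ring_Hom.ring_hom g" "\<And>k. f (Uct_D k) = g (Uct_D k)" "f Uct_t = g Uct_t"
  shows "f x = g x"
proof -
  interpret f: Ring_Hom.ring_hom f by fact
  interpret g: Ring_Hom.ring_hom g by fact
  show ?thesis
    by (induction x rule: Uct_gen_induct)
      (simp_all add: assms f.hom_cst g.hom_cst f.hom_add g.hom_add f.hom_mult g.hom_mult)
qed

lemma Uct_gen_hom_exists:
  fixes d :: "'p::prime_card mod_ring \<Rightarrow> 'b::ring_1"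
  assumes "of_nat CARD('p) = (0 :: 'b)"
    and "\<And>k l. d k * d l - d l * d k = cst (l - k) * d (k + l)"
    and "d 0 ^ CARD('p) = d 0" and "\<And>k. k \<noteq> 0 \<Longrightarrow> d k ^ CARD('p) = 0"
    and \<tau>: "\<And>x. \<tau> * x = x * \<tau>"
  shows "\<exists>f :: 'p Uct \<Rightarrow> 'b. Ring_Hom.ring_hom f \<and> (\<forall>k. f (Uct_D k) = d k) \<and> f Uct_t = \<tau>"
proof -
  obtain \<Phi> :: "'p Uc \<Rightarrow> 'b" where \<Phi>: "Ring_Hom.ring_hom \<Phi> \<and> (\<forall>k. \<Phi> (Uc_D k) = d k)"
    using Uc_hom_exists[of d, OF assms(1-4)] by (rule exE)
  show ?thesis
    using Uct_hom_exists[of \<Phi> \<tau>] \<Phi> \<tau> unfolding Uct_D_def by metis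
qed

text \<open>Homomorphisms out of \<open>Uct\<close> are specified on the \<open>D_k\<close> and on
  \<open>t\<close>; this is what makes them linear over the polynomial ring.\<close>

lemma Uct_hom_of_poly:
  fixes f :: "'p::prime_card Uct \<Rightarrow> 'b::ring_1"
  assumes "Ring_Hom.ring_hom f" "Ring_Hom.ring_hom \<kappa>" "f Uct_t = \<kappa> [:0, 1:]"
  shows "f (Uct_of_poly c) = \<kappa> c"
proof -
  interpret f: Ring_Hom.ring_hom f by fact
  have "(\<lambda>c. f (Uct_of_poly c)) = \<kappa>"
    by (rule mod_ring_poly_hom_eqI[OF _ assms(2)])
      (unfold_locales, simp_all add: f.hom_add f.hom_mult Uct_of_poly.hom_add Uct_of_poly.hom_mult assms(3))
  then show ?thesis by metis
qed

text \<open>The summands \<open>D_k \<otimes> 1\<close> and \<open>1 \<otimes> D_k\<close> commute,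
  so the \<open>p\<close>-th power is additive on them and the restricted relations are
  respected.\<close>

lemma std_comult_exists:
  "\<exists>f :: 'p::prime_card Uct \<Rightarrow> 'p Uct2. Ring_Hom.ring_hom f
    \<and> (\<forall>k. f (Uct_D k) = tens (Uct_D k) 1 + tens 1 (Uct_D k)) \<and> f Uct_t = Uct2_of_poly [:0, 1:]"
proof (rule Uct_gen_hom_exists)
  interpret L: Ring_Hom.ring_hom "\<lambda>a :: 'p Uct. tens a 1" by (rule ring_hom_tens)
  interpret R: Ring_Hom.ring_hom "tens (1 :: 'p Uct)" by (rule ring_hom_tens)
  have power: "(tens (Uct_D k) 1 + tens 1 (Uct_D k)) ^ CARD('p)
      = tens (Uct_D k ^ CARD('p)) 1 + tens 1 (Uct_D k ^ CARD('p))" for k :: "'p mod_ring"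
    unfolding L.hom_power R.hom_power
    by (rule freshmans_dream_commuting[OF _ prime_card of_nat_card_Uct2]) (simp add: tens_mult)
  show "(tens (Uct_D 0) 1 + tens 1 (Uct_D 0)) ^ CARD('p) = tens (Uct_D 0) 1 + tens (1 :: 'p Uct) (Uct_D 0)"
    by (simp only: power Uct_D_power)
  show "(tens (Uct_D k) 1 + tens 1 (Uct_D k)) ^ CARD('p) = 0" if "k \<noteq> 0" for k :: "'p mod_ring"
    by (simp only: power Uct_D_power(2)[OF that] L.hom_zero R.hom_zero add_0)
  show "(tens (Uct_D k) 1 + tens 1 (Uct_D k)) * (tens (Uct_D l) 1 + tens 1 (Uct_D l))
      - (tens (Uct_D l) 1 + tens 1 (Uct_D l)) * (tens (Uct_D k) 1 + tens 1 (Uct_D k))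
      = cst (l - k) * (tens (Uct_D (k + l)) 1 + tens 1 (Uct_D (k + l)))" for k l :: "'p mod_ring"
  proof -
    have "(tens (Uct_D k) 1 + tens 1 (Uct_D k)) * (tens (Uct_D l) 1 + tens 1 (Uct_D l))
      - (tens (Uct_D l) 1 + tens 1 (Uct_D l)) * (tens (Uct_D k) 1 + tens 1 (Uct_D k))
      = tens (Uct_D k * Uct_D l - Uct_D l * Uct_D k) 1 + tens 1 (Uct_D k * Uct_D l - Uct_D l * Uct_D k)"
      by (simp add: tens_left.diff tens_right.diff tens_mult distrib_left distrib_right)
    then show ?thesis
      by (simp only: Uct_D_commutator L.hom_mult R.hom_mult L.hom_cst R.hom_cst distrib_left)
  qed
qed (simp_all add: Uct2_of_poly.central)

definition std_comult :: "'p::prime_card Uct \<Rightarrow> 'p Uct2"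
  where "std_comult = (SOME f. Ring_Hom.ring_hom f
    \<and> (\<forall>k. f (Uct_D k) = tens (Uct_D k) 1 + tens 1 (Uct_D k)) \<and> f Uct_t = Uct2_of_poly [:0, 1:])"

lemmas std_comult_spec = someI_ex[OF std_comult_exists, folded std_comult_def]

interpretation std_comult: Ring_Hom.ring_hom std_comult
  by (rule conjunct1[OF std_comult_spec])

lemma std_comult_simps [simp]:
  "std_comult (Uct_D k) = tens (Uct_D k) 1 + tens 1 (Uct_D k)" "std_comult Uct_t = Uct2_of_poly [:0, 1:]"
  using std_comult_spec by auto

lemma std_comult_of_poly: "std_comult (Uct_of_poly c) = Uct2_of_poly c"
  by (rule Uct_hom_of_poly[OF std_comult.ring_hom_axioms Uct2_of_poly.ring_hom_axioms]) simp

lemma std_counit_exists: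
  "\<exists>f :: 'p::prime_card Uct \<Rightarrow> 'p mod_ring poly. Ring_Hom.ring_hom f \<and> (\<forall>k. f (Uct_D k) = 0) \<and> f Uct_t = [:0, 1:]"
  by (rule Uct_gen_hom_exists) (simp_all add: power_0_left of_nat_poly)

definition std_counit :: "'p::prime_card Uct \<Rightarrow> 'p mod_ring poly"
  where "std_counit = (SOME f. Ring_Hom.ring_hom f \<and> (\<forall>k. f (Uct_D k) = 0) \<and> f Uct_t = [:0, 1:])"

lemmas std_counit_spec = someI_ex[OF std_counit_exists, folded std_counit_def]

interpretation std_counit: Ring_Hom.ring_hom std_counit
  by (rule conjunct1[OF std_counit_spec])

lemma std_counit_simps [simp]: "std_counit (Uct_D k) = 0" "std_counit Uct_t = [:0, 1:]"
  using std_counit_spec by auto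

lemma std_counit_of_poly [simp]: "std_counit (Uct_of_poly c) = c"
  by (rule Uct_hom_of_poly[OF std_counit.ring_hom_axioms, of id, simplified]) (unfold_locales, simp_all)

text \<open>Reversing the product compensates the sign in the commutator relation, and
  \<open>(- D) ^ p = - (D ^ p)\<close> for odd \<open>p\<close> preserves the restricted
  relations.\<close>

lemma std_antipode_exists:
  assumes "odd CARD('p)"
  shows "\<exists>f :: 'p::prime_card Uct \<Rightarrow> 'p Uct opp. Ring_Hom.ring_hom f
    \<and> (\<forall>k. f (Uct_D k) = Opp (- Uct_D k)) \<and> f Uct_t = Opp Uct_t"
proof (rule Uct_gen_hom_exists)
  show "of_nat CARD('p) = (0 :: 'p Uct opp)"
    by (rule opp.expand) simp
  show "Opp (- Uct_D k) * Opp (- Uct_D l) - Opp (- Uct_D l) * Opp (- Uct_D k)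
      = cst (l - k) * Opp (- Uct_D (k + l))" for k l :: "'p mod_ring"
  proof (rule opp.expand)
    have "cst (k - l) * Uct_D (k + l) = - (cst (l - k) * Uct_D (k + l) :: 'p Uct)"
      by (simp flip: Uct_D_commutator add: Uct_D_commutator[of l k, symmetric, unfolded add.commute[of l k]])
    then show "unopp (Opp (- Uct_D k) * Opp (- Uct_D l) - Opp (- Uct_D l) * Opp (- Uct_D k))
      = unopp (cst (l - k) * Opp (- Uct_D (k + l)))"
      using Uct_D_commutator[of l k] by (simp add: cst_commute add.commute)
  qed
  show "Opp (- Uct_D 0) ^ CARD('p) = Opp (- Uct_D (0 :: 'p mod_ring))"
    by (rule opp.expand) (simp_all add: power_minus_odd assms Uct_D_power)
  show "Opp (- Uct_D k) ^ CARD('p) = 0" if "k \<noteq> 0" for k :: "'p mod_ring"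
    by (rule opp.expand) (simp_all add: power_minus_odd assms Uct_D_power that)
  show "Opp Uct_t * x = x * Opp Uct_t" for x :: "'p Uct opp"
    by (rule opp.expand) (simp_all add: Uct_t_commute)
qed

definition std_antipode :: "'p::prime_card Uct \<Rightarrow> 'p Uct"
  where "std_antipode x = unopp ((SOME f. Ring_Hom.ring_hom f
    \<and> (\<forall>k. f (Uct_D k) = Opp (- Uct_D k)) \<and> f Uct_t = Opp Uct_t) x)"

lemma std_antipode:
  assumes "odd CARD('p)"
  shows "std_antipode (x + y) = std_antipode x + (std_antipode y :: 'p::prime_card Uct)"
    "std_antipode (x * y) = std_antipode y * std_antipode x"
    "std_antipode 1 = (1 :: 'p Uct)" "std_antipode (cst (c :: 'p mod_ring)) = (cst c :: 'p Uct)"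
    "std_antipode (Uct_D k :: 'p Uct) = - Uct_D k"
    "std_antipode (Uct_t :: 'p Uct) = Uct_t"
proof -
  define f where "f = (SOME f :: 'p Uct \<Rightarrow> 'p Uct opp. Ring_Hom.ring_hom f
    \<and> (\<forall>k. f (Uct_D k) = Opp (- Uct_D k)) \<and> f Uct_t = Opp Uct_t)"
  note f_spec = someI_ex[OF std_antipode_exists[OF assms], folded f_def]
  interpret f: Ring_Hom.ring_hom f using f_spec by (rule conjunct1)
  have S: "std_antipode x = unopp (f x)" for x
    by (simp add: std_antipode_def f_def)
  show "std_antipode (x + y) = std_antipode x + (std_antipode y :: 'p::prime_card Uct)"
    "std_antipode (x * y) = std_antipode y * std_antipode x"
    "std_antipode 1 = (1 :: 'p Uct)" "std_antipode (cst (c :: 'p mod_ring)) = (cst c :: 'p Uct)"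
    "std_antipode (Uct_D k :: 'p Uct) = - Uct_D k"
    "std_antipode (Uct_t :: 'p Uct) = Uct_t"
    using f_spec by (simp_all add: S f.hom_add f.hom_mult f.hom_cst)
qed

lemma additive_std_antipode:
  assumes "odd CARD('p)"
  shows "Modules.additive (std_antipode :: 'p::prime_card Uct \<Rightarrow> _)"
  by standard (rule std_antipode(1)[OF assms])

lemma std_antipode_of_poly:
  assumes "odd CARD('p)"
  shows "std_antipode (Uct_of_poly c) = (Uct_of_poly c :: 'p::prime_card Uct)"
proof -
  interpret Modules.additive "std_antipode :: 'p Uct \<Rightarrow> _" by (rule additive_std_antipode[OF assms])
  show ?thesis
    by (induction c) (simp_all add: zero Uct_of_poly_pCons std_antipode[OF assms] flip: Uct_t_commute)
qed

section \<open>Hopf structures as maps between rings\<close>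

definition emb12 :: "'p::prime_card Uct2 \<Rightarrow> 'p Uct3"
  where "emb12 = tensor_extension Uct3_of_poly (\<lambda>a b. tens3 a b 1)"

definition emb23 :: "'p::prime_card Uct2 \<Rightarrow> 'p Uct3"
  where "emb23 = tensor_extension Uct3_of_poly (\<lambda>a b. tens3 1 a b)"

lemma bilinear_emb:
  "bilinear_map Uct_scale Uct3_of_poly (\<lambda>a b. tens3 a b (1 :: 'p::prime_card Uct))"
  "bilinear_map Uct_scale Uct3_of_poly (\<lambda>a b. tens3 (1 :: 'p::prime_card Uct) a b)"
  by (simp_all add: bilinear_map_def Uct_scale_eq tens3_add tens3_scale)

lemma emb_tens [simp]: "emb12 (tens a b) = tens3 a b 1" "emb23 (tens a b) = tens3 1 a b"
  by (simp_all add: emb12_def emb23_def tensor_extension_tens[OF central_hom_Uct3_of_poly bilinear_emb(1)]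
      tensor_extension_tens[OF central_hom_Uct3_of_poly bilinear_emb(2)])

interpretation emb12: Ring_Hom.ring_hom emb12
  unfolding emb12_def
  by (rule tensor_extension_ring_hom[OF central_hom_Uct3_of_poly bilinear_emb(1)]) (simp_all add: tens3_mult)

interpretation emb23: Ring_Hom.ring_hom emb23
  unfolding emb23_def
  by (rule tensor_extension_ring_hom[OF central_hom_Uct3_of_poly bilinear_emb(2)]) (simp_all add: tens3_mult)

lemma Uct2_of_poly_tens: "Uct2_of_poly c = tens (Uct_of_poly c) 1"
  using tens_scale(1)[of c 1 1] by simp

lemma Uct3_of_poly_tens3: "Uct3_of_poly c = tens3 (Uct_of_poly c) 1 1" "Uct3_of_poly c = tens3 1 (Uct_of_poly c) 1"
  using tens3_scale(1)[of c 1 1 1] tens3_scale(2)[of 1 c 1 1] by simp_all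

lemma emb_of_poly: "emb12 (Uct2_of_poly c) = Uct3_of_poly c" "emb23 (Uct2_of_poly c) = Uct3_of_poly c"
  by (simp_all add: Uct2_of_poly_tens Uct3_of_poly_tens3(1)) (simp flip: Uct3_of_poly_tens3)

lemma emb12_commute: "emb12 x * tens3 1 1 b = tens3 1 1 b * emb12 x"
  by (induction x rule: Uct2_induct) (simp_all add: tens3_mult emb12.hom_add distrib_left distrib_right)

lemma emb23_commute: "emb23 x * tens3 a 1 1 = tens3 a 1 1 * emb23 x"
  by (induction x rule: Uct2_induct) (simp_all add: tens3_mult emb23.hom_add distrib_left distrib_right)

text \<open>This is \<open>\<delta> \<otimes> id\<close>. Writing it as a product in the tensor
  cube, of factors that commute by \<open>emb12_commute\<close>, makes it a ring homomorphism
  whenever \<open>\<delta>\<close> is one.\<close>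

definition comult_left :: "('p::prime_card Uct \<Rightarrow> 'p Uct2) \<Rightarrow> 'p Uct2 \<Rightarrow> 'p Uct3"
  where "comult_left \<delta> = tensor_extension Uct3_of_poly (\<lambda>a b. emb12 (\<delta> a) * tens3 1 1 b)"

definition comult_right :: "('p::prime_card Uct \<Rightarrow> 'p Uct2) \<Rightarrow> 'p Uct2 \<Rightarrow> 'p Uct3"
  where "comult_right \<delta> = tensor_extension Uct3_of_poly (\<lambda>a b. tens3 a 1 1 * emb23 (\<delta> b))"

definition counit_left :: "('p::prime_card Uct \<Rightarrow> 'p mod_ring poly) \<Rightarrow> 'p Uct2 \<Rightarrow> 'p Uct"
  where "counit_left \<epsilon> = tensor_extension Uct_of_poly (\<lambda>a b. Uct_of_poly (\<epsilon> a) * b)"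

definition counit_right :: "('p::prime_card Uct \<Rightarrow> 'p mod_ring poly) \<Rightarrow> 'p Uct2 \<Rightarrow> 'p Uct"
  where "counit_right \<epsilon> = tensor_extension Uct_of_poly (\<lambda>a b. Uct_of_poly (\<epsilon> b) * a)"

text \<open>Multiplication after \<open>S \<otimes> id\<close>. In contrast to the maps for the
  coproduct and the counit, it is only used as an additive map.\<close>

definition antipode_left :: "('p::prime_card Uct \<Rightarrow> 'p Uct) \<Rightarrow> 'p Uct2 \<Rightarrow> 'p Uct"
  where "antipode_left S = tensor_extension Uct_of_poly (\<lambda>a b. S a * b)"

definition antipode_right :: "('p::prime_card Uct \<Rightarrow> 'p Uct) \<Rightarrow> 'p Uct2 \<Rightarrow> 'p Uct"
  where "antipode_right S = tensor_extension Uct_of_poly (\<lambda>a b. a * S b)"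

locale uct_comult = Ring_Hom.ring_hom \<delta> for \<delta> :: "'p::prime_card Uct \<Rightarrow> 'p Uct2" +
  assumes of_poly: "\<delta> (Uct_of_poly c) = Uct2_of_poly c"
begin

lemma bilinear_comult:
  "bilinear_map Uct_scale Uct3_of_poly (\<lambda>a b. emb12 (\<delta> a) * tens3 1 1 b)"
  "bilinear_map Uct_scale Uct3_of_poly (\<lambda>a b. tens3 a 1 1 * emb23 (\<delta> b))"
  by (simp_all add: bilinear_map_def Uct_scale_eq tens3_add tens3_scale hom_add hom_mult of_poly emb_of_poly
      emb12.hom_add emb12.hom_mult emb23.hom_add emb23.hom_mult distrib_left distrib_right mult.assoc
      Uct3_of_poly.left_commute)

lemma comult_left_tens [simp]: "comult_left \<delta> (tens a b) = emb12 (\<delta> a) * tens3 1 1 b"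
  by (simp add: comult_left_def tensor_extension_tens[OF central_hom_Uct3_of_poly bilinear_comult(1)])

lemma comult_right_tens [simp]: "comult_right \<delta> (tens a b) = tens3 a 1 1 * emb23 (\<delta> b)"
  by (simp add: comult_right_def tensor_extension_tens[OF central_hom_Uct3_of_poly bilinear_comult(2)])

lemma ring_hom_comult_left: "Ring_Hom.ring_hom (comult_left \<delta>)"
  unfolding comult_left_def
proof (rule tensor_extension_ring_hom[OF central_hom_Uct3_of_poly bilinear_comult(1)])
  fix a b c d
  have "emb12 (\<delta> a) * emb12 (\<delta> c) * (tens3 1 1 b * tens3 1 1 d)
      = emb12 (\<delta> a) * tens3 1 1 b * (emb12 (\<delta> c) * tens3 1 1 d)"
    using emb12_commute[of "\<delta> c" b] by (simp add: mult.assoc) (simp flip: mult.assoc)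
  then show "emb12 (\<delta> (a * c)) * tens3 1 1 (b * d)
      = emb12 (\<delta> a) * tens3 1 1 b * (emb12 (\<delta> c) * tens3 1 1 d)"
    by (simp add: hom_mult emb12.hom_mult tens3_mult)
qed simp

lemma ring_hom_comult_right: "Ring_Hom.ring_hom (comult_right \<delta>)"
  unfolding comult_right_def
proof (rule tensor_extension_ring_hom[OF central_hom_Uct3_of_poly bilinear_comult(2)])
  fix a b c d
  have "tens3 a 1 1 * tens3 c 1 1 * (emb23 (\<delta> b) * emb23 (\<delta> d))
      = tens3 a 1 1 * emb23 (\<delta> b) * (tens3 c 1 1 * emb23 (\<delta> d))"
    using emb23_commute[of "\<delta> b" c] by (simp add: mult.assoc) (simp flip: mult.assoc)
  then show "tens3 (a * c) 1 1 * emb23 (\<delta> (b * d))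
      = tens3 a 1 1 * emb23 (\<delta> b) * (tens3 c 1 1 * emb23 (\<delta> d))"
    by (simp add: hom_mult emb23.hom_mult tens3_mult)
qed simp

sublocale comult_left: Ring_Hom.ring_hom "comult_left \<delta>" by (rule ring_hom_comult_left)
sublocale comult_right: Ring_Hom.ring_hom "comult_right \<delta>" by (rule ring_hom_comult_right)

end

locale uct_counit = Ring_Hom.ring_hom \<epsilon> for \<epsilon> :: "'p::prime_card Uct \<Rightarrow> 'p mod_ring poly" +
  assumes of_poly: "\<epsilon> (Uct_of_poly c) = c"
begin

lemma bilinear_counit:
  "bilinear_map Uct_scale Uct_of_poly (\<lambda>a b. Uct_of_poly (\<epsilon> a) * b)"
  "bilinear_map Uct_scale Uct_of_poly (\<lambda>a b. Uct_of_poly (\<epsilon> b) * a)"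
  by (simp_all add: bilinear_map_def Uct_scale_eq hom_add hom_mult of_poly Uct_of_poly.hom_add
      Uct_of_poly.hom_mult distrib_left distrib_right mult.assoc
      Uct_of_poly.left_commute[of "Uct_of_poly (\<epsilon> _)"])

lemma counit_tens [simp]:
  "counit_left \<epsilon> (tens a b) = Uct_of_poly (\<epsilon> a) * b" "counit_right \<epsilon> (tens a b) = Uct_of_poly (\<epsilon> b) * a"
  by (simp_all add: counit_left_def counit_right_def
      tensor_extension_tens[OF Uct_of_poly.central_hom_axioms bilinear_counit(1)]
      tensor_extension_tens[OF Uct_of_poly.central_hom_axioms bilinear_counit(2)])

sublocale counit_left: Ring_Hom.ring_hom "counit_left \<epsilon>"
  unfolding counit_left_def
proof (rule tensor_extension_ring_hom[OF Uct_of_poly.central_hom_axioms bilinear_counit(1)])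
  fix a b c d
  show "Uct_of_poly (\<epsilon> (a * c)) * (b * d) = Uct_of_poly (\<epsilon> a) * b * (Uct_of_poly (\<epsilon> c) * d)"
    by (simp add: hom_mult Uct_of_poly.hom_mult mult.assoc Uct_of_poly.left_commute[of b])
qed simp

sublocale counit_right: Ring_Hom.ring_hom "counit_right \<epsilon>"
  unfolding counit_right_def
proof (rule tensor_extension_ring_hom[OF Uct_of_poly.central_hom_axioms bilinear_counit(2)])
  fix a b c d
  show "Uct_of_poly (\<epsilon> (b * d)) * (a * c) = Uct_of_poly (\<epsilon> b) * a * (Uct_of_poly (\<epsilon> d) * c)"
    by (simp add: hom_mult Uct_of_poly.hom_mult mult.assoc Uct_of_poly.left_commute[of a])
qed simp

end

locale uct_antipode =
  fixes S :: "'p::prime_card Uct \<Rightarrow> 'p Uct"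
  assumes add: "S (a + b) = S a + S b" and of_poly: "S (Uct_of_poly c * a) = Uct_of_poly c * S a"
begin

lemma bilinear_antipode:
  "bilinear_map Uct_scale Uct_of_poly (\<lambda>a b. S a * b)" "bilinear_map Uct_scale Uct_of_poly (\<lambda>a b. a * S b)"
  by (simp_all add: bilinear_map_def Uct_scale_eq add of_poly distrib_left distrib_right mult.assoc
      Uct_of_poly.left_commute)

lemma antipode_tens [simp]: "antipode_left S (tens a b) = S a * b" "antipode_right S (tens a b) = a * S b"
  by (simp_all add: antipode_left_def antipode_right_def
      tensor_extension_tens[OF Uct_of_poly.central_hom_axioms bilinear_antipode(1)]
      tensor_extension_tens[OF Uct_of_poly.central_hom_axioms bilinear_antipode(2)])

sublocale antipode_left: Modules.additive "antipode_left S"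
  by unfold_locales (simp add: antipode_left_def
      tensor_extension_add[OF Uct_of_poly.central_hom_axioms bilinear_antipode(1)])

sublocale antipode_right: Modules.additive "antipode_right S"
  by unfold_locales (simp add: antipode_right_def
      tensor_extension_add[OF Uct_of_poly.central_hom_axioms bilinear_antipode(2)])

end

text \<open>The Hopf axioms with coproducts as elements of the ring \<open>Uct2\<close> instead of
  classes of formal tensors; \<open>hopf_embedding\<close> below translates back.\<close>

locale uct_hopf = comult: uct_comult \<delta> + counit: uct_counit \<epsilon> + antipode: uct_antipode S
  for \<delta> :: "'p::prime_card Uct \<Rightarrow> 'p Uct2" and \<epsilon> S +
  assumes coassoc: "comult_left \<delta> (\<delta> a) = comult_right \<delta> (\<delta> a)"
    and counit_left: "counit_left \<epsilon> (\<delta> a) = a" and counit_right: "counit_right \<epsilon> (\<delta> a) = a"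
    and antipode_left: "antipode_left S (\<delta> a) = Uct_of_poly (\<epsilon> a)"
    and antipode_right: "antipode_right S (\<delta> a) = Uct_of_poly (\<epsilon> a)"

interpretation std_comult: uct_comult std_comult
  by standard (rule std_comult_of_poly)

interpretation std_counit: uct_counit std_counit
  by standard simp

lemma ring_hom_comp:
  assumes "Ring_Hom.ring_hom f" "Ring_Hom.ring_hom g"
  shows "Ring_Hom.ring_hom (\<lambda>x. f (g x))"
proof -
  interpret f: Ring_Hom.ring_hom f by fact
  interpret g: Ring_Hom.ring_hom g by fact
  show ?thesis by unfold_locales (simp_all add: f.hom_add f.hom_mult g.hom_add g.hom_mult)
qed

lemma ring_hom_id: "Ring_Hom.ring_hom (\<lambda>x. x)"
  by unfold_locales simp_all

lemma std_coassoc: "comult_left std_comult (std_comult a) = comult_right std_comult (std_comult a)"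
proof (rule Uct_hom_eqI)
  show "Ring_Hom.ring_hom (\<lambda>a :: 'a Uct. comult_left std_comult (std_comult a))"
    by (rule ring_hom_comp[OF std_comult.comult_left.ring_hom_axioms std_comult.ring_hom_axioms])
  show "Ring_Hom.ring_hom (\<lambda>a :: 'a Uct. comult_right std_comult (std_comult a))"
    by (rule ring_hom_comp[OF std_comult.comult_right.ring_hom_axioms std_comult.ring_hom_axioms])
  show "comult_left std_comult (std_comult (Uct_D k)) = comult_right std_comult (std_comult (Uct_D k))" for k
    by (simp add: std_comult.comult_left.hom_add std_comult.comult_right.hom_add emb12.hom_add emb23.hom_add
        add.assoc)
  show "comult_left std_comult (std_comult Uct_t) = comult_right std_comult (std_comult Uct_t)"
    by (simp only: std_comult_simps)
      (simp add: Uct2_of_poly_tens Uct3_of_poly_tens3(1) emb_of_poly)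
qed

lemma std_counit_left: "counit_left std_counit (std_comult a) = a"
  by (rule Uct_hom_eqI[OF ring_hom_comp[OF std_counit.counit_left.ring_hom_axioms std_comult.ring_hom_axioms]
        ring_hom_id])
    (simp_all add: std_counit.counit_left.hom_add, simp add: Uct2_of_poly_tens)

lemma std_counit_right: "counit_right std_counit (std_comult a) = a"
  by (rule Uct_hom_eqI[OF ring_hom_comp[OF std_counit.counit_right.ring_hom_axioms std_comult.ring_hom_axioms]
        ring_hom_id])
    (simp_all add: std_counit.counit_right.hom_add, simp add: Uct2_of_poly_tens)

lemma uct_antipode_std:
  assumes "odd CARD('p)"
  shows "uct_antipode (std_antipode :: 'p::prime_card Uct \<Rightarrow> _)"
  by standard (simp_all add: std_antipode[OF assms] std_antipode_of_poly[OF assms] Uct_of_poly.central)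

text \<open>Multiplication after \<open>S \<otimes> id\<close> is not multiplicative, so checking
  generators is not immediately enough. But its value at \<open>X (x \<otimes> y)\<close> is
  \<open>S x\<close> times its value at \<open>X\<close> times \<open>y\<close>; if the middle value
  is a central scalar it can be pulled out. Hence the elements that satisfy the axiom are closed
  under products.\<close>

lemma std_antipode_left:
  fixes a :: "'p::prime_card Uct"
  assumes odd_p: "odd CARD('p)"
  shows "antipode_left std_antipode (std_comult a) = Uct_of_poly (std_counit a)"
proof -
  interpret uct_antipode "std_antipode :: 'p Uct \<Rightarrow> _" by (rule uct_antipode_std[OF odd_p])
  have mult: "antipode_left std_antipode (X * Y) = Uct_of_poly c * antipode_left std_antipode Y"
    if X: "antipode_left std_antipode X = Uct_of_poly c" for X Y :: "'p Uct2" and c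
  proof (induction Y rule: Uct2_induct)
    case (tens x y)
    have "antipode_left std_antipode (X * tens x y) = std_antipode x * antipode_left std_antipode X * y"
      by (induction X rule: Uct2_induct)
        (simp_all add: tens_mult std_antipode[OF odd_p] antipode_left.zero antipode_left.add
          distrib_left distrib_right mult.assoc)
    then show ?case
      by (simp add: X mult.assoc Uct_of_poly.left_commute[of "std_antipode x"])
  qed (simp_all add: antipode_left.zero antipode_left.add distrib_left)
  show ?thesis
  proof (induction a rule: Uct_gen_induct)
    case (cst c)
    have "std_comult (cst c) = tens (cst c) (1 :: 'p Uct)"
      by (simp add: std_comult.hom_cst ring_hom.hom_cst[OF ring_hom_tens(1)])
    then show ?case
      by (simp add: std_antipode[OF odd_p] std_counit.hom_cst Uct_of_poly.hom_cst)
  next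
    case t
    show ?case by (simp add: Uct2_of_poly_tens std_antipode[OF odd_p])
  qed (simp_all add: std_antipode[OF odd_p] antipode_left.add std_comult.hom_add std_comult.hom_mult
      std_counit.hom_add std_counit.hom_mult Uct_of_poly.hom_add Uct_of_poly.hom_mult mult)
qed

text \<open>The mirror image: now the coproduct of the second factor is enclosed between
  \<open>x\<close> and \<open>S y\<close>, so it is that one which has to be sent to a
  scalar.\<close>

lemma std_antipode_right:
  fixes a :: "'p::prime_card Uct"
  assumes odd_p: "odd CARD('p)"
  shows "antipode_right std_antipode (std_comult a) = Uct_of_poly (std_counit a)"
proof -
  interpret uct_antipode "std_antipode :: 'p Uct \<Rightarrow> _" by (rule uct_antipode_std[OF odd_p])
  have mult: "antipode_right std_antipode (X * Y) = antipode_right std_antipode X * Uct_of_poly c"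
    if Y: "antipode_right std_antipode Y = Uct_of_poly c" for X Y :: "'p Uct2" and c
  proof (induction X rule: Uct2_induct)
    case (tens x y)
    have "antipode_right std_antipode (tens x y * Y) = x * antipode_right std_antipode Y * std_antipode y"
      by (induction Y rule: Uct2_induct)
        (simp_all add: tens_mult std_antipode[OF odd_p] antipode_right.zero antipode_right.add
          distrib_left distrib_right mult.assoc)
    then show ?case
      by (simp add: Y mult.assoc Uct_of_poly.central[of c "std_antipode y"])
  qed (simp_all add: antipode_right.zero antipode_right.add distrib_right)
  show ?thesis
  proof (induction a rule: Uct_gen_induct)
    case (cst c)
    have "std_comult (cst c) = tens (cst c) (1 :: 'p Uct)"
      by (simp add: std_comult.hom_cst ring_hom.hom_cst[OF ring_hom_tens(1)])
    then show ?case
      by (simp add: std_antipode[OF odd_p] std_counit.hom_cst Uct_of_poly.hom_cst)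
  next
    case t
    show ?case by (simp add: Uct2_of_poly_tens std_antipode[OF odd_p])
  qed (simp_all add: std_antipode[OF odd_p] antipode_right.add std_comult.hom_add std_comult.hom_mult
      std_counit.hom_add std_counit.hom_mult Uct_of_poly.hom_add Uct_of_poly.hom_mult mult)
qed

lemma uct_hopf_std:
  assumes "odd CARD('p)"
  shows "uct_hopf (std_comult :: 'p::prime_card Uct \<Rightarrow> _) std_counit std_antipode"
proof -
  interpret uct_antipode "std_antipode :: 'p Uct \<Rightarrow> _" by (rule uct_antipode_std[OF assms])
  show ?thesis
    by unfold_locales
      (simp_all add: std_coassoc std_counit_left std_counit_right
        std_antipode_left[OF assms] std_antipode_right[OF assms])
qed

section \<open>The twist\<close>

lemma sum_UNIV_shift:
  fixes f :: "'p::prime_card mod_ring \<Rightarrow> 'b::comm_monoid_add"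
  shows "(\<Sum>a\<in>UNIV. f (a + c)) = (\<Sum>a\<in>UNIV. f a)"
  by (rule sum.reindex_bij_witness[of _ "\<lambda>a. a - c" "\<lambda>a. a + c"]) auto

lemma sum_UNIV_uminus:
  fixes f :: "'p::prime_card mod_ring \<Rightarrow> 'b::comm_monoid_add"
  shows "(\<Sum>a\<in>UNIV. f (- a)) = (\<Sum>a\<in>UNIV. f a)"
  by (rule sum.reindex_bij_witness[of _ uminus uminus]) auto

lemma power_mulUct_t_commuteuting:
  fixes x y :: "'b::monoid_mult"
  assumes "y * x = x * y"
  shows "(x * y) ^ n = x ^ n * y ^ n"
proof (induction n)
  case (Suc n)
  have "(x * y) ^ Suc n = x * (y * x ^ n) * y ^ n"
    by (simp add: Suc mult.assoc)
  also have "y * x ^ n = x ^ n * y"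
    using assms power_commuting_commutes[of x y n] by simp
  finally show ?case by (simp add: mult.assoc)
qed simp

interpretation Uct_cst: Ring_Hom.ring_hom "cst :: 'p::prime_card mod_ring \<Rightarrow> 'p Uct"
  by (rule ring_hom_cst[OF of_nat_card_Uct])

text \<open>The numerator of the binomial coefficient of \<open>a\<close> over \<open>l\<close>. The
  denominator is carried by \<open>N\<close>, so no division occurs.\<close>

definition falling :: "'p::prime_card mod_ring \<Rightarrow> nat \<Rightarrow> 'p mod_ring"
  where "falling a l = (\<Prod>j<l. a - of_nat j)"

lemma falling_0 [simp]: "falling a 0 = 1"
  by (simp add: falling_def)

lemma falling_Suc: "falling a (Suc l) = falling a l * (a - of_nat l)"
  by (simp add: falling_def)

lemma falling_add_1: "falling (a + 1) (Suc l) = (a + 1) * falling a l"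
  unfolding falling_def by (subst prod.lessThan_Suc_shift) (simp add: algebra_simps)

lemma falling_zero: "falling 0 (Suc l) = 0"
  by (induction l) (simp_all add: falling_Suc)

text \<open>Pascal's rule with denominators cleared.\<close>

lemma falling_pascal: "falling (a + 1) (Suc l) = falling a (Suc l) + of_nat (Suc l) * falling a l"
  by (simp add: falling_add_1) (simp add: falling_Suc algebra_simps)

lemma Uct2_of_poly_const: "Uct2_of_poly [:c:] = cst c"
  by (simp add: Uct2_of_poly_tens ring_hom.hom_cst[OF ring_hom_tens(1)])

locale witt_twist =
  fixes i :: "'p::prime_card mod_ring"
  assumes odd_p: "odd CARD('p)" and i_nz: "i \<noteq> 0"
begin

text \<open>With these scalars \<open>h e = e h + e\<close>, so multiplication by \<open>e\<close>
  moves eigenvalues of \<open>h\<close> by exactly 1.\<close>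

definition h :: "'p Uct" where "h = cst (1 / i) * Uct_D 0"
definition e :: "'p Uct" where "e = cst i * Uct_D i"
definition w :: "'p Uct" where "w = 1 - e * Uct_t"
text \<open>The image of \<open>w\<close> under the standard antipode, see
  \<open>std_antipode_W\<close>.\<close>

definition w' :: "'p Uct" where "w' = 1 + e * Uct_t"
definition P :: "'p mod_ring \<Rightarrow> 'p Uct" where "P = idem h"
definition W :: "'p mod_ring \<Rightarrow> 'p Uct" where "W = mod_power w"
definition W' :: "'p mod_ring \<Rightarrow> 'p Uct" where "W' = mod_power w'"

lemma h_power: "h ^ CARD('p) = h"
proof -
  have "h ^ CARD('p) = cst (1 / i) ^ CARD('p) * Uct_D 0 ^ CARD('p)"
    unfolding h_def by (rule power_mulUct_t_commuteuting) (simp add: cst_commute)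
  then show ?thesis
    by (simp only: Uct_D_power fermat_mod_ring(1) h_def flip: Uct_cst.hom_power)
qed

lemma e_power: "e ^ CARD('p) = 0"
proof -
  have "e ^ CARD('p) = cst i ^ CARD('p) * Uct_D i ^ CARD('p)"
    unfolding e_def by (rule power_mulUct_t_commuteuting) (simp add: cst_commute)
  then show ?thesis
    by (simp only: Uct_D_power(2)[OF i_nz] mult_zero_right)
qed

lemma et_power: "(e * Uct_t) ^ CARD('p) = 0"
proof -
  have "(e * Uct_t) ^ CARD('p) = e ^ CARD('p) * Uct_t ^ CARD('p)"
    by (rule power_mulUct_t_commuteuting) (simp add: Uct_t_commute)
  then show ?thesis by (simp only: e_power mult_zero_left)
qed

lemma w_power: "w ^ CARD('p) = 1"
proof -
  have "w ^ CARD('p) = 1 ^ CARD('p) + (- (e * Uct_t)) ^ CARD('p)"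
    unfolding w_def diff_conv_add_uminus
    by (rule freshmans_dream_commuting[OF _ prime_card of_nat_card_Uct]) simp
  then show ?thesis by (simp add: power_minus_odd odd_p et_power)
qed

lemma w'_power: "w' ^ CARD('p) = 1"
proof -
  have "w' ^ CARD('p) = 1 ^ CARD('p) + (e * Uct_t) ^ CARD('p)"
    unfolding w'_def by (rule freshmans_dream_commuting[OF _ prime_card of_nat_card_Uct]) simp
  then show ?thesis by (simp add: et_power)
qed

lemmas W_add = mod_power_add[OF w_power, folded W_def]
lemmas W'_add = mod_power_add[OF w'_power, folded W'_def]

lemma W_0 [simp]: "W 0 = 1" and W'_0 [simp]: "W' 0 = 1"
  by (simp_all add: W_def W'_def)

lemma W_1: "W 1 = w" and W'_1: "W' 1 = w'"
  by (simp_all add: W_def W'_def mod_power_1[OF w_power] mod_power_1[OF w'_power])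

lemma W_inverse [simp]: "W a * W (- a) = 1" "W (- a) * W a = 1"
  by (simp_all flip: W_add)

lemma h_D: "h * Uct_D k = Uct_D k * h + cst (k / i) * Uct_D k"
proof -
  have "Uct_D 0 * Uct_D k = Uct_D k * Uct_D 0 + cst k * (Uct_D k :: 'p Uct)"
    using Uct_D_commutator[of 0 k] by (simp add: algebra_simps)
  then have "cst (1 / i) * (Uct_D 0 * Uct_D k) = cst (1 / i) * (Uct_D k * Uct_D 0 + cst k * (Uct_D k :: 'p Uct))"
    by simp
  then show ?thesis
    by (simp add: h_def distrib_left mult.assoc cst_left_commute[of "Uct_D k"] Uct_cst.hom_mult
        divide_inverse[of k] divide_inverse[of 1] mult.commute[of k])
qed

text \<open>\<open>D_k\<close> is an eigenvector of \<open>ad h\<close> with eigenvalue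
  \<open>k / i\<close>, so it shifts the spectrum of \<open>h\<close> by that amount.\<close>

lemma D_P: "Uct_D k * P a = P (a + k / i) * Uct_D k"
proof -
  have "Uct_D k * h = (h + cst (- (k / i))) * Uct_D k"
    using h_D[of k] by (simp only: Uct_cst.hom_uminus distrib_right) simp
  from idem_commute[OF of_nat_card_Uct this, of a] show ?thesis
    by (simp add: P_def)
qed

lemma e_P: "e * P a = P (a + 1) * e"
  using D_P[of i a] i_nz by (simp add: e_def mult.assoc) (simp add: cst_left_commute)

lemma h_P: "h * P a = cst a * P a"
  unfolding P_def by (rule mult_idem[OF of_nat_card_Uct h_power])

lemma P_h: "P a * h = cst a * P a"
  using idem_commute[OF of_nat_card_Uct, of h h 0 a] h_P by (simp add: P_def)

lemma P_orthogonal: "P a * P b = (if a = b then P b else 0)"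
  unfolding P_def by (rule idem_orthogonal[OF of_nat_card_Uct h_power])

lemma sum_P: "(\<Sum>a\<in>UNIV. P a) = 1"
  unfolding P_def by (rule sum_idem[OF of_nat_card_Uct])

lemma sum_P_shift: "(\<Sum>a\<in>UNIV. P (a + c)) = 1" "(\<Sum>a\<in>UNIV. P (- a)) = 1"
  by (simp_all only: sum_UNIV_shift sum_UNIV_uminus sum_P)

lemma e_w: "e * w = w * e"
  by (simp add: w_def algebra_simps) (simp add: Uct_t_commute mult.assoc)

lemma e_W: "e * W a = W a * e"
  unfolding W_def by (rule mod_power_commute[OF e_w])

lemma t_power_comm: "Uct_t ^ n * x = x * Uct_t ^ n"
  by (rule power_commuting_commutes) (rule Uct_t_commute)

definition Y :: "'p mod_ring \<Rightarrow> nat \<Rightarrow> 'p Uct"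
  where "Y k l = cst (N i (k - i) l) * Uct_D (k + of_nat l * i)"

lemma Y_0 [simp]: "Y k 0 = Uct_D k"
  by (simp add: Y_def)

text \<open>The rule for divided powers: \<open>ad e\<close> sends
  \<open>(ad e) ^ l D_k / l!\<close> to \<open>l + 1\<close> times the next one. The factor
  \<open>k + l i - i\<close> in the commutator of \<open>D_i\<close> with \<open>D_n\<close>,
  \<open>n = k + l i\<close>, is the factor by which \<open>N_Suc\<close> extends
  \<open>N\<close>.\<close>

lemma e_Y: "e * Y k l = Y k l * e + cst (of_nat (Suc l) :: 'p mod_ring) * Y k (Suc l)"
proof -
  let ?n = "k + of_nat l * i"
  have "Uct_D i * Uct_D ?n = Uct_D ?n * Uct_D i + cst (?n - i) * (Uct_D (i + ?n) :: 'p Uct)"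
    using Uct_D_commutator[of i ?n] by (simp add: algebra_simps)
  then have "cst (i * N i (k - i) l) * (Uct_D i * Uct_D ?n)
      = cst (i * N i (k - i) l) * (Uct_D ?n * Uct_D i) + cst (i * N i (k - i) l) * (cst (?n - i) * (Uct_D (i + ?n) :: 'p Uct))"
    by (simp only: distrib_left)
  moreover have "cst (i * N i (k - i) l) * (cst (?n - i) * (Uct_D (i + ?n) :: 'p Uct)) = cst (of_nat (Suc l) :: 'p mod_ring) * Y k (Suc l)"
  proof -
    have "i * N i (k - i) l * (?n - i) = of_nat (Suc l) * N i (k - i) (Suc l)"
      unfolding N_Suc by (simp add: algebra_simps)
    moreover have "i + ?n = k + of_nat (Suc l) * i"
      by (simp add: algebra_simps)
    ultimately show ?thesis
      unfolding Y_def by (simp only: mult.assoc[symmetric] Uct_cst.hom_mult[symmetric])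
  qed
  moreover have "e * Y k l = cst (i * N i (k - i) l) * (Uct_D i * Uct_D ?n)"
    by (simp add: e_def Y_def mult.assoc Uct_cst.hom_mult cst_left_commute[of "Uct_D i"])
  moreover have "Y k l * e = cst (i * N i (k - i) l) * (Uct_D ?n * Uct_D i)"
    by (simp add: e_def Y_def mult.assoc Uct_cst.hom_mult cst_left_commute[of "Uct_D ?n"])
      (simp only: mult.assoc[symmetric] cst_commute[of i "cst _"])
  ultimately show ?thesis by simp
qed

lemma Y_w: "Y k l * w = w * Y k l + cst (of_nat (Suc l) :: 'p mod_ring) * Y k (Suc l) * Uct_t"
proof -
  have "Y k l * w = Y k l - Y k l * e * Uct_t"
    by (simp add: w_def right_diff_distrib mult.assoc)
  also have "Y k l * e = e * Y k l - cst (of_nat (Suc l) :: 'p mod_ring) * Y k (Suc l)"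
    by (simp add: e_Y del: of_nat_Suc)
  also have "Y k l - (e * Y k l - cst (of_nat (Suc l) :: 'p mod_ring) * Y k (Suc l)) * Uct_t
      = (Y k l - e * Y k l * Uct_t) + cst (of_nat (Suc l) :: 'p mod_ring) * Y k (Suc l) * Uct_t"
    by (simp add: left_diff_distrib)
  also have "Y k l - e * Y k l * Uct_t = w * Y k l"
    by (simp add: w_def left_diff_distrib mult.assoc Uct_t_commute)
  finally show ?thesis .
qed

text \<open>The binomial series of \<open>(1 - e t) ^ a\<close> moved past \<open>D\<^sub>k\<close>; the top term of the induction step
  carries the factor \<open>p = 0\<close>, so that no condition on the size of \<open>a\<close> is needed.\<close>

lemma D_W: "Uct_D k * W a = (\<Sum>l<CARD('p). cst (falling a l) * (W (a - of_nat l) * Y k l * Uct_t ^ l))"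
proof (induction a rule: mod_ring_nat_induct)
  case 0
  obtain m where m: "CARD('p) = Suc m"
    by (metis Suc_pred zero_less_card_finite)
  show ?case
    unfolding m sum.lessThan_Suc_shift by (simp add: falling_zero)
next
  case (Suc a)
  obtain m where m: "CARD('p) = Suc m"
    by (metis Suc_pred zero_less_card_finite)
  define G where "G l = W (a + 1 - of_nat l) * Y k l * Uct_t ^ l" for l
  have W_shift: "W (a + 1 - of_nat l) = W (a - of_nat l) * w" for l
    using W_add[of "a - of_nat l" 1] by (simp add: W_1 algebra_simps)
  have step: "W (a - of_nat l) * Y k l * Uct_t ^ l * w = G l + cst (of_nat (Suc l) :: 'p mod_ring) * G (Suc l)" for l
  proof -
    have "W (a - of_nat l) * Y k l * Uct_t ^ l * w = W (a - of_nat l) * (Y k l * w) * Uct_t ^ l"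
      by (simp add: mult.assoc t_power_comm)
    also have "\<dots> = W (a - of_nat l) * w * Y k l * Uct_t ^ l
        + W (a - of_nat l) * (cst (of_nat (Suc l) :: 'p mod_ring) * (Y k (Suc l) * Uct_t)) * Uct_t ^ l"
      by (simp only: Y_w distrib_left distrib_right mult.assoc)
    also have "W (a - of_nat l) * (cst (of_nat (Suc l) :: 'p mod_ring) * (Y k (Suc l) * Uct_t)) * Uct_t ^ l
        = cst (of_nat (Suc l) :: 'p mod_ring) * G (Suc l)"
      by (simp only: cst_left_commute[of "W _"]) (simp add: G_def mult.assoc)
    finally show ?thesis by (simp only: G_def W_shift)
  qed
  have "Uct_D k * W (a + 1) = Uct_D k * W a * w"
    by (simp add: W_add W_1 mult.assoc)
  also have "\<dots> = (\<Sum>l<CARD('p). cst (falling a l) * (G l + cst (of_nat (Suc l) :: 'p mod_ring) * G (Suc l)))"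
    unfolding Suc sum_distrib_right by (intro sum.cong refl) (simp only: step[symmetric] mult.assoc)
  also have "\<dots> = (\<Sum>l<Suc m. cst (falling a l) * G l)
      + (\<Sum>l<Suc m. cst (of_nat (Suc l) * falling a l) * G (Suc l))"
    unfolding m sum.distrib[symmetric]
    by (intro sum.cong refl) (simp only: distrib_left mult.assoc[symmetric] Uct_cst.hom_mult[symmetric]
        mult.commute[of "falling a _"])
  also have "(\<Sum>l<Suc m. cst (of_nat (Suc l) * falling a l) * G (Suc l))
      = (\<Sum>l<m. cst (of_nat (Suc l) * falling a l) * G (Suc l))"
  proof -
    have "of_nat (Suc m) = (0 :: 'p mod_ring)"
      by (metis m of_nat_card_eq_0)
    then show ?thesis
      by (simp only: sum.lessThan_Suc mult_zero_left Uct_cst.hom_zero add_0_right)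
  qed
  also have "(\<Sum>l<Suc m. cst (falling a l) * G l)
      = G 0 + (\<Sum>l<m. cst (falling a (Suc l)) * G (Suc l))"
    unfolding sum.lessThan_Suc_shift by simp
  also have "G 0 + (\<Sum>l<m. cst (falling a (Suc l)) * G (Suc l))
      + (\<Sum>l<m. cst (of_nat (Suc l) * falling a l) * G (Suc l))
      = (\<Sum>l<Suc m. cst (falling (a + 1) l) * G l)"
    unfolding sum.lessThan_Suc_shift falling_pascal
    by (simp add: Uct_cst.hom_add distrib_right sum.distrib add.assoc del: of_nat_Suc)
  finally show ?case
    by (simp only: G_def m)
qed

section \<open>The twisted coproduct and its values on the generators\<close>

definition F :: "'p Uct2" where "F = (\<Sum>a\<in>UNIV. tens (P a) (W a))"
definition F_inv :: "'p Uct2" where "F_inv = (\<Sum>a\<in>UNIV. tens (P a) (W (- a)))"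

definition comult :: "'p Uct \<Rightarrow> 'p Uct2"
  where "comult x = F * std_comult x * F_inv"

lemma F_inverse: "F * F_inv = 1" "F_inv * F = 1"
proof -
  have "F * F_inv = (\<Sum>a\<in>UNIV. \<Sum>b\<in>UNIV. if a = b then tens (P b) (W a * W (- b)) else 0)"
    unfolding F_def F_inv_def sum_product
    by (intro sum.cong refl) (simp add: tens_mult P_orthogonal tens_left.zero)
  then show "F * F_inv = 1"
    by (simp add: sum.delta) (simp only: tens_left.sum[symmetric] sum_P tens_one)
  have "F_inv * F = (\<Sum>a\<in>UNIV. \<Sum>b\<in>UNIV. if a = b then tens (P b) (W (- a) * W b) else 0)"
    unfolding F_def F_inv_def sum_product
    by (intro sum.cong refl) (simp add: tens_mult P_orthogonal tens_left.zero)
  then show "F_inv * F = 1"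
    by (simp add: sum.delta) (simp only: tens_left.sum[symmetric] sum_P tens_one)
qed

lemma ring_hom_comult: "Ring_Hom.ring_hom comult"
proof unfold_locales
  show "comult (x * y) = comult x * comult y" for x y
  proof -
    have "comult x * comult y = F * std_comult x * (F_inv * F) * std_comult y * F_inv"
      by (simp only: comult_def mult.assoc)
    then show ?thesis
      by (simp add: comult_def F_inverse std_comult.hom_mult mult.assoc)
  qed
qed (simp_all add: comult_def std_comult.hom_add distrib_left distrib_right F_inverse)

lemma comult_of_poly: "comult (Uct_of_poly c) = Uct2_of_poly c"
proof -
  have "comult (Uct_of_poly c) = Uct2_of_poly c * (F * F_inv)"
    unfolding comult_def std_comult_of_poly
    by (simp only: Uct2_of_poly.central[of c F, symmetric] mult.assoc)
  then show ?thesis by (simp add: F_inverse)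
qed

sublocale comult: uct_comult comult
  by (intro uct_comult.intro uct_comult_axioms.intro ring_hom_comult comult_of_poly)

text \<open>Moving \<open>D_k\<close> to the left of \<open>P a\<close> replaces \<open>a\<close> by
  \<open>a + k / i\<close>; reindexing the sum restores \<open>F\<close> and splits off the factor
  \<open>W (k / i)\<close>.\<close>

lemma F_D_left: "F * tens (Uct_D k) 1 * F_inv = tens (Uct_D k) (W (k / i))"
proof -
  have "F * tens (Uct_D k) 1 = (\<Sum>a\<in>UNIV. tens (P a * Uct_D k) (W a))"
    by (simp add: F_def sum_distrib_right tens_mult)
  also have "\<dots> = (\<Sum>a\<in>UNIV. tens (P (a + k / i) * Uct_D k) (W (a + k / i)))"
    by (rule sum_UNIV_shift[symmetric])
  also have "\<dots> = tens (Uct_D k) (W (k / i)) * F"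
    by (simp add: F_def sum_distrib_left tens_mult D_P add.commute[of _ "k / i"] flip: W_add)
  finally show ?thesis
    by (simp add: mult.assoc F_inverse)
qed

lemma F_D_right: "F * tens 1 (Uct_D k) * F_inv = (\<Sum>a\<in>UNIV. tens (P a) (W a * Uct_D k * W (- a)))"
proof -
  have "F * tens 1 (Uct_D k) * F_inv
      = (\<Sum>a\<in>UNIV. \<Sum>b\<in>UNIV. if a = b then tens (P b) (W a * Uct_D k * W (- b)) else 0)"
    unfolding F_def F_inv_def sum_distrib_right tens_mult mult_1_right sum_distrib_left
    by (subst sum.swap) (intro sum.cong refl, simp add: P_orthogonal tens_left.zero)
  then show ?thesis by simp
qed

lemma rising_h_P: "rising h l * P a = cst (\<Prod>j<l. a + of_nat j) * P a"
proof (induction l)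
  case (Suc l)
  have "rising h (Suc l) * P a = rising h l * (cst (a + of_nat l) * P a)"
    by (simp add: mult.assoc distrib_right h_P Uct_cst.hom_add Uct_cst.hom_of_nat)
  then show ?case
    by (simp add: cst_left_commute[of "rising h l"] Suc Uct_cst.hom_mult)
      (simp only: mult.assoc[symmetric] Uct_cst.hom_mult[symmetric] mult.commute)
qed simp

text \<open>The spectral form of a polynomial in \<open>h\<close>. By \<open>falling_uminus\<close>
  its eigenvalue on \<open>P a\<close> is, up to sign, the coefficient that comes from expanding
  \<open>w ^ (- a)\<close>, whence the rising factorials in the coproduct.\<close>

lemma rising_h: "rising h l = (\<Sum>a\<in>UNIV. cst (\<Prod>j<l. a + of_nat j) * P a)"
proof -
  have "rising h l = (\<Sum>a\<in>UNIV. rising h l * P a)"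
    by (simp add: sum_P flip: sum_distrib_left)
  then show ?thesis by (simp add: rising_h_P)
qed

lemma falling_uminus: "falling (- a) l = (- 1) ^ l * (\<Prod>j<l. a + of_nat j)"
  by (induction l) (simp_all add: falling_Suc algebra_simps)

lemma tens_cst: "tens (cst c * a) b = Uct2_of_poly [:c:] * tens a b"
  "tens a (cst c * b) = Uct2_of_poly [:c:] * tens a b"
  using tens_scale(1)[of "[:c:]" a b] tens_scale(2)[of a "[:c:]" b] by simp_all

text \<open>By \<open>D_W\<close>, moving \<open>W (- a)\<close> to the left past \<open>D_k\<close>
  produces \<open>W (- a - l)\<close>, and with the \<open>W a\<close> in front the exponent becomes
  \<open>- l\<close>, free of \<open>a\<close>. Only the scalar \<open>falling (- a) l\<close> still
  depends on \<open>a\<close>, and its sum against the \<open>P a\<close> is a multiple of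
  \<open>rising h l\<close>.\<close>

lemma comult_D:
  "comult (Uct_D k) = tens (Uct_D k) (W (k / i))
    + (\<Sum>l<CARD('p). Uct2_of_poly [:(- 1) ^ l * N i (k - i) l:]
        * tens (rising h l) (W (- of_nat l) * Uct_D (k + of_nat l * i) * Uct_t ^ l))"
proof -
  let ?D = "\<lambda>l. Uct_D (k + of_nat l * i)"
  have W_D_W: "W a * Uct_D k * W (- a) = (\<Sum>l<CARD('p). cst (falling (- a) l) * (W (- of_nat l) * Y k l * Uct_t ^ l))" for a
  proof -
    have "W a * (W (- a - of_nat l) * x) = W (- of_nat l) * x" for l x
      using W_add[of a "- a - of_nat l"] by (simp flip: mult.assoc)
    then show ?thesis
      by (simp add: mult.assoc D_W sum_distrib_left cst_left_commute[of "W a"])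
  qed
  have "(\<Sum>a\<in>UNIV. tens (P a) (W a * Uct_D k * W (- a)))
      = (\<Sum>a\<in>UNIV. \<Sum>l<CARD('p). tens (P a) (cst (falling (- a) l) * (W (- of_nat l) * Y k l * Uct_t ^ l)))"
    by (simp only: W_D_W tens_right.sum)
  also have "\<dots> = (\<Sum>l<CARD('p). \<Sum>a\<in>UNIV. tens (P a) (cst (falling (- a) l) * (W (- of_nat l) * Y k l * Uct_t ^ l)))"
    by (rule sum.swap)
  also have "\<dots> = (\<Sum>l<CARD('p). Uct2_of_poly [:(- 1) ^ l * N i (k - i) l:]
        * tens (rising h l) (W (- of_nat l) * ?D l * Uct_t ^ l))"
  proof (rule sum.cong[OF refl])
    fix l
    have "W (- of_nat l) * Y k l * Uct_t ^ l = cst (N i (k - i) l) * (W (- of_nat l) * ?D l * Uct_t ^ l)"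
      by (simp add: Y_def mult.assoc cst_left_commute[of "W _"])
    moreover have "falling (- a) l * N i (k - i) l = ((- 1) ^ l * N i (k - i) l) * (\<Prod>j<l. a + of_nat j)" for a :: "'p mod_ring"
      by (simp add: falling_uminus)
    ultimately have *: "cst (falling (- a) l) * (W (- of_nat l) * Y k l * Uct_t ^ l)
        = cst ((- 1) ^ l * N i (k - i) l) * (cst (\<Prod>j<l. a + of_nat j) * (W (- of_nat l) * ?D l * Uct_t ^ l))" for a :: "'p mod_ring"
      by (simp only: mult.assoc[symmetric] Uct_cst.hom_mult[symmetric])
    have "(\<Sum>a\<in>UNIV. tens (P a) (cst (falling (- a) l) * (W (- of_nat l) * Y k l * Uct_t ^ l)))
        = (\<Sum>a\<in>UNIV. Uct2_of_poly [:(- 1) ^ l * N i (k - i) l:]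
            * tens (cst (\<Prod>j<l. a + of_nat j) * P a) (W (- of_nat l) * ?D l * Uct_t ^ l))"
      by (simp only: * tens_cst)
    then show "(\<Sum>a\<in>UNIV. tens (P a) (cst (falling (- a) l) * (W (- of_nat l) * Y k l * Uct_t ^ l)))
        = Uct2_of_poly [:(- 1) ^ l * N i (k - i) l:] * tens (rising h l) (W (- of_nat l) * ?D l * Uct_t ^ l)"
      by (simp only: rising_h tens_left.sum sum_distrib_left)
  qed
  finally show ?thesis
    by (simp only: comult_def std_comult_simps distrib_left distrib_right F_D_left F_D_right)
qed

text \<open>Reflects that \<open>ad e\<close> kills \<open>D_i\<close>. The first step of the
  recursion has the factor 0, and below \<open>p\<close> the factor on the left of
  \<open>N_Suc\<close> can be cancelled.\<close>

lemma N_i_0: "N i 0 (Suc l) = 0" if "Suc l < CARD('p)"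
  using that
proof (induction l)
  case 0
  show ?case using N_Suc[of 0 i 0] by simp
next
  case (Suc l)
  have "of_nat (Suc (Suc l)) * N i 0 (Suc (Suc l)) = 0"
    unfolding N_Suc using Suc by simp
  moreover have "of_nat (Suc (Suc l)) \<noteq> (0 :: 'p mod_ring)"
    using of_nat_0_mod_ring_dvd[of "Suc (Suc l)", where 'a='p] Suc.prems nat_dvd_not_less by blast
  ultimately show ?case by (metis mult_eq_0_iff)
qed

text \<open>For \<open>k = i\<close> only \<open>l = 0\<close> survives in \<open>comult_D\<close>,
  so \<open>e\<close> becomes \<open>e \<otimes> w + 1 \<otimes> e\<close>. Then
  \<open>1 \<otimes> 1 - e t \<otimes> w - 1 \<otimes> e t\<close> factors as
  \<open>w \<otimes> w\<close>.\<close>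

lemma comult_w: "comult w = tens w w"
proof -
  obtain m where m: "CARD('p) = Suc m"
    by (metis Suc_pred zero_less_card_finite)
  have "comult (Uct_D i) = tens (Uct_D i) w + tens 1 (Uct_D i)"
    unfolding comult_D m sum.lessThan_Suc_shift
    using N_i_0 i_nz by (simp add: W_1 m flip: one_pCons)
  then have e: "comult e = tens e w + tens 1 e"
    by (simp add: e_def comult.hom_mult comult.hom_cst distrib_left)
      (simp add: tens_cst Uct2_of_poly_const)
  have "comult w = 1 - comult e * Uct2_of_poly [:0, 1:]"
    using comult_of_poly[of "[:0, 1:]"] by (simp add: w_def comult.hom_minus comult.hom_mult)
  also have "\<dots> = tens 1 1 - tens (e * Uct_t) w - tens 1 (e * Uct_t)"
  proof -
    \<comment> \<open>The indeterminate can be placed in either tensor factor: on the left for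
      \<open>e \<otimes> w\<close>, on the right for \<open>1 \<otimes> e\<close>.\<close>
    have "tens a b * Uct2_of_poly [:0, 1:] = tens (a * Uct_t) b"
      "tens a b * Uct2_of_poly [:0, 1:] = tens a (b * Uct_t)" for a b :: "'p Uct"
      using tens_scale(1)[of "[:0, 1:]" a b] tens_scale(2)[of a "[:0, 1:]" b]
      by (simp_all add: Uct_t_commute Uct2_of_poly.central)
    from this(1)[of e w] this(2)[of 1 e] show ?thesis
      by (simp add: e distrib_right diff_diff_eq)
  qed
  also have "\<dots> = tens w w"
    by (simp add: w_def tens_left.diff tens_right.diff)
  finally show ?thesis .
qed

lemma comult_W: "comult (W a) = tens (W a) (W a)"
proof -
  have "comult (W a) = mod_power (tens w w) a"
    unfolding W_def by (subst mod_power_hom[where f=comult]) (simp_all add: comult.hom_mult comult_w)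
  moreover have "tens w w ^ n = tens (w ^ n) (w ^ n)" for n
    by (induction n) (simp_all add: tens_mult)
  ultimately show ?thesis by (simp add: mod_power_def W_def)
qed

lemma F_std_comult_W: "F * std_comult (W a) = tens (W a) (W a) * F"
proof -
  have "F * std_comult (W a) = comult (W a) * F"
    by (simp add: comult_def mult.assoc F_inverse)
  then show ?thesis by (simp only: comult_W)
qed

end

section \<open>The cocycle identity and coassociativity\<close>

context witt_twist
begin

lemma std_comult_h: "std_comult h = tens h 1 + tens 1 h"
  by (simp add: h_def std_comult.hom_mult std_comult.hom_cst distrib_left tens_cst Uct2_of_poly_const)

text \<open>A ring homomorphism maps spectral idempotents to spectral idempotents, and
  \<open>h\<close> goes to a sum of two commuting elements, so \<open>idem_add\<close>
  applies.\<close>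

lemma std_comult_P: "std_comult (P a) = (\<Sum>b\<in>UNIV. tens (P b) (P (a - b)))"
proof -
  interpret L: Ring_Hom.ring_hom "\<lambda>a :: 'p Uct. tens a 1" by (rule ring_hom_tens)
  interpret R: Ring_Hom.ring_hom "tens (1 :: 'p Uct)" by (rule ring_hom_tens)
  have "std_comult (P a) = idem (tens h 1 + tens 1 h) a"
    by (simp add: P_def std_comult.hom_idem std_comult_h)
  also have "\<dots> = (\<Sum>b\<in>UNIV. idem (tens h 1) b * idem (tens 1 h) (a - b))"
    by (rule idem_add[OF of_nat_card_Uct2])
      (simp_all add: tens_mult h_power flip: L.hom_power R.hom_power)
  also have "\<dots> = (\<Sum>b\<in>UNIV. tens (P b) (P (a - b)))"
    by (simp add: P_def tens_mult flip: L.hom_idem R.hom_idem)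
  finally show ?thesis .
qed

text \<open>One side of the cocycle identity in a normal form shared with
  \<open>twist_right\<close>. Orthogonality in the first tensor factor identifies two of the three
  summation indices, and a shift of \<open>a\<close> by the remaining one does the rest.\<close>

lemma twist_left: "emb12 F * comult_left std_comult F
    = (\<Sum>b\<in>UNIV. \<Sum>a\<in>UNIV. tens3 (P b) (W b * P a) (W (a + b)))"
proof -
  have "emb12 F * comult_left std_comult F
      = (\<Sum>c\<in>UNIV. \<Sum>a\<in>UNIV. \<Sum>b\<in>UNIV. tens3 (P c * P b) (W c * P (a - b)) (W a))"
  proof -
    have "comult_left std_comult F = (\<Sum>a\<in>UNIV. \<Sum>b\<in>UNIV. tens3 (P b) (P (a - b)) (W a))"
      by (simp add: F_def std_comult.comult_left.hom_sum std_comult_P emb12.hom_sum sum_distrib_right tens3_mult)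
    moreover have "emb12 F = (\<Sum>c\<in>UNIV. tens3 (P c) (W c) 1)"
      by (simp add: F_def emb12.hom_sum)
    ultimately show ?thesis
      by (simp only: sum_distrib_right) (simp only: sum_distrib_left tens3_mult mult_1_left)
  qed
  also have "\<dots> = (\<Sum>c\<in>UNIV. \<Sum>a\<in>UNIV. tens3 (P c) (W c * P (a - c)) (W a))"
  proof (intro sum.cong refl)
    fix a c
    have "(\<Sum>b\<in>UNIV. tens3 (P c * P b) (W c * P (a - b)) (W a))
        = (\<Sum>b\<in>UNIV. if c = b then tens3 (P b) (W c * P (a - b)) (W a) else 0)"
      by (intro sum.cong refl) (simp add: P_orthogonal tens3_1.zero)
    then show "(\<Sum>b\<in>UNIV. tens3 (P c * P b) (W c * P (a - b)) (W a)) = tens3 (P c) (W c * P (a - c)) (W a)"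
      by simp
  qed
  also have "\<dots> = (\<Sum>c\<in>UNIV. \<Sum>a\<in>UNIV. tens3 (P c) (W c * P (a + c - c)) (W (a + c)))"
    by (rule sum.cong[OF refl], rule sum_UNIV_shift[symmetric])
  finally show ?thesis by simp
qed

text \<open>Here \<open>F\<close> meets the standard coproduct of \<open>W b\<close> in the last two
  factors. Since \<open>W b\<close> is group-like for the twisted coproduct,
  \<open>F_std_comult_W\<close> moves \<open>F\<close> to the right.\<close>

lemma twist_right: "emb23 F * comult_right std_comult F
    = (\<Sum>b\<in>UNIV. \<Sum>a\<in>UNIV. tens3 (P b) (W b * P a) (W (a + b)))"
proof -
  have "emb23 F * comult_right std_comult F
      = (\<Sum>b\<in>UNIV. tens3 (P b) 1 1 * emb23 (F * std_comult (W b)))"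
    by (simp add: F_def[of ] std_comult.comult_right.hom_sum sum_distrib_left emb23.hom_mult)
      (simp only: mult.assoc[symmetric] emb23_commute)
  also have "\<dots> = (\<Sum>b\<in>UNIV. \<Sum>a\<in>UNIV. tens3 (P b) (W b * P a) (W b * W a))"
    unfolding F_std_comult_W
    by (simp add: F_def sum_distrib_left tens_mult emb23.hom_sum tens3_mult)
  finally show ?thesis by (simp add: W_add add.commute)
qed

lemma comult_left_comult: "comult_left comult X = emb12 F * comult_left std_comult X * emb12 F_inv"
proof (induction X rule: Uct2_induct)
  case (tens a b)
  show ?case
    by (simp only: comult.comult_left_tens std_comult.comult_left_tens)
      (simp add: comult_def emb12.hom_mult mult.assoc emb12_commute[of F_inv])
qed (simp_all add: comult.comult_left.hom_add std_comult.comult_left.hom_add distrib_left distrib_right)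

lemma comult_right_comult: "comult_right comult X = emb23 F * comult_right std_comult X * emb23 F_inv"
proof (induction X rule: Uct2_induct)
  case (tens a b)
  show ?case
    by (simp only: comult.comult_right_tens std_comult.comult_right_tens)
      (simp add: comult_def emb23.hom_mult emb23_commute[of F] flip: mult.assoc)
qed (simp_all add: comult.comult_right.hom_add std_comult.comult_right.hom_add distrib_left distrib_right)

lemma coassoc: "comult_left comult (comult a) = comult_right comult (comult a)"
proof -
  define GL GR where "GL = emb12 F * comult_left std_comult F" and "GR = emb23 F * comult_right std_comult F"
  define HL HR where "HL = comult_left std_comult F_inv * emb12 F_inv"
    and "HR = comult_right std_comult F_inv * emb23 F_inv"
  have "GL * HL = emb12 F * comult_left std_comult (F * F_inv) * emb12 F_inv"
    by (simp only: GL_def HL_def std_comult.comult_left.hom_mult mult.assoc)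
  also have "\<dots> = 1"
    unfolding F_inverse by (simp add: F_inverse flip: emb12.hom_mult)
  finally have GHL: "GL * HL = 1" .
  have "HR * GR = comult_right std_comult F_inv * emb23 (F_inv * F) * comult_right std_comult F"
    by (simp only: GR_def HR_def emb23.hom_mult mult.assoc)
  also have "\<dots> = 1"
    unfolding F_inverse by (simp add: F_inverse flip: std_comult.comult_right.hom_mult)
  finally have HGR: "HR * GR = 1" .
  have G: "GL = GR"
    by (simp add: GL_def GR_def twist_left twist_right)
  \<comment> \<open>The cocycle identity for the inverse twist comes from uniqueness of inverses:
    \<open>HR\<close> is a left inverse of \<open>GR\<close>, \<open>HL\<close> a right inverse of
    \<open>GL\<close>, and \<open>GL = GR\<close>.\<close>
  have "HR = HR * (GL * HL)"
    by (simp add: GHL)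
  also have "\<dots> = HL"
    by (simp add: G HGR flip: mult.assoc)
  finally have H: "HR = HL" .
  have "comult_left comult (comult a) = GL * comult_left std_comult (std_comult a) * HL"
    by (simp only: comult_left_comult comult_def std_comult.comult_left.hom_mult GL_def HL_def mult.assoc)
  also have "\<dots> = GR * comult_right std_comult (std_comult a) * HR"
    by (simp only: G H std_coassoc)
  also have "\<dots> = comult_right comult (comult a)"
    by (simp only: comult_right_comult comult_def std_comult.comult_right.hom_mult GR_def HR_def mult.assoc)
  finally show ?thesis .
qed

lemma counit_P: "std_counit (P a) = (if a = 0 then 1 else 0)"
proof -
  have "std_counit h = 0"
    by (simp add: h_def std_counit.hom_mult)
  then show ?thesis
    using idem_zero[of a, where 'b="'p mod_ring poly"] by (simp add: P_def std_counit.hom_idem of_nat_poly)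
qed

lemma counit_W: "std_counit (W a) = 1"
proof -
  have "std_counit w = 1"
    by (simp add: w_def e_def std_counit.hom_mult std_counit.hom_minus)
  then show ?thesis
    unfolding W_def by (subst mod_power_hom[where f=std_counit]) (simp_all add: std_counit.hom_mult)
qed

text \<open>The counit in the left factor keeps only \<open>P 0\<close>, beside which stands
  \<open>W 0 = 1\<close>; in the right factor it sends every \<open>W a\<close> to 1 and the
  \<open>P a\<close> add up to 1.\<close>

lemma counit_F: "counit_left std_counit F = 1" "counit_right std_counit F = 1"
  "counit_left std_counit F_inv = 1" "counit_right std_counit F_inv = 1"
proof -
  have *: "Uct_of_poly (if a = 0 then 1 else 0) * x = (if a = 0 then x else 0)"
    for a :: "'p mod_ring" and x :: "'p Uct"
    by simp
  show "counit_left std_counit F = 1" "counit_left std_counit F_inv = 1"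
    by (simp_all add: F_def F_inv_def std_counit.counit_left.hom_sum counit_P * )
  show "counit_right std_counit F = 1" "counit_right std_counit F_inv = 1"
    by (simp_all add: F_def F_inv_def std_counit.counit_right.hom_sum counit_W sum_P)
qed

section \<open>The twisted antipode\<close>

definition u :: "'p Uct" where "u = (\<Sum>a\<in>UNIV. P a * W' a)"
definition v :: "'p Uct" where "v = (\<Sum>a\<in>UNIV. P a * W a)"

text \<open>As \<open>P a\<close> and \<open>w\<close> do not commute in general, the inverse of
  \<open>v\<close> is not obtained by negating exponents: \<open>u\<close> has powers of
  \<open>w'\<close>, the images of those of \<open>w\<close> under the standard antipode.\<close>

definition antipode :: "'p Uct \<Rightarrow> 'p Uct"
  where "antipode a = u * std_antipode a * v"

lemma e_v: "e * v = v * W (- 1) * e"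
proof -
  have "e * v = (\<Sum>a\<in>UNIV. P (a + 1) * (W (a + 1) * W (- 1) * e))"
  proof -
    have "e * (P a * W a) = P (a + 1) * (W a * e)" for a
      by (metis e_P e_W mult.assoc)
    moreover have "W (a + 1) * W (- 1) = W a" for a
      by (simp flip: W_add)
    ultimately show ?thesis
      by (simp add: v_def sum_distrib_left)
  qed
  also have "\<dots> = (\<Sum>a\<in>UNIV. P a * (W a * W (- 1) * e))"
    by (rule sum_UNIV_shift)
  finally show ?thesis
    by (simp add: v_def sum_distrib_right mult.assoc)
qed

text \<open>Conjugation by \<open>v\<close> turns \<open>w'\<close> into the inverse of
  \<open>w\<close>: by \<open>e_v\<close> the sum \<open>v + e v t\<close> equals
  \<open>v W (- 1) (w + e t)\<close>, and \<open>w + e t = 1\<close>.\<close>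

lemma w'_v: "w' * v = v * W (- 1)"
proof -
  have "w' * v = v + e * v * Uct_t"
    by (simp add: w'_def distrib_right mult.assoc Uct_t_commute)
  also have "\<dots> = v * W (- 1) * (W 1 + e * Uct_t)"
    by (simp add: e_v distrib_left mult.assoc)
  also have "W 1 + e * Uct_t = 1"
    by (simp add: W_1 w_def)
  finally show ?thesis by simp
qed

lemma W'_v: "W' a * v = v * W (- a)"
proof (induction a rule: mod_ring_nat_induct)
  case (Suc a)
  have "W' (a + 1) * v = W' a * (w' * v)"
    by (simp add: W'_add W'_1 mult.assoc)
  also have "\<dots> = W' a * v * W (- 1)"
    by (simp only: w'_v mult.assoc)
  also have "\<dots> = v * W (- a + - 1)"
    by (simp only: Suc W_add mult.assoc)
  finally show ?case by simp
qed simp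

text \<open>Once \<open>W' a\<close> has been moved across \<open>v\<close>, orthogonality reduces
  \<open>P a v W (- a)\<close> to \<open>P a W a W (- a) = P a\<close>. The antipode axioms and the
  formula on the generators all end in this relation.\<close>

lemma u_v: "u * v = 1"
proof -
  have "u * v = (\<Sum>a\<in>UNIV. P a * (v * W (- a)))"
    by (simp add: u_def sum_distrib_right mult.assoc W'_v)
  also have "\<dots> = (\<Sum>a\<in>UNIV. \<Sum>b\<in>UNIV. if a = b then P b * W b * W (- a) else 0)"
    unfolding v_def sum_distrib_right sum_distrib_left
    by (intro sum.cong refl) (simp add: P_orthogonal flip: mult.assoc)
  finally show ?thesis by (simp add: mult.assoc sum_P)
qed

lemmas std_antipode_simps = std_antipode[OF odd_p]

interpretation std_antipode: Modules.additive "std_antipode :: 'p Uct \<Rightarrow> _"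
  by (rule additive_std_antipode[OF odd_p])

lemma std_antipode_power: "std_antipode (x ^ n) = (std_antipode x ^ n :: 'p Uct)"
  by (induction n) (simp_all add: std_antipode_simps power_commutes)

lemma std_antipode_P: "std_antipode (P a) = P (- a)"
proof -
  have "std_antipode h = - h"
    by (simp add: h_def std_antipode_simps cst_commute)
  then have "std_antipode (P a) = idem (- h) a"
    by (simp add: P_def idem_def std_antipode_power std_antipode.diff std_antipode_simps)
  then show ?thesis
    by (simp add: P_def idem_uminus[OF of_nat_card_Uct odd_p])
qed

lemma std_antipode_W: "std_antipode (W a) = W' a"
proof -
  have "std_antipode e = - e"
    by (simp add: e_def std_antipode_simps cst_commute)
  then have "std_antipode w = w'"
    by (simp add: w_def w'_def std_antipode_simps std_antipode.diff Uct_t_commute)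
  then show ?thesis
    by (simp add: W_def W'_def mod_power_def std_antipode_power)
qed

text \<open>Next to \<open>P (- a)\<close> the element \<open>v\<close> acts as
  \<open>W (- a)\<close>, which cancels \<open>W a\<close>.\<close>

lemma sum_P_v_W: "(\<Sum>a\<in>UNIV. P (- a) * v * W a) = 1"
proof -
  have "P (- a) * v * W a = P (- a)" for a
  proof -
    have "P (- a) * v = (\<Sum>b\<in>UNIV. if - a = b then P b * W b else 0)"
      unfolding v_def sum_distrib_left
      by (intro sum.cong refl) (simp add: P_orthogonal flip: mult.assoc)
    then show ?thesis by (simp add: mult.assoc)
  qed
  then show ?thesis by (simp add: sum_P_shift)
qed

lemma sum_P_u_W': "(\<Sum>a\<in>UNIV. P a * u * W' (- a)) = 1"
proof -
  have "P a * u * W' (- a) = P a" for a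
  proof -
    have "P a * u = (\<Sum>b\<in>UNIV. if a = b then P b * W' b else 0)"
      unfolding u_def sum_distrib_left
      by (intro sum.cong refl) (simp add: P_orthogonal flip: mult.assoc)
    then show ?thesis by (simp add: mult.assoc flip: W'_add)
  qed
  then show ?thesis by (simp add: sum_P)
qed

sublocale antipode: uct_antipode antipode
  by standard (simp_all add: antipode_def std_antipode_simps std_antipode_of_poly[OF odd_p] distrib_left
      distrib_right mult.assoc Uct_of_poly.central[symmetric] flip: Uct_of_poly.left_commute[of u])

sublocale std_antipode: uct_antipode "std_antipode :: 'p Uct \<Rightarrow> _"
  by (rule uct_antipode_std[OF odd_p])

text \<open>The antipode reverses \<open>P a x P b\<close>, so the idempotent from \<open>F\<close>,
  the element \<open>v\<close> and \<open>W a\<close> come to stand next to each other; their sum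
  over \<open>a\<close> is 1 by \<open>sum_P_v_W\<close>, and only the index of the inverse twist
  remains.\<close>

lemma antipode_left_twist:
  "antipode_left antipode (F * X * F_inv)
    = (\<Sum>b\<in>UNIV. u * P (- b) * antipode_left std_antipode X * W (- b))"
proof (induction X rule: Uct2_induct)
  case (tens x y)
  have "antipode_left antipode (F * tens x y * F_inv)
      = (\<Sum>b\<in>UNIV. \<Sum>a\<in>UNIV. antipode (P a * x * P b) * (W a * y * W (- b)))"
    by (simp add: F_def F_inv_def sum_distrib_right sum_distrib_left tens_mult antipode.antipode_left.sum)
  also have "\<dots> = (\<Sum>b\<in>UNIV. \<Sum>a\<in>UNIV. u * P (- b) * std_antipode x * (P (- a) * v * W a) * (y * W (- b)))"
    by (intro sum.cong refl) (simp add: antipode_def std_antipode_simps std_antipode_P mult.assoc)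
  also have "\<dots> = (\<Sum>b\<in>UNIV. u * P (- b) * std_antipode x * (\<Sum>a\<in>UNIV. P (- a) * v * W a) * (y * W (- b)))"
    by (simp only: sum_distrib_left sum_distrib_right)
  finally show ?case unfolding sum_P_v_W by (simp add: mult.assoc)
qed (simp_all add: antipode.antipode_left.zero antipode.antipode_left.add std_antipode.antipode_left.zero
    std_antipode.antipode_left.add distrib_left distrib_right sum.distrib)

text \<open>Here the antipode is applied to the second factor, so the idempotent from the inverse
  twist meets \<open>u W' (- b)\<close>. The inner sum is 1 by \<open>sum_P_u_W'\<close>, and the
  index of \<open>F\<close> remains.\<close>

lemma antipode_right_twist:
  "antipode_right antipode (F * X * F_inv)
    = (\<Sum>a\<in>UNIV. P a * antipode_right std_antipode X * W' a * v)"
proof (induction X rule: Uct2_induct)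
  case (tens x y)
  have "antipode_right antipode (F * tens x y * F_inv)
      = (\<Sum>a\<in>UNIV. \<Sum>b\<in>UNIV. (P a * x * P b) * antipode (W a * y * W (- b)))"
    by (subst sum.swap) (simp add: F_def F_inv_def sum_distrib_right sum_distrib_left tens_mult antipode.antipode_right.sum)
  also have "\<dots> = (\<Sum>a\<in>UNIV. \<Sum>b\<in>UNIV. P a * x * (P b * u * W' (- b)) * (std_antipode y * W' a * v))"
    by (intro sum.cong refl) (simp add: antipode_def std_antipode_simps std_antipode_W mult.assoc)
  also have "\<dots> = (\<Sum>a\<in>UNIV. P a * x * (\<Sum>b\<in>UNIV. P b * u * W' (- b)) * (std_antipode y * W' a * v))"
    by (simp only: sum_distrib_left sum_distrib_right)
  finally show ?case unfolding sum_P_u_W' by (simp add: mult.assoc)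
qed (simp_all add: antipode.antipode_right.zero antipode.antipode_right.add std_antipode.antipode_right.zero
    std_antipode.antipode_right.add distrib_left distrib_right sum.distrib)

lemma uct_hopf_twist: "uct_hopf comult std_counit antipode"
proof
  fix a
  show "comult_left comult (comult a) = comult_right comult (comult a)"
    by (rule coassoc)
  show "counit_left std_counit (comult a) = a" "counit_right std_counit (comult a) = a"
    by (simp_all add: comult_def std_counit.counit_left.hom_mult std_counit.counit_right.hom_mult counit_F
        std_counit_left std_counit_right)
  have "antipode_left antipode (comult a) = (\<Sum>b\<in>UNIV. u * P (- b) * Uct_of_poly (std_counit a) * W (- b))"
    by (simp only: comult_def antipode_left_twist std_antipode_left[OF odd_p])
  also have "\<dots> = (\<Sum>b\<in>UNIV. Uct_of_poly (std_counit a) * (u * (P (- b) * W (- b))))"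
    by (simp only: Uct_of_poly.central[of _ "u * P _", symmetric]) (simp only: mult.assoc)
  also have "\<dots> = (\<Sum>b\<in>UNIV. Uct_of_poly (std_counit a) * (u * (P b * W b)))"
    by (rule sum_UNIV_uminus)
  also have "\<dots> = Uct_of_poly (std_counit a) * (u * v)"
    by (simp only: v_def sum_distrib_left)
  finally show "antipode_left antipode (comult a) = Uct_of_poly (std_counit a)"
    by (simp add: u_v)
  have "antipode_right antipode (comult a) = (\<Sum>b\<in>UNIV. P b * Uct_of_poly (std_counit a) * W' b * v)"
    by (simp only: comult_def antipode_right_twist std_antipode_right[OF odd_p])
  also have "\<dots> = (\<Sum>b\<in>UNIV. Uct_of_poly (std_counit a) * (P b * W' b * v))"
    by (simp only: Uct_of_poly.central[of _ "P _", symmetric]) (simp only: mult.assoc)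
  also have "\<dots> = Uct_of_poly (std_counit a) * (u * v)"
    by (simp only: u_def sum_distrib_left sum_distrib_right)
  finally show "antipode_right antipode (comult a) = Uct_of_poly (std_counit a)"
    by (simp add: u_v)
qed

section \<open>The explicit antipode on the generators\<close>

lemma W_h: "W a * h = h * W a + cst a * (W (a - 1) - W a)"
proof (induction a rule: mod_ring_nat_induct)
  case (Suc a)
  have "h * e = e * h + e"
    using h_D[of i] i_nz by (simp add: e_def distrib_left mult.assoc) (simp add: cst_left_commute distrib_left)
  then have "h * (e * Uct_t) = e * Uct_t * h + e * Uct_t"
    by (simp add: mult.assoc Uct_t_commute) (simp add: distrib_right flip: mult.assoc)
  \<comment> \<open>The commutator of \<open>h\<close> with \<open>e t\<close> is
    \<open>e t = 1 - w\<close>, so everything can be written in \<open>w\<close> alone.\<close>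
  then have w_h: "w * h = h * w + (1 - w)"
    by (simp add: w_def left_diff_distrib right_diff_distrib)
  have "W (a + 1) * h = W a * (w * h)"
    by (simp add: W_add W_1 mult.assoc)
  also have "\<dots> = W a * h * w + W a * (1 - w)"
    by (simp only: w_h distrib_left mult.assoc)
  also have "\<dots> = h * (W a * w) + cst a * (W (a - 1) * w - W a * w) + (W a - W a * w)"
    by (simp add: Suc distrib_left distrib_right left_diff_distrib right_diff_distrib mult.assoc)
  also have "W (a - 1) * w = W a"
    using W_add[of "a - 1" 1] by (simp add: W_1)
  also have "W a * w = W (a + 1)"
    by (simp add: W_add W_1)
  also have "h * W (a + 1) + cst a * (W a - W (a + 1)) + (W a - W (a + 1))
      = h * W (a + 1) + cst (a + 1) * (W a - W (a + 1))"
    by (simp add: Uct_cst.hom_add distrib_right)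
  finally show ?case by simp
qed simp

text \<open>Multiplying on the right by \<open>h - c\<close> lowers the exponent of \<open>w\<close>
  by one and yields the scalar \<open>a\<close>, the idempotent staying the same. Iterated, this
  produces falling factorials.\<close>

lemma P_W_h: "P (a + c) * W a * (h - cst c) = cst a * (P (a + c) * W (a - 1))"
proof -
  have "P (a + c) * W a * h = P (a + c) * h * W a + P (a + c) * (cst a * (W (a - 1) - W a))"
    by (simp only: W_h distrib_left mult.assoc)
  also have "\<dots> = cst (a + c) * (P (a + c) * W a) + cst a * (P (a + c) * (W (a - 1) - W a))"
    by (simp only: P_h cst_left_commute[of "P _"] mult.assoc)
  also have "\<dots> = cst c * (P (a + c) * W a) + cst a * (P (a + c) * W (a - 1))"
    by (simp add: Uct_cst.hom_add distrib_right right_diff_distrib)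
  finally show ?thesis
    by (simp add: right_diff_distrib cst_commute[of c] mult.assoc)
qed

lemma rising_commute: "x * y = y * x \<Longrightarrow> rising x l * y = y * rising x l"
  for x y :: "'b::ring_1"
proof (induction l)
  case (Suc l)
  have "(x + of_nat l) * y = y * (x + of_nat l)"
    using Suc.prems by (simp add: distrib_left distrib_right mult_of_nat_commute)
  then show ?case
    using Suc by (simp add: mult.assoc) (simp flip: mult.assoc)
qed simp

text \<open>The shift \<open>1 - c - l\<close> makes \<open>h - c\<close> the last of the
  \<open>l\<close> factors. That factor is moved to the front and used up by \<open>P_W_h\<close>;
  the others are handled by induction with \<open>a - 1\<close> and \<open>c + 1\<close>, which
  leaves the index \<open>a + c\<close> of the idempotent unchanged.\<close>

lemma P_W_rising:
  "P (a + c) * W a * rising (h + cst (1 - c - of_nat l)) l = cst (falling a l) * (P (a + c) * W (a - of_nat l))"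
proof (induction l arbitrary: a c)
  case (Suc l)
  have c: "1 - c - of_nat (Suc l) = - c - of_nat l" "1 - (c + 1) - of_nat l = - c - of_nat l"
    by simp_all
  have last: "h + cst (- c - of_nat l) + of_nat l = h - cst c"
    by (simp add: Uct_cst.hom_minus Uct_cst.hom_uminus Uct_cst.hom_of_nat)
  have "rising (h + cst (- c - of_nat l)) (Suc l) = (h - cst c) * rising (h + cst (- c - of_nat l)) l"
    unfolding rising.simps last
    by (rule rising_commute) (simp add: left_diff_distrib right_diff_distrib distrib_left distrib_right
        cst_commute[of _ h] cst_commute[of "- c - of_nat l" "cst c"])
  then have "P (a + c) * W a * rising (h + cst (1 - c - of_nat (Suc l))) (Suc l)
      = P (a + c) * W a * (h - cst c) * rising (h + cst (- c - of_nat l)) l"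
    by (simp only: c mult.assoc)
  also have "\<dots> = cst a * (P ((a - 1) + (c + 1)) * W (a - 1) * rising (h + cst (1 - (c + 1) - of_nat l)) l)"
    by (simp only: P_W_h c) (simp add: mult.assoc)
  also have "\<dots> = cst a * (cst (falling (a - 1) l) * (P ((a - 1) + (c + 1)) * W (a - 1 - of_nat l)))"
    by (simp only: Suc.IH)
  also have "\<dots> = cst (a * falling (a - 1) l) * (P (a + c) * W (a - of_nat (Suc l)))"
    by (simp add: Uct_cst.hom_mult mult.assoc diff_diff_eq add.commute)
  also have "a * falling (a - 1) l = falling a (Suc l)"
    using falling_add_1[of "a - 1" l] by simp
  finally show ?case .
qed simp

text \<open>Moving \<open>D_n\<close>, \<open>n = k + l i\<close>, to the right of
  \<open>h + 1\<close> subtracts \<open>k / i + l\<close>. For \<open>n = l\<close> the result is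
  the rising factorial of \<open>P_W_rising\<close> with \<open>c = k / i\<close>; this is the
  source of the \<open>h + 1\<close> in the antipode formula.\<close>

lemma D_rising: "Uct_D (k + of_nat l * i) * rising (h + 1) n = rising (h + cst (1 - k / i - of_nat l)) n * Uct_D (k + of_nat l * i)"
proof -
  let ?D = "Uct_D (k + of_nat l * i)"
  have "(k + of_nat l * i) / i = k / i + of_nat l"
    using i_nz by (simp add: add_divide_distrib)
  then have step: "?D * (h + 1 + of_nat m) = (h + cst (1 - k / i - of_nat l) + of_nat m) * ?D" for m
    using h_D[of "k + of_nat l * i"]
    by (simp add: Uct_cst.hom_minus Uct_cst.hom_add distrib_left distrib_right left_diff_distrib mult_of_nat_commute)
  show ?thesis
  proof (induction n)
    case (Suc n)
    show ?case
      by (simp only: rising.simps mult.assoc[symmetric] Suc) (simp only: mult.assoc step)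
  qed simp
qed

text \<open>As \<open>u v = 1\<close>, the antipode of \<open>D_k\<close> is known once
  \<open>D_k\<close> has been moved to the right of \<open>v\<close>.\<close>

lemma D_v: "Uct_D k * v = v * (W (- (k / i))
    * (\<Sum>l<CARD('p). cst (N i (k - i) l) * (Uct_D (k + of_nat l * i) * rising (h + 1) l * Uct_t ^ l)))"
proof -
  let ?c = "k / i"
  let ?D = "\<lambda>l. Uct_D (k + of_nat l * i)"
  have "Uct_D k * v = (\<Sum>a\<in>UNIV. P (a + ?c) * (Uct_D k * W a))"
    by (simp add: v_def sum_distrib_left D_P flip: mult.assoc)
  also have "\<dots> = (\<Sum>a\<in>UNIV. P (a + ?c) * W a
      * (\<Sum>l<CARD('p). cst (N i (k - i) l) * (?D l * rising (h + 1) l * Uct_t ^ l)))"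
  proof (rule sum.cong[OF refl])
    fix a
    \<comment> \<open>Read from right to left in \<open>P_W_rising\<close>, the dependence on
      \<open>a\<close> of \<open>falling a l\<close> and \<open>W (a - l)\<close> is reabsorbed into
      \<open>W a\<close>. The sum over \<open>l\<close> then no longer depends on \<open>a\<close>
      and leaves the sum over \<open>a\<close>.\<close>
    have "P (a + ?c) * (cst (falling a l) * (W (a - of_nat l) * Y k l * Uct_t ^ l))
        = P (a + ?c) * W a * (cst (N i (k - i) l) * (?D l * rising (h + 1) l * Uct_t ^ l))" for l
    proof -
      have "P (a + ?c) * W a * (cst (N i (k - i) l) * (?D l * rising (h + 1) l * Uct_t ^ l))
          = cst (N i (k - i) l) * (P (a + ?c) * W a * rising (h + cst (1 - ?c - of_nat l)) l * (?D l * Uct_t ^ l))"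
        by (simp only: D_rising cst_left_commute[of "P (a + ?c)" "N i (k - i) l"]
            cst_left_commute[of "W a" "N i (k - i) l"] mult.assoc)
      also have "\<dots> = cst (N i (k - i) l) * (cst (falling a l) * (P (a + ?c) * W (a - of_nat l)) * (?D l * Uct_t ^ l))"
        by (simp only: P_W_rising)
      also have "\<dots> = cst (falling a l) * (P (a + ?c) * (cst (N i (k - i) l) * (W (a - of_nat l) * (?D l * Uct_t ^ l))))"
        by (simp only: mult.assoc cst_left_commute[of "P (a + ?c)"] cst_left_commute[of "cst (N i (k - i) l)" "falling a l"])
      also have "\<dots> = P (a + ?c) * (cst (falling a l) * (W (a - of_nat l) * Y k l * Uct_t ^ l))"
        by (simp only: Y_def mult.assoc cst_left_commute[of "P (a + ?c)" "falling a l"] cst_left_commute[of "W _"])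
      finally show ?thesis by simp
    qed
    then show "P (a + ?c) * (Uct_D k * W a) = P (a + ?c) * W a
        * (\<Sum>l<CARD('p). cst (N i (k - i) l) * (?D l * rising (h + 1) l * Uct_t ^ l))"
      unfolding D_W sum_distrib_left by (intro sum.cong refl)
  qed
  also have "\<dots> = (\<Sum>a\<in>UNIV. P (a + ?c) * (W (a + ?c) * W (- ?c))
      * (\<Sum>l<CARD('p). cst (N i (k - i) l) * (?D l * rising (h + 1) l * Uct_t ^ l)))"
    by (simp flip: W_add)
  also have "\<dots> = (\<Sum>a\<in>UNIV. P a * (W a * W (- ?c))
      * (\<Sum>l<CARD('p). cst (N i (k - i) l) * (?D l * rising (h + 1) l * Uct_t ^ l)))"
    by (rule sum_UNIV_shift)
  finally show ?thesis
    by (simp only: v_def sum_distrib_right mult.assoc)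
qed

lemma antipode_D: "antipode (Uct_D k) = - (W (- (k / i))
    * (\<Sum>l<CARD('p). cst (N i (k - i) l) * (Uct_D (k + of_nat l * i) * rising (h + 1) l * Uct_t ^ l)))"
proof -
  have "antipode (Uct_D k) = - (u * (Uct_D k * v))"
    by (simp add: antipode_def std_antipode_simps mult.assoc)
  then show ?thesis
    unfolding D_v by (simp add: u_v flip: mult.assoc)
qed

end

section \<open>Hopf algebras embedded in \<open>Uct\<close>\<close>

lemma central_hom_comp:
  assumes "central_hom \<kappa>" "Ring_Hom.ring_hom \<rho>"
  shows "central_hom (\<lambda>c. \<kappa> (\<rho> c))"
proof -
  interpret central_hom \<kappa> by fact
  interpret \<rho>: Ring_Hom.ring_hom \<rho> by fact
  show ?thesis
  proof unfold_locales
    show "\<kappa> (\<rho> c) * x = x * \<kappa> (\<rho> c)" for c x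
      by (rule central)
  qed (simp_all add: hom_add hom_mult \<rho>.hom_add \<rho>.hom_mult)
qed

lemma tensor_extension_scale:
  assumes \<kappa>: "central_hom \<kappa>" and g: "bilinear_map Uct_scale \<kappa> g"
  shows "tensor_extension \<kappa> g (Uct2_of_poly c * X) = \<kappa> c * tensor_extension \<kappa> g X"
proof (induction X rule: Uct2_induct)
  case (tens a b)
  have "g (Uct_of_poly c * a) b = \<kappa> c * g a b"
    using g by (simp add: bilinear_map_def Uct_scale_eq)
  then show ?case
    by (simp add: tensor_extension_tens[OF \<kappa> g] flip: tens_scale(1))
next
  case zero
  show ?case using tensor_extension_add[OF \<kappa> g, of 0 0] by simp
qed (simp_all add: tensor_extension_add[OF \<kappa> g] distrib_left)

definition tensor_map ::
    "('a \<Rightarrow> 'p::prime_card Uct) \<Rightarrow> ('r::comm_ring_1 \<Rightarrow> 'p mod_ring poly) \<Rightarrow> ('a \<times> 'a \<Rightarrow>\<^sub>0 'r) \<Rightarrow> 'p Uct2"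
  where "tensor_map \<iota> \<rho> = algebra_extension (\<lambda>c. Uct2_of_poly (\<rho> c)) (\<lambda>(a, b). tens (\<iota> a) (\<iota> b))"

definition tensor3_map ::
    "('a \<Rightarrow> 'p::prime_card Uct) \<Rightarrow> ('r::comm_ring_1 \<Rightarrow> 'p mod_ring poly) \<Rightarrow> ('a \<times> 'a \<times> 'a \<Rightarrow>\<^sub>0 'r) \<Rightarrow> 'p Uct3"
  where "tensor3_map \<iota> \<rho>
    = algebra_extension (\<lambda>c. Uct3_of_poly (\<rho> c)) (\<lambda>(a, b, c). tens3 (\<iota> a) (\<iota> b) (\<iota> c))"

text \<open>This is applied to the identity of \<open>Uct\<close> and to the embedding of \<open>Uc\<close> as the constants; the
  tensor relations of \<open>Uc\<close> are reflected because the reduction at \<open>t = 0\<close> inverts the embedding.\<close>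

locale hopf_embedding = assoc_algebra scale + uct_hopf \<delta> \<epsilon> S
  for scale :: "'r::comm_ring_1 \<Rightarrow> 'a::ring_1 \<Rightarrow> 'a"
    and \<delta> :: "'p::prime_card Uct \<Rightarrow> 'p Uct2" and \<epsilon> S +
  fixes \<iota> :: "'a \<Rightarrow> 'p Uct" and \<rho> :: "'r \<Rightarrow> 'p mod_ring poly"
    and \<epsilon>' :: "'a \<Rightarrow> 'r" and S' :: "'a \<Rightarrow> 'a"
  assumes \<iota>_hom: "Ring_Hom.ring_hom \<iota>" and \<rho>_hom: "Ring_Hom.ring_hom \<rho>"
    and \<iota>_scale: "\<iota> (scale c a) = Uct_of_poly (\<rho> c) * \<iota> a"
    and \<iota>_inj: "inj \<iota>" and \<rho>_inj: "inj \<rho>"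
    and \<epsilon>': "\<rho> (\<epsilon>' a) = \<epsilon> (\<iota> a)" and S': "\<iota> (S' a) = S (\<iota> a)"
    and comult_range: "\<exists>x. tensor_map \<iota> \<rho> x = \<delta> (\<iota> a)"
    and tensor_reflect: "tensor_map \<iota> \<rho> x = tensor_map \<iota> \<rho> y \<Longrightarrow> (x, y) \<in> tensor_rel scale"
    and tensor3_reflect: "tensor3_map \<iota> \<rho> x' = tensor3_map \<iota> \<rho> y' \<Longrightarrow> (x', y') \<in> tensor3_rel scale"
begin

interpretation \<iota>: Ring_Hom.ring_hom \<iota> by (rule \<iota>_hom)
interpretation \<rho>: Ring_Hom.ring_hom \<rho> by (rule \<rho>_hom)
lemmas \<kappa> = central_hom_comp[OF Uct_of_poly.central_hom_axioms \<rho>_hom]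
lemmas \<kappa>2 = central_hom_comp[OF Uct2_of_poly.central_hom_axioms \<rho>_hom]
lemmas \<kappa>3 = central_hom_comp[OF Uct3_of_poly.central_hom_axioms \<rho>_hom]

lemmas extension_simps =
  central_hom.extension_zero[OF \<kappa>] central_hom.extension_single[OF \<kappa>] central_hom.extension_add[OF \<kappa>]
  central_hom.extension_zero[OF \<kappa>2] central_hom.extension_single[OF \<kappa>2] central_hom.extension_add[OF \<kappa>2]
  central_hom.extension_zero[OF \<kappa>3] central_hom.extension_single[OF \<kappa>3] central_hom.extension_add[OF \<kappa>3]

text \<open>Taking all formal tensors that represent the coproduct turns membership, and with it
  each Hopf axiom, into an equation in \<open>Uct2\<close>; \<open>comult_eq_class\<close>
  identifies the set with a tensor class.\<close>

definition \<Delta>' :: "'a \<Rightarrow> ('a \<times> 'a \<Rightarrow>\<^sub>0 'r) set"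
  where "\<Delta>' a = {x. tensor_map \<iota> \<rho> x = \<delta> (\<iota> a)}"

lemma tensor_map_eq_iff: "tensor_map \<iota> \<rho> x = tensor_map \<iota> \<rho> y \<longleftrightarrow> (x, y) \<in> tensor_rel scale"
proof
  assume "(x, y) \<in> tensor_rel scale"
  then have "x - y \<in> free_scale.span (tensor_relators scale)"
    by (simp add: tensor_rel_def)
  moreover have "bilinear_map scale (\<lambda>c. Uct2_of_poly (\<rho> c)) (\<lambda>a b. tens (\<iota> a) (\<iota> b))"
    by (simp add: bilinear_map_def \<iota>.hom_add tens_add \<iota>_scale tens_scale)
  ultimately have "tensor_map \<iota> \<rho> (x - y) = 0"
    unfolding tensor_map_def by (intro central_hom.extension_span[OF \<kappa>2 central_hom.extension_tensor_relators[OF \<kappa>2]])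
  then show "tensor_map \<iota> \<rho> x = tensor_map \<iota> \<rho> y"
    by (simp add: tensor_map_def central_hom.extension_diff[OF \<kappa>2])
qed (rule tensor_reflect)

lemma comult_eq_class:
  assumes "tensor_map \<iota> \<rho> x = \<delta> (\<iota> a)"
  shows "\<Delta>' a = tensor_class scale x"
  using assms by (auto simp: \<Delta>'_def tensor_class_def simp flip: tensor_map_eq_iff)

lemma extension_tensor_map:
  assumes \<kappa>: "central_hom \<kappa>" and g: "bilinear_map Uct_scale \<kappa> g"
  shows "tensor_extension \<kappa> g (tensor_map \<iota> \<rho> x) = algebra_extension (\<lambda>c. \<kappa> (\<rho> c)) (\<lambda>(a, b). g (\<iota> a) (\<iota> b)) x"
proof -
  note \<kappa>' = central_hom_comp[OF \<kappa> \<rho>_hom]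
  note simps = extension_simps central_hom.extension_zero[OF \<kappa>'] central_hom.extension_single[OF \<kappa>']
    central_hom.extension_add[OF \<kappa>'] tensor_map_def
  show ?thesis
  proof (induction x rule: poly_mapping_sum_induct)
    case zero
    show ?case
      using tensor_extension_add[OF \<kappa> g, of 0 0] by (simp add: simps)
  next
    case (single k c)
    show ?case
      by (cases k) (simp add: simps tensor_extension_scale[OF \<kappa> g] tensor_extension_tens[OF \<kappa> g])
  next
    case (add x y)
    then show ?case
      by (simp add: simps tensor_extension_add[OF \<kappa> g])
  qed
qed

lemma structure_tensor_map:
  "comult_left \<delta> (tensor_map \<iota> \<rho> x)
    = algebra_extension (\<lambda>c. Uct3_of_poly (\<rho> c)) (\<lambda>(a, b). emb12 (\<delta> (\<iota> a)) * tens3 1 1 (\<iota> b)) x"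
  "comult_right \<delta> (tensor_map \<iota> \<rho> x)
    = algebra_extension (\<lambda>c. Uct3_of_poly (\<rho> c)) (\<lambda>(a, b). tens3 (\<iota> a) 1 1 * emb23 (\<delta> (\<iota> b))) x"
  "counit_left \<epsilon> (tensor_map \<iota> \<rho> x)
    = algebra_extension (\<lambda>c. Uct_of_poly (\<rho> c)) (\<lambda>(a, b). Uct_of_poly (\<epsilon> (\<iota> a)) * \<iota> b) x"
  "counit_right \<epsilon> (tensor_map \<iota> \<rho> x)
    = algebra_extension (\<lambda>c. Uct_of_poly (\<rho> c)) (\<lambda>(a, b). Uct_of_poly (\<epsilon> (\<iota> b)) * \<iota> a) x"
  "antipode_left S (tensor_map \<iota> \<rho> x)
    = algebra_extension (\<lambda>c. Uct_of_poly (\<rho> c)) (\<lambda>(a, b). S (\<iota> a) * \<iota> b) x"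
  "antipode_right S (tensor_map \<iota> \<rho> x)
    = algebra_extension (\<lambda>c. Uct_of_poly (\<rho> c)) (\<lambda>(a, b). \<iota> a * S (\<iota> b)) x"
  unfolding comult_left_def comult_right_def counit_left_def counit_right_def antipode_left_def antipode_right_def
  by (rule extension_tensor_map[OF central_hom_Uct3_of_poly comult.bilinear_comult(1)]
      extension_tensor_map[OF central_hom_Uct3_of_poly comult.bilinear_comult(2)]
      extension_tensor_map[OF Uct_of_poly.central_hom_axioms counit.bilinear_counit(1)]
      extension_tensor_map[OF Uct_of_poly.central_hom_axioms counit.bilinear_counit(2)]
      extension_tensor_map[OF Uct_of_poly.central_hom_axioms antipode.bilinear_antipode(1)]
      extension_tensor_map[OF Uct_of_poly.central_hom_axioms antipode.bilinear_antipode(2)])+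

lemma \<iota>_linear_extension:
  "\<iota> (linear_extension scale f x) = algebra_extension (\<lambda>c. Uct_of_poly (\<rho> c)) (\<lambda>k. \<iota> (f k)) x"
  by (induction x rule: poly_mapping_sum_induct)
    (simp_all add: linear_extension_add[OF module_axioms] \<iota>.hom_add extension_simps linear_extension_single \<iota>_scale)

lemma tensor3_map_left:
  "tensor3_map \<iota> \<rho> (linear_extension free_scale (\<lambda>(b1, b2). single (b1, b2, c) 1) z) = emb12 (tensor_map \<iota> \<rho> z) * tens3 1 1 (\<iota> c)"
  by (induction z rule: poly_mapping_sum_induct)
    (auto simp: tensor3_map_def tensor_map_def linear_extension_free_scale_add extension_simps
      emb12.hom_add emb12.hom_mult distrib_right emb_of_poly mult.assoc tens3_mult)

lemma tensor3_map_right: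
  "tensor3_map \<iota> \<rho> (linear_extension free_scale (\<lambda>(c1, c2). single (b, c1, c2) 1) z) = tens3 (\<iota> b) 1 1 * emb23 (tensor_map \<iota> \<rho> z)"
  by (induction z rule: poly_mapping_sum_induct)
    (auto simp: tensor3_map_def tensor_map_def linear_extension_free_scale_add extension_simps
      emb23.hom_add emb23.hom_mult distrib_left emb_of_poly mult.assoc tens3_mult Uct3_of_poly.left_commute[of "tens3 _ _ _"])

lemma hopf_algebra: "hopf_algebra scale \<Delta>' \<epsilon>' S'"
proof
  fix a b :: 'a and c :: 'r and x y :: "'a \<times> 'a \<Rightarrow>\<^sub>0 'r"
  show "\<Delta>' a \<in> UNIV // tensor_rel scale"
  proof -
    obtain x where "tensor_map \<iota> \<rho> x = \<delta> (\<iota> a)"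
      using comult_range by blast
    then show ?thesis
      by (simp add: comult_eq_class tensor_class_def quotientI)
  qed
  show "x + y \<in> \<Delta>' (a + b)" if "x \<in> \<Delta>' a" "y \<in> \<Delta>' b"
    using that by (simp add: \<Delta>'_def tensor_map_def extension_simps \<iota>.hom_add comult.hom_add)
  show "free_scale c x \<in> \<Delta>' (scale c a)" if "x \<in> \<Delta>' a"
    using that by (simp add: \<Delta>'_def tensor_map_def central_hom.extension_scale[OF \<kappa>2] \<iota>_scale comult.hom_mult comult.of_poly)
  show "tensor_mult x y \<in> \<Delta>' (a * b)" if "x \<in> \<Delta>' a" "y \<in> \<Delta>' b"
    using that by (simp add: \<Delta>'_def tensor_mult_eq tensor_map_def \<iota>.hom_mult comult.hom_mult)
      (subst central_hom.extension_mult[OF \<kappa>2], auto simp: \<iota>.hom_mult tens_mult)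
  show "single (1, 1) 1 \<in> \<Delta>' 1"
    by (simp add: \<Delta>'_def tensor_map_def extension_simps)
  have \<rho>_eqI: "c = d" if "\<rho> c = \<rho> d" for c d
    using that \<rho>_inj by (simp add: inj_eq)
  have \<iota>_eqI: "c = d" if "\<iota> c = \<iota> d" for c d
    using that \<iota>_inj by (simp add: inj_eq)
  show "\<epsilon>' (a * b) = \<epsilon>' a * \<epsilon>' b"
    by (rule \<rho>_eqI) (simp add: \<epsilon>' \<rho>.hom_mult \<iota>.hom_mult counit.hom_mult)
  show "\<epsilon>' 1 = 1"
    by (rule \<rho>_eqI) (simp add: \<epsilon>')
  show "\<epsilon>' (a + b) = \<epsilon>' a + \<epsilon>' b"
    by (rule \<rho>_eqI) (simp add: \<epsilon>' \<rho>.hom_add \<iota>.hom_add counit.hom_add)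
  show "\<epsilon>' (scale c a) = c * \<epsilon>' a"
    by (rule \<rho>_eqI) (simp add: \<epsilon>' \<rho>.hom_mult \<iota>_scale counit.hom_mult counit.of_poly)
  show "S' (a + b) = S' a + S' b"
    by (rule \<iota>_eqI) (simp add: S' \<iota>.hom_add antipode.add)
  show "S' (scale c a) = scale c (S' a)"
    by (rule \<iota>_eqI) (simp add: S' \<iota>_scale antipode.of_poly)
  show "(linear_extension free_scale (\<lambda>(b, c).
         linear_extension free_scale (\<lambda>(b1, b2). single (b1, b2, c) 1) (d b)) x,
       linear_extension free_scale (\<lambda>(b, c).
         linear_extension free_scale (\<lambda>(c1, c2). single (b, c1, c2) 1) (d c)) x)
      \<in> tensor3_rel scale" if x: "x \<in> \<Delta>' a" and "\<And>b. d b \<in> \<Delta>' b" for d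
  proof (rule tensor3_reflect)
    \<comment> \<open>A choice \<open>d\<close> of representatives enters only through the elements
      they represent, which are the coproducts given by \<open>\<delta>\<close>.\<close>
    have d: "tensor_map \<iota> \<rho> (d b) = \<delta> (\<iota> b)" for b
      using that(2) by (simp add: \<Delta>'_def)
    have "tensor3_map \<iota> \<rho> (linear_extension free_scale (\<lambda>(b, c).
        linear_extension free_scale (\<lambda>(b1, b2). single (b1, b2, c) 1) (d b)) x)
      = algebra_extension (\<lambda>c. Uct3_of_poly (\<rho> c)) (\<lambda>(b, c). emb12 (\<delta> (\<iota> b)) * tens3 1 1 (\<iota> c)) x"
      unfolding tensor3_map_def central_hom.extension_linear_extension[OF \<kappa>3]
      unfolding tensor3_map_def[symmetric]
      by (rule arg_cong[where f = "\<lambda>g. algebra_extension (\<lambda>c. Uct3_of_poly (\<rho> c)) g x"])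
        (auto simp: fun_eq_iff tensor3_map_left d)
    also have "\<dots> = comult_left \<delta> (tensor_map \<iota> \<rho> x)"
      by (simp only: structure_tensor_map)
    also have "\<dots> = comult_right \<delta> (tensor_map \<iota> \<rho> x)"
      using x by (simp add: \<Delta>'_def coassoc)
    also have "\<dots> = algebra_extension (\<lambda>c. Uct3_of_poly (\<rho> c)) (\<lambda>(b, c). tens3 (\<iota> b) 1 1 * emb23 (\<delta> (\<iota> c))) x"
      by (simp only: structure_tensor_map)
    also have "\<dots> = tensor3_map \<iota> \<rho> (linear_extension free_scale (\<lambda>(b, c).
        linear_extension free_scale (\<lambda>(c1, c2). single (b, c1, c2) 1) (d c)) x)"
      unfolding tensor3_map_def central_hom.extension_linear_extension[OF \<kappa>3]
      unfolding tensor3_map_def[symmetric]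
      by (rule arg_cong[where f = "\<lambda>g. algebra_extension (\<lambda>c. Uct3_of_poly (\<rho> c)) g x"])
        (auto simp: fun_eq_iff tensor3_map_right d)
    finally show "tensor3_map \<iota> \<rho> (linear_extension free_scale (\<lambda>(b, c).
        linear_extension free_scale (\<lambda>(b1, b2). single (b1, b2, c) 1) (d b)) x)
      = tensor3_map \<iota> \<rho> (linear_extension free_scale (\<lambda>(b, c).
        linear_extension free_scale (\<lambda>(c1, c2). single (b, c1, c2) 1) (d c)) x)" .
  qed
  assume x: "x \<in> \<Delta>' a"
  then have x: "tensor_map \<iota> \<rho> x = \<delta> (\<iota> a)"
    by (simp add: \<Delta>'_def)
  show "linear_extension scale (\<lambda>(b, c). scale (\<epsilon>' b) c) x = a"
    using structure_tensor_map(3)[of x, unfolded x counit_left]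
    by (intro \<iota>_eqI) (simp add: \<iota>_linear_extension case_prod_unfold \<iota>_scale \<epsilon>')
  show "linear_extension scale (\<lambda>(b, c). scale (\<epsilon>' c) b) x = a"
    using structure_tensor_map(4)[of x, unfolded x counit_right]
    by (intro \<iota>_eqI) (simp add: \<iota>_linear_extension case_prod_unfold \<iota>_scale \<epsilon>')
  show "linear_extension scale (\<lambda>(b, c). S' b * c) x = scale (\<epsilon>' a) 1"
    using structure_tensor_map(5)[of x, unfolded x antipode_left]
    by (intro \<iota>_eqI) (simp add: \<iota>_linear_extension case_prod_unfold \<iota>_scale \<epsilon>' \<iota>.hom_mult S')
  show "linear_extension scale (\<lambda>(b, c). b * S' c) x = scale (\<epsilon>' a) 1"
    using structure_tensor_map(6)[of x, unfolded x antipode_right]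
    by (intro \<iota>_eqI) (simp add: \<iota>_linear_extension case_prod_unfold \<iota>_scale \<epsilon>' \<iota>.hom_mult S')
qed (simp_all add: algebra_simps)

end


section \<open>Reduction at \<open>t = 0\<close>\<close>

lemma reduction_const [simp]: "reduction (Uct_const a) = a"
  by (simp add: reduction_def Uct_const_def)

lemma reduction_D [simp]: "reduction (Uct_D k) = Uc_D k"
  by (simp add: Uct_D_def)

lemma reduction_t [simp]: "reduction Uct_t = 0"
  by (simp add: reduction_def Uct_t_def lookup_single)

interpretation reduction: Ring_Hom.ring_hom reduction
proof unfold_locales
  show "reduction (x + y) = reduction x + reduction y" for x y
    by (simp add: reduction_def lookup_add)
  show "reduction (x * y) = reduction x * reduction y" for x y
    by (rule poly_mapping_mult_eqI) (auto simp: reduction_def lookup_add mult_single lookup_single when_def)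
qed (simp_all add: reduction_def lookup_one)

interpretation Uct_const: Ring_Hom.ring_hom Uct_const by (rule ring_hom_Uct_const)

lemma reduction_of_poly:
  fixes c :: "'p::prime_card mod_ring poly"
  shows "reduction (Uct_of_poly c) = cst (poly c 0)"
proof (rule Uct_hom_of_poly[OF reduction.ring_hom_axioms])
  interpret cst: Ring_Hom.ring_hom "cst :: 'p mod_ring \<Rightarrow> 'p Uc" by (rule ring_hom_cst[OF of_nat_card_Uc])
  show "Ring_Hom.ring_hom (\<lambda>c :: 'p mod_ring poly. cst (poly c 0) :: 'p Uc)"
    by unfold_locales (simp_all add: cst.hom_add cst.hom_mult)
qed (simp add: cst_def)

lemma reduction_scale: "reduction (Uct_scale c a) = Uc_scale (poly c 0) (reduction a)"
  by (simp add: Uct_scale_eq Uc_scale_def Uc_const_cst reduction.hom_mult reduction_of_poly)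

lemma semilinear_extension_add:
  assumes "Ring_Hom.ring_hom \<rho>"
  shows "linear_extension (\<lambda>c. free_scale (\<rho> c)) g (x + y)
    = linear_extension (\<lambda>c. free_scale (\<rho> c)) g x + linear_extension (\<lambda>c. free_scale (\<rho> c)) g y"
proof -
  interpret Ring_Hom.ring_hom \<rho> by fact
  show ?thesis
    by (rule linear_extension_plus) (simp_all add: hom_add free_scale.scale_left_distrib)
qed

lemma semilinear_extension_single:
  assumes "Ring_Hom.ring_hom \<rho>"
  shows "linear_extension (\<lambda>c. free_scale (\<rho> c)) g (single k c) = free_scale (\<rho> c) (g k)"
proof -
  interpret Ring_Hom.ring_hom \<rho> by fact
  show ?thesis by (rule linear_extension_single) simp
qed

lemma semilinear_extension_span:
  assumes \<rho>: "Ring_Hom.ring_hom \<rho>"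
    and R: "\<And>r. r \<in> R \<Longrightarrow> linear_extension (\<lambda>c. free_scale (\<rho> c)) g r \<in> R'"
    and "x - y \<in> free_scale.span R"
  shows "linear_extension (\<lambda>c. free_scale (\<rho> c)) g x - linear_extension (\<lambda>c. free_scale (\<rho> c)) g y
    \<in> free_scale.span R'"
proof -
  interpret Ring_Hom.ring_hom \<rho> by (rule \<rho>)
  let ?f = "linear_extension (\<lambda>c. free_scale (\<rho> c)) g"
  have scale: "?f (free_scale c z) = free_scale (\<rho> c) (?f z)" for c z
    by (induction z rule: poly_mapping_sum_induct)
      (simp_all add: semilinear_extension_add[OF \<rho>] semilinear_extension_single[OF \<rho>] hom_mult
        free_scale.scale_right_distrib)
  have "?f z \<in> free_scale.span R'" if "z \<in> free_scale.span R" for z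
    using that
    by (induction rule: free_scale.span_induct_alt)
      (simp_all add: semilinear_extension_add[OF \<rho>] scale free_scale.span_zero
        free_scale.span_add free_scale.span_scale free_scale.span_base R)
  from this[OF assms(3)] show ?thesis
    using semilinear_extension_add[OF \<rho>, of g "x - y" y] by simp
qed

lemma ring_hom_poly_0: "Ring_Hom.ring_hom (\<lambda>c :: 'r::comm_ring_1 poly. poly c 0)"
  by unfold_locales simp_all

lemma ring_hom_const_poly: "Ring_Hom.ring_hom (\<lambda>c :: 'r::comm_ring_1. [:c:])"
  by unfold_locales (simp_all add: one_pCons)

lemmas reduction_single = semilinear_extension_single[OF ring_hom_poly_0]

lemma semilinear_extension_diff:
  assumes "Ring_Hom.ring_hom \<rho>"
  shows "linear_extension (\<lambda>c. free_scale (\<rho> c)) g (x - y)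
    = linear_extension (\<lambda>c. free_scale (\<rho> c)) g x - linear_extension (\<lambda>c. free_scale (\<rho> c)) g y"
  using semilinear_extension_add[OF assms, of g "x - y" y] by simp

text \<open>Setting \<open>t = 0\<close> sends each bilinearity relator over \<open>Uct\<close> to
  one over \<open>Uc\<close>, so it descends to tensor classes.\<close>

lemma tensor_reduction_rel:
  assumes "x - y \<in> free_scale.span (tensor_relators Uct_scale)"
  shows "tensor_reduction x - tensor_reduction y \<in> free_scale.span (tensor_relators Uc_scale)"
  unfolding tensor_reduction_def
proof (rule semilinear_extension_span[OF ring_hom_poly_0 _ assms])
  show "linear_extension (\<lambda>c. free_scale (poly c 0)) (\<lambda>(a, b). single (reduction a, reduction b) 1) r
      \<in> tensor_relators Uc_scale" if "r \<in> tensor_relators Uct_scale" for r :: "'a Uct \<times> 'a Uct \<Rightarrow>\<^sub>0 'a mod_ring poly"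
    using that by (cases rule: tensor_relators_cases)
      (simp_all add: semilinear_extension_diff[OF ring_hom_poly_0] reduction_single reduction.hom_add
        reduction_scale tensor_relators_intros)
qed

definition tensor3_reduction ::
    "('p::prime_card Uct \<times> 'p Uct \<times> 'p Uct \<Rightarrow>\<^sub>0 'p mod_ring poly) \<Rightarrow> ('p Uc \<times> 'p Uc \<times> 'p Uc \<Rightarrow>\<^sub>0 'p mod_ring)"
  where "tensor3_reduction = linear_extension (\<lambda>f. free_scale (poly f 0))
      (\<lambda>(a, b, c). single (reduction a, reduction b, reduction c) 1)"

lemma tensor3_reduction_rel:
  assumes "x - y \<in> free_scale.span (tensor3_relators Uct_scale)"
  shows "tensor3_reduction x - tensor3_reduction y \<in> free_scale.span (tensor3_relators Uc_scale)"
  unfolding tensor3_reduction_def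
proof (rule semilinear_extension_span[OF ring_hom_poly_0 _ assms])
  show "linear_extension (\<lambda>c. free_scale (poly c 0)) (\<lambda>(a, b, c). single (reduction a, reduction b, reduction c) 1) r
      \<in> tensor3_relators Uc_scale"
    if "r \<in> tensor3_relators Uct_scale" for r :: "'a Uct \<times> 'a Uct \<times> 'a Uct \<Rightarrow>\<^sub>0 'a mod_ring poly"
    using that by (cases rule: tensor3_relators_cases)
      (simp_all add: semilinear_extension_diff[OF ring_hom_poly_0] reduction_single reduction.hom_add
        reduction_scale tensor3_relators_intros)
qed

lemma Uct2_eq_tensor_rel: "abs_Uct2 x = abs_Uct2 y \<longleftrightarrow> (x, y) \<in> tensor_rel Uct_scale"
  by (simp add: tensor_rel_def Uct2.abs_eq_iff)

lemma Uct3_eq_tensor3_rel: "abs_Uct3 x = abs_Uct3 y \<longleftrightarrow> (x, y) \<in> tensor3_rel Uct_scale"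
  by (simp add: tensor3_rel_def Uct3.abs_eq_iff)

lemma tensor_map_id: "tensor_map (\<lambda>a. a) (\<lambda>c. c) = abs_Uct2" "tensor3_map (\<lambda>a. a) (\<lambda>c. c) = abs_Uct3"
  by (simp_all add: fun_eq_iff tensor_map_def tensor3_map_def abs_Uct2_eq abs_Uct3_eq)

lemma surj_abs_Uct2: "\<exists>x. abs_Uct2 x = y"
  by (induction y rule: Uct2.abs_induct) blast

lemma hopf_embedding_id:
  assumes "uct_hopf \<delta> \<epsilon> S"
  shows "hopf_embedding (Uct_scale :: 'p::prime_card mod_ring poly \<Rightarrow> _) \<delta> \<epsilon> S (\<lambda>a. a) (\<lambda>c. c) \<epsilon> S"
  using assoc_algebra_Uct assms
  by (intro hopf_embedding.intro hopf_embedding_axioms.intro)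
    (simp_all add: ring_hom_id Uct_scale_eq tensor_map_id surj_abs_Uct2 Uct2_eq_tensor_rel Uct3_eq_tensor3_rel inj_on_def)

lemma Uct_const_scale: "Uct_const (Uc_scale c a) = Uct_of_poly [:c:] * Uct_const a"
  by (simp add: Uc_scale_def Uc_const_cst Uct_const.hom_mult Uct_const.hom_cst)

text \<open>A section of \<open>tensor_reduction\<close> already on formal tensors. An equality of
  constant tensors over \<open>Uct\<close> is therefore reduced to an equality of the original
  tensors over \<open>Uc\<close>.\<close>

definition const_tensor :: "('p::prime_card Uc \<times> 'p Uc \<Rightarrow>\<^sub>0 'p mod_ring) \<Rightarrow> ('p Uct \<times> 'p Uct \<Rightarrow>\<^sub>0 'p mod_ring poly)"
  where "const_tensor = linear_extension (\<lambda>c. free_scale [:c:]) (\<lambda>(a, b). single (Uct_const a, Uct_const b) 1)"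

definition const_tensor3 ::
    "('p::prime_card Uc \<times> 'p Uc \<times> 'p Uc \<Rightarrow>\<^sub>0 'p mod_ring) \<Rightarrow> ('p Uct \<times> 'p Uct \<times> 'p Uct \<Rightarrow>\<^sub>0 'p mod_ring poly)"
  where "const_tensor3
    = linear_extension (\<lambda>c. free_scale [:c:]) (\<lambda>(a, b, c). single (Uct_const a, Uct_const b, Uct_const c) 1)"

lemmas const_extension_simps =
  semilinear_extension_add[OF ring_hom_const_poly] semilinear_extension_single[OF ring_hom_const_poly]
  semilinear_extension_add[OF ring_hom_poly_0] semilinear_extension_single[OF ring_hom_poly_0]

lemma reduction_const_tensor:
  "tensor_reduction (const_tensor x) = x" "tensor3_reduction (const_tensor3 y) = y"
proof -
  show "tensor_reduction (const_tensor x) = x"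
    by (induction x rule: poly_mapping_sum_induct)
      (auto simp: tensor_reduction_def const_tensor_def const_extension_simps)
  show "tensor3_reduction (const_tensor3 y) = y"
    by (induction y rule: poly_mapping_sum_induct)
      (auto simp: tensor3_reduction_def const_tensor3_def const_extension_simps)
qed

lemmas const_poly_central_hom = central_hom_comp[OF central_hom_Uct2_of_poly ring_hom_const_poly]
  central_hom_comp[OF central_hom_Uct3_of_poly ring_hom_const_poly]

lemmas const_poly_extension_simps =
  central_hom.extension_zero[OF const_poly_central_hom(1)] central_hom.extension_single[OF const_poly_central_hom(1)]
  central_hom.extension_add[OF const_poly_central_hom(1)]
  central_hom.extension_zero[OF const_poly_central_hom(2)] central_hom.extension_single[OF const_poly_central_hom(2)]
  central_hom.extension_add[OF const_poly_central_hom(2)]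

lemma abs_const_tensor:
  "abs_Uct2 (const_tensor x) = tensor_map Uct_const (\<lambda>c. [:c:]) x"
  "abs_Uct3 (const_tensor3 y) = tensor3_map Uct_const (\<lambda>c. [:c:]) y"
proof -
  show "abs_Uct2 (const_tensor x) = tensor_map Uct_const (\<lambda>c. [:c:]) x"
    by (induction x rule: poly_mapping_sum_induct)
      (auto simp: const_tensor_def tensor_map_def const_extension_simps abs_Uct2_simps abs_Uct2_single
        const_poly_extension_simps)
  show "abs_Uct3 (const_tensor3 y) = tensor3_map Uct_const (\<lambda>c. [:c:]) y"
    by (induction y rule: poly_mapping_sum_induct)
      (auto simp: const_tensor3_def tensor3_map_def const_extension_simps abs_Uct3_simps abs_Uct3_single
        const_poly_extension_simps)
qed

text \<open>Coproducts of constants need representatives with constant entries and constant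
  coefficients to define a coproduct on \<open>Uc\<close>. They exist for the generators, and sums
  and products of such representatives are again of this kind.\<close>

lemma std_comult_const_range: "\<exists>x. tensor_map Uct_const (\<lambda>c. [:c:]) x = std_comult (Uct_const a)"
proof (induction a rule: Uc_induct)
  case (const c)
  show ?case
    by (rule exI[of _ "single (1, 1) c"], simp add: tensor_map_def const_poly_extension_simps Uct_const.hom_cst std_comult.hom_cst)
      (simp add: Uct2_of_poly_const)
next
  case (D k)
  show ?case
    by (rule exI[of _ "single (Uc_D k, 1) 1 + single (1, Uc_D k) 1"])
      (simp add: tensor_map_def const_poly_extension_simps flip: Uct_D_def one_pCons)
next
  case (plus a b)
  then obtain x y where "tensor_map Uct_const (\<lambda>c. [:c:]) x = std_comult (Uct_const a)"
    "tensor_map Uct_const (\<lambda>c. [:c:]) y = std_comult (Uct_const b)" by blast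
  then show ?case
    by (intro exI[of _ "x + y"]) (simp add: tensor_map_def const_poly_extension_simps Uct_const.hom_add std_comult.hom_add)
next
  case (times a b)
  then obtain x y where "tensor_map Uct_const (\<lambda>c. [:c:]) x = std_comult (Uct_const a)"
    "tensor_map Uct_const (\<lambda>c. [:c:]) y = std_comult (Uct_const b)" by blast
  moreover have "tensor_map Uct_const (\<lambda>c. [:c:]) (monoid_algebra_mult x y)
      = tensor_map Uct_const (\<lambda>c. [:c:]) x * tensor_map Uct_const (\<lambda>c. [:c:]) y"
    unfolding tensor_map_def
    by (rule central_hom.extension_mult[OF const_poly_central_hom(1)]) (auto simp: Uct_const.hom_mult tens_mult)
  ultimately show ?case
    by (intro exI[of _ "monoid_algebra_mult x y"]) (simp add: Uct_const.hom_mult std_comult.hom_mult)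
qed

lemma std_counit_const: "[:poly (std_counit (Uct_const a)) 0:] = std_counit (Uct_const a)"
proof (induction a rule: Uc_induct)
  case (const c)
  have "std_counit (Uct_const (cst c)) = [:c:]"
    using std_counit_of_poly[of "[:c:]"] by (simp add: Uct_const.hom_cst)
  then show ?case by simp
next
  case (D k)
  show ?case by (simp flip: Uct_D_def)
next
  case (plus a b)
  have "[:c + d:] = [:c:] + [:d:]" for c d :: "'a mod_ring" by simp
  then show ?case by (simp only: Uct_const.hom_add std_counit.hom_add poly_add plus)
next
  case (times a b)
  have "[:c * d:] = [:c:] * [:d:]" for c d :: "'a mod_ring" by simp
  then show ?case by (simp only: Uct_const.hom_mult std_counit.hom_mult poly_mult times)
qed

lemma std_antipode_const:
  fixes a :: "'p::prime_card Uc"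
  assumes odd_p: "odd CARD('p)"
  shows "Uct_const (reduction (std_antipode (Uct_const a))) = std_antipode (Uct_const a)"
proof (induction a rule: Uc_induct)
  case (D k)
  show ?case
    unfolding Uct_D_def[symmetric]
    by (simp add: std_antipode[OF odd_p] reduction.hom_uminus Uct_const.hom_uminus) (simp add: Uct_D_def)
qed (simp_all add: Uct_const.hom_cst Uct_const.hom_add Uct_const.hom_mult std_antipode[OF odd_p]
    reduction.hom_cst reduction.hom_add reduction.hom_mult)

lemma hopf_embedding_const:
  assumes odd_p: "odd CARD('p)"
  shows "hopf_embedding Uc_scale std_comult std_counit (std_antipode :: 'p::prime_card Uct \<Rightarrow> _)
    Uct_const (\<lambda>c. [:c:]) (\<lambda>a. poly (std_counit (Uct_const a)) 0)
    (\<lambda>a. reduction (std_antipode (Uct_const a)))"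
proof (intro hopf_embedding.intro hopf_embedding_axioms.intro)
  show "assoc_algebra (Uc_scale :: 'p mod_ring \<Rightarrow> _)"
    by (rule assoc_algebra_Uc)
  show "uct_hopf std_comult std_counit (std_antipode :: 'p Uct \<Rightarrow> _)"
    by (rule uct_hopf_std[OF odd_p])
  show "inj (Uct_const :: 'p Uc \<Rightarrow> _)"
    by (rule inj_on_inverseI[of _ reduction]) simp
  show "(x, y) \<in> tensor_rel Uc_scale"
    if "tensor_map Uct_const (\<lambda>c. [:c:]) x = tensor_map Uct_const (\<lambda>c. [:c:]) y" for x y :: "'p Uc \<times> 'p Uc \<Rightarrow>\<^sub>0 'p mod_ring"
    using that tensor_reduction_rel[of "const_tensor x" "const_tensor y"]
    by (simp add: tensor_rel_def reduction_const_tensor Uct2.abs_eq_iff flip: abs_const_tensor)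
  show "(x, y) \<in> tensor3_rel Uc_scale"
    if "tensor3_map Uct_const (\<lambda>c. [:c:]) x = tensor3_map Uct_const (\<lambda>c. [:c:]) y"
    for x y :: "'p Uc \<times> 'p Uc \<times> 'p Uc \<Rightarrow>\<^sub>0 'p mod_ring"
    using that tensor3_reduction_rel[of "const_tensor3 x" "const_tensor3 y"]
    by (simp add: tensor3_rel_def reduction_const_tensor Uct3.abs_eq_iff flip: abs_const_tensor)
qed (simp_all add: ring_hom_Uct_const ring_hom_const_poly Uct_const_scale inj_on_def std_counit_const
    std_antipode_const[OF odd_p] std_comult_const_range)


section \<open>The deformation\<close>

text \<open>Setting \<open>t = 0\<close> and re-embedding as constants, done on formal tensors, is
  the map on \<open>Uct2\<close> induced by doing so in each factor. This allows the reduction to be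
  computed on classes.\<close>

lemma tensor_map_tensor_reduction:
  fixes x :: "'p::prime_card Uct \<times> 'p Uct \<Rightarrow>\<^sub>0 'p mod_ring poly"
  defines "\<kappa> \<equiv> \<lambda>c :: 'p mod_ring poly. Uct2_of_poly [:poly c 0:]"
    and "g \<equiv> \<lambda>a b :: 'p Uct. tens (Uct_const (reduction a)) (Uct_const (reduction b))"
  shows "central_hom \<kappa>" "bilinear_map Uct_scale \<kappa> g"
    "tensor_map Uct_const (\<lambda>c. [:c:]) (tensor_reduction x) = tensor_extension \<kappa> g (abs_Uct2 x)"
proof -
  show \<kappa>: "central_hom \<kappa>"
    unfolding \<kappa>_def by (rule central_hom_comp[OF const_poly_central_hom(1) ring_hom_poly_0])
  show g: "bilinear_map Uct_scale \<kappa> g"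
    by (simp add: bilinear_map_def g_def \<kappa>_def reduction.hom_add Uct_const.hom_add tens_add reduction_scale
        Uct_const_scale tens_scale del: Uct_of_poly_simps)
  have \<kappa>_eq: "Uct2_of_poly [:poly c 0:] = \<kappa> c" for c
    by (simp add: \<kappa>_def)
  have "tensor_map Uct_const (\<lambda>c. [:c:]) (tensor_reduction x) = algebra_extension \<kappa> (\<lambda>(a, b). g a b) x"
    by (induction x rule: poly_mapping_sum_induct)
      (auto simp: tensor_map_def tensor_reduction_def const_extension_simps const_poly_extension_simps
        central_hom.extension_zero[OF \<kappa>] central_hom.extension_add[OF \<kappa>] central_hom.extension_single[OF \<kappa>]
        g_def \<kappa>_eq)
  then show "tensor_map Uct_const (\<lambda>c. [:c:]) (tensor_reduction x) = tensor_extension \<kappa> g (abs_Uct2 x)"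
    by (simp add: tensor_extension_abs[OF \<kappa> g])
qed

lemma atLeastAtMost_card: "{0..CARD('p::finite) - Suc 0} = {..<CARD('p)}"
proof -
  obtain m where "CARD('p) = Suc m"
    by (metis Suc_pred zero_less_card_finite)
  then show ?thesis
    by (simp add: atLeast0AtMost lessThan_Suc_atMost)
qed

section \<open>Comparison with the standard structure at \<open>t = 0\<close>\<close>

context witt_twist
begin

lemma const_reduction_P: "Uct_const (reduction (P a)) = P a"
proof -
  have "Uct_const (reduction h) = h"
    by (simp add: h_def reduction.hom_mult Uct_const.hom_mult reduction.hom_cst Uct_const.hom_cst flip: Uct_D_def)
  then show ?thesis
    by (simp add: P_def reduction.hom_idem Uct_const.hom_idem)
qed

lemma reduction_W: "reduction (W a) = 1" "reduction (W' a) = 1"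
proof -
  have "reduction w = 1" "reduction w' = 1"
    by (simp_all add: w_def w'_def reduction.hom_minus reduction.hom_add reduction.hom_mult)
  then show "reduction (W a) = 1" "reduction (W' a) = 1"
    by (simp_all add: W_def W'_def mod_power_def reduction.hom_power)
qed

text \<open>The idempotents \<open>P a\<close> are constant and \<open>w\<close> becomes 1 at
  \<open>t = 0\<close>, so \<open>F\<close> and its inverse both become 1. What is left are two ring
  homomorphisms that agree on the \<open>D_k\<close> and on \<open>t\<close>.\<close>

lemma comult_reduction:
  assumes "abs_Uct2 x = comult a"
  shows "tensor_map Uct_const (\<lambda>c. [:c:]) (tensor_reduction x) = std_comult (Uct_const (reduction a))"
proof -
  define r where "r a = Uct_const (reduction a)" for a :: "'p Uct"
  define R where "R = tensor_extension (\<lambda>c :: 'p mod_ring poly. Uct2_of_poly [:poly c 0:])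
    (\<lambda>a b :: 'p Uct. tens (Uct_const (reduction a)) (Uct_const (reduction b)))"
  note R_spec = tensor_map_tensor_reduction(1,2)[where 'p='p]
  have R_tens: "R (tens a b) = tens (r a) (r b)" for a b
    by (simp add: R_def r_def tensor_extension_tens[OF R_spec])
  have "Ring_Hom.ring_hom R"
    unfolding R_def by (rule tensor_extension_ring_hom[OF R_spec])
      (simp_all add: reduction.hom_mult Uct_const.hom_mult tens_mult)
  then interpret R: Ring_Hom.ring_hom R .
  have r_P: "r (P a) = P a" and r_W: "r (W a) = 1" for a
    by (simp_all add: r_def const_reduction_P reduction_W)
  have R_F: "R F = 1" "R F_inv = 1"
    by (simp_all add: F_def F_inv_def R.hom_sum R_tens r_P r_W sum_P flip: tens_left.sum)
  have "R (comult a) = std_comult (r a)"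
  proof (rule Uct_hom_eqI[OF ring_hom_comp[OF R.ring_hom_axioms ring_hom_comult]
        ring_hom_comp[OF std_comult.ring_hom_axioms]])
    show "Ring_Hom.ring_hom r"
      unfolding r_def[abs_def] by (rule ring_hom_comp[OF Uct_const.ring_hom_axioms reduction.ring_hom_axioms])
    show "R (comult (Uct_D k)) = std_comult (r (Uct_D k))" for k
      by (simp add: comult_def R.hom_mult R_F R.hom_add R_tens)
        (simp add: r_def flip: Uct_D_def)
    show "R (comult Uct_t) = std_comult (r Uct_t)"
      using comult_of_poly[of "[:0, 1:]"] by (simp add: Uct2_of_poly_tens R_tens r_def tens_left.zero)
  qed
  then show ?thesis
    using tensor_map_tensor_reduction(3)[of x] by (simp add: R_def r_def assms)
qed

lemma counit_reduction:
  fixes a :: "'p Uct"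
  shows "poly (std_counit a) 0 = poly (std_counit (Uct_const (reduction a))) 0"
proof (rule Uct_hom_eqI[where f = "\<lambda>a :: 'p Uct. poly (std_counit a) 0"
      and g = "\<lambda>a :: 'p Uct. poly (std_counit (Uct_const (reduction a))) 0"])
  show "Ring_Hom.ring_hom (\<lambda>a :: 'p Uct. poly (std_counit a) 0)"
    by (rule ring_hom_comp[OF ring_hom_poly_0 std_counit.ring_hom_axioms])
  show "Ring_Hom.ring_hom (\<lambda>a :: 'p Uct. poly (std_counit (Uct_const (reduction a))) 0)"
    by (intro ring_hom_comp[OF ring_hom_poly_0] ring_hom_comp[OF std_counit.ring_hom_axioms]
        ring_hom_comp[OF Uct_const.ring_hom_axioms] reduction.ring_hom_axioms)
qed (simp_all flip: Uct_D_def)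

text \<open>At \<open>t = 0\<close> both \<open>u\<close> and \<open>v\<close> become the sum of all
  \<open>P a\<close>, which is 1, so the conjugation disappears.\<close>

lemma antipode_reduction: "reduction (antipode a) = reduction (std_antipode (Uct_const (reduction a)))"
proof -
  have "reduction u = reduction (\<Sum>a\<in>UNIV. P a)" "reduction v = reduction (\<Sum>a\<in>UNIV. P a)"
    by (simp_all add: u_def v_def reduction.hom_sum reduction.hom_mult reduction_W)
  then have "reduction (antipode a) = reduction (std_antipode a)"
    by (simp add: antipode_def reduction.hom_mult sum_P)
  also have "\<dots> = reduction (std_antipode (Uct_const (reduction a)))"
  proof (induction a rule: Uct_gen_induct)
    case (D k)
    show ?case by (simp flip: Uct_D_def)
  next
    case t
    show ?case
      using std_antipode_of_poly[OF odd_p, of 0] by (simp add: std_antipode_simps)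
  qed (simp_all add: std_antipode_simps reduction.hom_cst Uct_const.hom_cst reduction.hom_add Uct_const.hom_add
      reduction.hom_mult Uct_const.hom_mult)
  finally show ?thesis .
qed

sublocale deformed: hopf_embedding Uct_scale comult std_counit antipode "\<lambda>a. a" "\<lambda>c. c" std_counit antipode
  by (rule hopf_embedding_id[OF uct_hopf_twist])

sublocale standard: hopf_embedding Uc_scale std_comult std_counit "std_antipode :: 'p Uct \<Rightarrow> _"
    Uct_const "\<lambda>c. [:c:]" "\<lambda>a. poly (std_counit (Uct_const a)) 0" "\<lambda>a. reduction (std_antipode (Uct_const a))"
  by (rule hopf_embedding_const[OF odd_p])

lemma polynomial_deformation_twist: "polynomial_deformation deformed.\<Delta>' std_counit antipode"
  unfolding polynomial_deformation_def
proof (intro conjI exI allI ballI)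
  show "hopf_algebra Uct_scale deformed.\<Delta>' std_counit antipode"
    by (rule deformed.hopf_algebra)
  show "standard_hopf_structure standard.\<Delta>' (\<lambda>a. poly (std_counit (Uct_const a)) 0)
      (\<lambda>a. reduction (std_antipode (Uct_const a)))"
    unfolding standard_hopf_structure_def
  proof (intro conjI allI)
    show "hopf_algebra Uc_scale standard.\<Delta>' (\<lambda>a. poly (std_counit (Uct_const a)) 0)
      (\<lambda>a. reduction (std_antipode (Uct_const a)))"
      by (rule standard.hopf_algebra)
    show "standard.\<Delta>' (Uc_D k) = tensor_class Uc_scale (single (Uc_D k, 1) 1 + single (1, Uc_D k) 1)" for k
      by (rule standard.comult_eq_class)
        (simp add: tensor_map_def const_poly_extension_simps flip: Uct_D_def one_pCons)
  qed
  show "tensor_reduction x \<in> standard.\<Delta>' (reduction a)" if "x \<in> deformed.\<Delta>' a" for a x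
    using that by (simp add: deformed.\<Delta>'_def standard.\<Delta>'_def tensor_map_id comult_reduction)
qed (rule counit_reduction antipode_reduction)+

lemma abs_Uct2_sum: "abs_Uct2 (sum f A) = (\<Sum>a\<in>A. abs_Uct2 (f a))"
  by (induction A rule: infinite_finite_induct) (simp_all add: abs_Uct2_simps)

lemma deformed_comult_D:
  "deformed.\<Delta>' (Uct_D k) = tensor_class Uct_scale
    (single (Uct_D k, W (k / i)) 1
      + (\<Sum>l = 0..CARD('p) - 1. single (rising h l, W (- of_nat l) * Uct_D (k + of_nat l * i) * Uct_t ^ l)
          [:(- 1) ^ l * N i (k - i) l:]))"
proof (rule deformed.comult_eq_class)
  show "tensor_map (\<lambda>a. a) (\<lambda>c. c) (single (Uct_D k, W (k / i)) 1
      + (\<Sum>l = 0..CARD('p) - 1. single (rising h l, W (- of_nat l) * Uct_D (k + of_nat l * i) * Uct_t ^ l)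
          [:(- 1) ^ l * N i (k - i) l:])) = comult (Uct_D k)"
    by (simp add: tensor_map_id comult_D abs_Uct2_simps abs_Uct2_sum abs_Uct2_single atLeastAtMost_card)
qed

lemma deformed_antipode_D:
  "antipode (Uct_D k) = - (W (- (k / i)) * (\<Sum>l = 0..CARD('p) - 1.
     Uct_scale [:N i (k - i) l:] (Uct_D (k + of_nat l * i) * rising (h + 1) l * Uct_t ^ l)))"
proof -
  show ?thesis
    by (simp add: antipode_D Uct_scale_eq atLeastAtMost_card)
qed

end

theorem theorem2:
  fixes i :: "'p::prime_card mod_ring"
    and h e t :: "'p Uct"
  assumes odd_p: "odd CARD('p)"
    and i: "i \<noteq> 0"
    and h: "h = Uct_scale [:1 / i:] (Uct_D 0)"
    and e: "e = Uct_scale [:i:] (Uct_D i)"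
    and t: "t = Uct_t"
  shows "\<exists>\<Delta> S \<epsilon>. polynomial_deformation \<Delta> \<epsilon> S \<and>
    (\<forall>k. \<Delta> (Uct_D k) = tensor_class Uct_scale
       (single (Uct_D k, mod_power (1 - e * t) (k / i)) 1
        + (\<Sum>l = 0..CARD('p) - 1.
             single (rising h l,
                     mod_power (1 - e * t) (- of_nat l :: 'p mod_ring) * Uct_D (k + of_nat l * i) * t ^ l)
               [:(- 1) ^ l * N i (k - i) l:]))) \<and>
    (\<forall>k. S (Uct_D k) =
       - (mod_power (1 - e * t) (- (k / i))
          * (\<Sum>l = 0..CARD('p) - 1.
               Uct_scale [:N i (k - i) l:] (Uct_D (k + of_nat l * i) * rising (h + 1) l * t ^ l)))) \<and>
    (\<forall>k. \<epsilon> (Uct_D k) = 0)"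
proof -
  interpret twist: witt_twist i
    by standard (use odd_p i in auto)
  have h: "h = twist.h" and e: "e = twist.e" and W: "mod_power (1 - e * t) = twist.W"
    by (simp_all add: h e t twist.h_def twist.e_def twist.w_def twist.W_def Uct_scale_eq)
  show ?thesis
    unfolding h W unfolding t
    by (intro exI conjI allI)
      (rule twist.polynomial_deformation_twist twist.deformed_comult_D twist.deformed_antipode_D std_counit_simps)+
qed

end
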